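(* Let $\mu$ be a critical offspring distribution on $\mathbb{Z}_+$ with infinite variance, in the domain of attraction of an $\alpha$-stable law for some $\alpha\in(1,2]$. Let $\mathcal{T}$ be a $\mu$-Galton–Watson tree and $\mathcal{A},\mathcal{B}\subset\mathbb{Z}_+$ with $\mu_{\mathcal{B}}>0$. For $n\ge1$ with $\mathbb{P}(N^{\mathcal{B}}(\mathcal{T})=n)>0$ let $\mathcal{T}^{\mathcal{B}}_n$ be $\mathcal{T}$ conditioned on $N^{\mathcal{B}}(\mathcal{T})=n$. Then, as $n\to\infty$ along such values: (i) $\frac1n\mathbb{E}(N^{\mathcal{A}}(\mathcal{T}^{\mathcal{B}}_n))\to\frac{\mu_{\mathcal{A}}}{\mu_{\mathcal{B}}}$; (ii) there exists $\delta_{\mathcal{A},\mathcal{B}}\ge0$ such that $\frac{N^{\mathcal{A}}(\mathcal{T}^{\mathcal{B}}_n)-n\mu_{\mathcal{A}}/\mu_{\mathcal{B}}}{\sqrt n}$ converges in distribution to a centered Gaussian with variance $\delta^2_{\mathcal{A},\mathcal{B}}$; moreover $\delta_{\mathcal{A},\mathcal{B}}=0$ iff $\mu_{\mathcal{A}}=0$ or $\mu_{\mathcal{A}\setminus\mathcal{B}}=\mu_{\mathcal{B}\setminus\mathcal{A}}=0$; (iii) for every $j\ge1$ and $\mathcal{A}_1,\dots,\mathcal{A}_j\subset\mathbb{Z}_+$, the vector $\big(\frac{N^{\mathcal{A}_i}(\mathcal{T}^{\mathcal{B}}_n)-n\mu_{\mathcal{A}_i}/\mu_{\mathcal{B}}}{\sqrt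 n}\big)_{1\le i\le j}$ converges in distribution to a Gaussian vector.
   Context: $\mu_i=\mu(\{i\})$, $\mu_{\mathcal{C}}=\sum_{i\in\mathcal{C}}\mu_i$; critical means mean $1$. $\mu$ with infinite variance is in the domain of attraction of an $\alpha$-stable law if there is a slowly varying function $L$ with $\mathrm{Var}(X\mathbb{1}_{X\le x})\sim x^{2-\alpha}L(x)$ as $x\to\infty$, $X\sim\mu$. A $\mu$-Galton–Watson tree is a random plane tree $\mathcal{T}$ with $\mathbb{P}(\mathcal{T}=T)=\prod_{u\in T}\mu_{k_u(T)}$, $k_u(T)$ the outdegree of $u$; $N^{\mathcal{C}}(T)$ is the number of vertices with outdegree in $\mathcal{C}$. *)

theory Defs
  imports "HOL-Probability.Probability"
begin

definition critical :: "nat pmf \<Rightarrow> bool" where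
  "critical \<mu> \<longleftrightarrow> integrable (measure_pmf \<mu>) (\<lambda>k. real k)
      \<and> measure_pmf.expectation \<mu> (\<lambda>k. real k) = 1"

definition infinite_variance :: "nat pmf \<Rightarrow> bool" where
  "infinite_variance \<mu> \<longleftrightarrow> \<not> integrable (measure_pmf \<mu>) (\<lambda>k. (real k)\<^sup>2)"

definition slowly_varying :: "(real \<Rightarrow> real) \<Rightarrow> bool" where
  "slowly_varying L \<longleftrightarrow> L \<in> borel_measurable borel
      \<and> (\<forall>\<^sub>F x in at_top. L x > 0)
      \<and> (\<forall>c>0. ((\<lambda>x. L (c * x) / L x) \<longlongrightarrow> 1) at_top)"

definition trunc_var :: "nat pmf \<Rightarrow> real \<Rightarrow> real" where
  "trunc_var \<mu> x = measure_pmf.variance \<mu> (\<lambda>k. if real k \<le> x then real k else 0)"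

definition stable_domain :: "nat pmf \<Rightarrow> real \<Rightarrow> bool" where
  "stable_domain \<mu> \<alpha> \<longleftrightarrow> (\<exists>L. slowly_varying L \<and>
      trunc_var \<mu> \<sim>[at_top] (\<lambda>x. x powr (2 - \<alpha>) * L x))"

datatype ptree = Node "ptree list"

fun outdeg :: "ptree \<Rightarrow> nat" where
  "outdeg (Node ts) = length ts"

fun NC :: "nat set \<Rightarrow> ptree \<Rightarrow> nat" where
  "NC C (Node ts) = (if length ts \<in> C then 1 else 0) + sum_list (map (NC C) ts)"

fun gw_weight :: "nat pmf \<Rightarrow> ptree \<Rightarrow> real" where
  "gw_weight \<mu> (Node ts) = pmf \<mu> (length ts) * prod_list (map (gw_weight \<mu>) ts)"

text \<open>The mu-Galton--Watson tree: P(T = t) = gw_weight mu t (for critical mu these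
  weights sum to 1 over finite plane trees).\<close>
definition gw_tree :: "nat pmf \<Rightarrow> ptree pmf" where
  "gw_tree \<mu> = embed_pmf (gw_weight \<mu>)"

definition gw_cond :: "nat pmf \<Rightarrow> nat set \<Rightarrow> nat \<Rightarrow> ptree pmf" where
  "gw_cond \<mu> B n = cond_pmf (gw_tree \<mu>) {t. NC B t = n}"

definition admissible :: "nat pmf \<Rightarrow> nat set \<Rightarrow> nat set" where
  "admissible \<mu> B = {n. n \<ge> 1 \<and> measure_pmf.prob (gw_tree \<mu>) {t. NC B t = n} > 0}"

definition along_admissible :: "nat pmf \<Rightarrow> nat set \<Rightarrow> nat filter" where
  "along_admissible \<mu> B = inf at_top (principal (admissible \<mu> B))"

definition conv_distr :: "'i filter \<Rightarrow> ('i \<Rightarrow> 'a::topological_space measure) \<Rightarrow> 'a measure \<Rightarrow> bool" where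
  "conv_distr F M N \<longleftrightarrow> (\<forall>f::'a \<Rightarrow> real. continuous_on UNIV f \<and> bounded (range f) \<longrightarrow>
      ((\<lambda>i. integral\<^sup>L (M i) f) \<longlongrightarrow> integral\<^sup>L N f) F)"

definition gaussian :: "real \<Rightarrow> real \<Rightarrow> real measure" where
  "gaussian m s = (if s = 0 then return borel m else density lborel (normal_density m s))"

definition gaussian_vector :: "(real ^ 'j) measure \<Rightarrow> bool" where
  "gaussian_vector M \<longleftrightarrow> prob_space M \<and> sets M = sets borel \<and>
      (\<forall>u::real^'j. \<exists>m s. s \<ge> 0 \<and> distr M borel (\<lambda>x. u \<bullet> x) = gaussian m s)"

end

theory Submission
  imports Defs
begin

text \<open>
  Cut the depth-first outdegree sequence of the tree after each letter of \<open>B\<close>.  By the cycle lemma,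
  under \<open>N\<^sup>B = n\<close> the numbers of occurrences of the letters are those in \<open>n\<close> i.i.d. blocks whose
  Lukasiewicz walk is conditioned to end at \<open>-1\<close>.  A block has geometric length, so \<open>N\<^sup>A\<close> of a block has
  all moments, while the walk over blocks stays in the domain of attraction of the same stable law.
  As the variance is infinite, the walk lives on a scale much larger than \<open>sqrt n\<close>; inverting the joint
  characteristic function shows that conditioning on the endpoint does not affect the fluctuations of
  \<open>N\<^sup>A\<close> in the limit, and these are the ones of the unconditioned central limit theorem.  The limit
  variance is that of \<open>N\<^sup>A\<close> of one block, which vanishes exactly when this count is almost surely constant.
\<close>

section \<open>Plane trees and words\<close>

text \<open>Fourier inversion writes the probability that the walk ends at -1 and the conditioned
  numerator as the same prefactor \<open>th n / P\<close> times \<open>J (\<lambda>_. 0) n\<close>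
  and \<open>J g n\<close>. Only their ratio matters, so all that must be known of the limit is that
  \<open>I0\<close>, essentially a stable density at 0, does not vanish. The integrals run over one
  period of the modulus of the characteristic function, which takes care of the span of the walk.
  The obstacle is the presence of two scales, \<open>1 / th n\<close> for the walk and
  \<open>sqrt n\<close> for the count, which depend on each other inside a block. Cauchy-Schwarz
  shows only that \<open>n\<close> times the mixed term is bounded; a truncation, four moments of
  the count and \<open>sqrt n * th n\<close> tending to 0 make it vanish. The boundary case \<alpha>
  = 2 is covered by the same argument: everything is read off the truncated second moment
  \<open>K\<close>, which tends to infinity and varies regularly with index 2 - \<alpha>.
  Convergence in distribution does not carry the means along. They come from a second moment bound:
  conditioning costs a factor of order \<open>1 / th n\<close>, and the variance of the average
  gains \<open>1 / n\<close>.\<close>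

fun code :: "ptree \<Rightarrow> nat list" where
  "code (Node ts) = length ts # concat (map code ts)"

text \<open>\<open>p\<close> counts the vertices that are announced but not yet read;
  \<open>forest_word 1\<close> thus recognises the codes of single trees.\<close>

fun forest_word :: "nat \<Rightarrow> nat list \<Rightarrow> bool" where
  "forest_word p [] \<longleftrightarrow> p = 0"
| "forest_word 0 (k # w) \<longleftrightarrow> False"
| "forest_word (Suc p) (k # w) \<longleftrightarrow> forest_word (k + p) w"

definition walk :: "nat list \<Rightarrow> int" where
  "walk w = (\<Sum>k\<leftarrow>w. int k - 1)"

lemma walk_simps [simp]:
  "walk [] = 0" "walk (k # w) = int k - 1 + walk w" "walk (v @ w) = walk v + walk w"
  by (simp_all add: walk_def)

lemma walk_mset_cong: "mset v = mset w \<Longrightarrow> walk v = walk w"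
  unfolding walk_def by (metis mset_map sum_mset_sum_list)

text \<open>Reading one whole code settles exactly one pending vertex. The arbitrary continuation
  \<open>w\<close> and counter \<open>q\<close> let the induction run through the list of
  children.\<close>

lemma forest_word_code_append: "forest_word (Suc q) (code t @ w) \<longleftrightarrow> forest_word q w"
proof (induction t arbitrary: q w)
  case (Node ts)
  have "forest_word (length us + q) (concat (map code us) @ w) \<longleftrightarrow> forest_word q w"
    if "set us \<subseteq> set ts" for us
    using that by (induction us) (use Node in auto)
  from this[of ts] show ?case by simp
qed

lemma forest_word_code: "forest_word 1 (code t)"
  using forest_word_code_append[of 0 t "[]"] by simp

lemma forest_word_imp_codes:
  "forest_word p w \<Longrightarrow> \<exists>ts. length ts = p \<and> concat (map code ts) = w"
proof (induction w arbitrary: p)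
  case (Cons k w)
  then obtain q where p: "p = Suc q" and "forest_word (k + q) w" by (cases p) auto
  then obtain ts where ts: "length ts = k + q" "concat (map code ts) = w" using Cons.IH by blast
  \<comment> \<open>The first \<open>k\<close> trees of the forest read after the letter
    \<open>k\<close> become the children of the new root.\<close>
  have "concat (map code (Node (take k ts) # drop k ts)) = k # concat (map code (take k ts @ drop k ts))"
    using ts(1) by (simp del: append_take_drop_id)
  with ts have "concat (map code (Node (take k ts) # drop k ts)) = k # w" by simp
  then show ?case using ts(1) p by (intro exI[of _ "Node (take k ts) # drop k ts"]) auto
qed auto

text \<open>Equal words have equal first letters, so both leading roots have the same degree and can
  be replaced by their children. The forests may get longer, but the word loses a letter, hence the
  induction on its length.\<close>

lemma concat_code_inject:
  "concat (map code ts) = concat (map code us) \<Longrightarrow> length ts = length us \<Longrightarrow> ts = us"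
proof (induction "length (concat (map code ts))" arbitrary: ts us rule: less_induct)
  case less
  show ?case
  proof (cases ts)
    case (Cons t ts')
    then obtain u us' where us: "us = u # us'" using less.prems(2) by (cases us) auto
    obtain t1 where t: "t = Node t1" by (cases t)
    obtain u1 where u: "u = Node u1" by (cases u)
    have l: "length t1 = length u1" using less.prems Cons us t u by simp
    have "t1 @ ts' = u1 @ us'"
      by (rule less.hyps) (use less.prems Cons us t u l in auto)
    then show ?thesis using l Cons us t u by simp
  qed (use less in auto)
qed

lemma bij_betw_code: "bij_betw code UNIV {w. forest_word 1 w}"
proof (rule bij_betwI')
  fix t u show "code t = code u \<longleftrightarrow> t = u"
    using concat_code_inject[of "[t]" "[u]"] by auto
next
  fix w assume "w \<in> {w. forest_word 1 w}"
  then obtain ts where "length ts = 1" "concat (map code ts) = w"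
    using forest_word_imp_codes by blast
  then show "\<exists>t\<in>UNIV. w = code t" by (cases ts) auto
qed (use forest_word_code in auto)

lemma NC_code: "NC C t = length (filter (\<lambda>k. k \<in> C) (code t))"
proof (induction t)
  case (Node ts)
  have "sum_list (map (NC C) us) = length (filter (\<lambda>k. k \<in> C) (concat (map code us)))"
    if "set us \<subseteq> set ts" for us
    using that by (induction us) (use Node in auto)
  from this[of ts] show ?case by simp
qed

lemma gw_weight_code: "gw_weight \<mu> t = prod_list (map (pmf \<mu>) (code t))"
proof (induction t)
  case (Node ts)
  have "prod_list (map (gw_weight \<mu>) us) = prod_list (map (pmf \<mu>) (concat (map code us)))"
    if "set us \<subseteq> set ts" for us
    using that by (induction us) (use Node in auto)
  from this[of ts] show ?case by simp
qed

section \<open>The cycle lemma\<close>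

lemma mset_rotate [simp]: "mset (rotate r w) = mset w"
proof (induction r)
  case (Suc r)
  then show ?case by (cases "rotate r w") auto
qed simp

text \<open>First passage: reading stops when the walk started at \<open>p\<close> hits 0 for the
  first time. In this form rotations can be compared through partial sums.\<close>

lemma forest_word_iff_walk:
  "forest_word p w \<longleftrightarrow> int p + walk w = 0 \<and> (\<forall>j<length w. 0 < int p + walk (take j w))"
proof (induction w arbitrary: p)
  case (Cons k w)
  show ?case
  proof (cases p)
    case (Suc q)
    have "(\<forall>j<length (k # w). 0 < int p + walk (take j (k # w)))
        \<longleftrightarrow> (\<forall>j<length w. 0 < int (k + q) + walk (take j w))"
      (is "?l \<longleftrightarrow> ?r")
    proof
      assume ?l show ?r
      proof (intro allI impI)
        fix j assume "j < length w"
        with \<open>?l\<close>[rule_format, of "Suc j"] show "0 < int (k + q) + walk (take j w)"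
          using Suc by simp
      qed
    next
      assume ?r then show ?l using Suc by (auto simp: take_Cons split: nat.split)
    qed
    then show ?thesis using Suc Cons by auto
  qed (auto intro!: exI[of _ 0])
qed simp

text \<open>A rotation shifts the partial sums by a constant, and the part that wraps around by a
  further -1, the total of the word. Staying positive until the end therefore means that
  \<open>r\<close> is the first time at which the walk is minimal: the inequality is strict before
  \<open>r\<close> and weak after it.\<close>

lemma forest_word_rotate_iff:
  assumes w: "walk w = - 1" and r: "r < length w"
  shows "forest_word 1 (rotate r w) \<longleftrightarrow>
    (\<forall>i<length w. walk (take r w) \<le> walk (take i w)) \<and> (\<forall>i<r. walk (take r w) < walk (take i w))"
proof -
  let ?s = "\<lambda>i. walk (take i w)" and ?m = "length w"
  have rot: "rotate r w = drop r w @ take r w" using r by (simp add: rotate_drop_take)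
  have sm: "?s r + walk (drop r w) = - 1"
    using w by (metis append_take_drop_id walk_simps(3))
  have a: "walk (take j (drop r w)) = ?s (r + j) - ?s r" for j
    by (simp add: take_add)
  have 1: "walk (take j (rotate r w)) = ?s (r + j) - ?s r" if "j \<le> ?m - r" for j
    using that a by (simp add: rot)
  have 2: "walk (take (?m - r + i) (rotate r w)) = ?s i - ?s r - 1" if "i \<le> r" for i
    using that sm by (simp add: rot min_def)
  have walkr: "walk (rotate r w) = - 1"
    using w walk_mset_cong[of "rotate r w" w] by simp
  have "forest_word 1 (rotate r w) \<longleftrightarrow> (\<forall>j<?m. 0 < 1 + walk (take j (rotate r w)))"
    unfolding forest_word_iff_walk using walkr by simp
  also have "\<dots> \<longleftrightarrow> (\<forall>i<?m. ?s r \<le> ?s i) \<and> (\<forall>i<r. ?s r < ?s i)"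
  proof (intro iffI conjI allI impI)
    assume h: "\<forall>j<?m. 0 < 1 + walk (take j (rotate r w))"
    fix i assume i: "i < r"
    from h[rule_format, of "?m - r + i"] 2[of i] i r show "?s r < ?s i" by simp
  next
    assume h: "\<forall>j<?m. 0 < 1 + walk (take j (rotate r w))"
    fix i assume i: "i < ?m"
    show "?s r \<le> ?s i"
    proof (cases "i < r")
      case True
      then have "?m - r + i < ?m" using r by simp
      from h[rule_format, OF this] 2[of i] True show ?thesis by simp
    next
      case False
      then have "i - r < ?m" "i - r \<le> ?m - r" "r + (i - r) = i" using i by auto
      with h[rule_format, of "i - r"] 1[of "i - r"] show ?thesis by simp
    qed
  next
    assume h: "(\<forall>i<?m. ?s r \<le> ?s i) \<and> (\<forall>i<r. ?s r < ?s i)"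
    fix j assume j: "j < ?m"
    show "0 < 1 + walk (take j (rotate r w))"
    proof (cases "j < ?m - r")
      case True
      then have "r + j < ?m" by simp
      with h have "?s r \<le> ?s (r + j)" by blast
      with 1[of j] True show ?thesis by simp
    next
      case False
      define i where "i = j - (?m - r)"
      have "j = ?m - r + i" "i < r" using False j r by (auto simp: i_def)
      with h 2[of i] show ?thesis by force
    qed
  qed
  finally show ?thesis .
qed

text \<open>The good rotation starts at the first minimum of the walk, and a finite sequence has
  exactly one such time.\<close>

lemma cycle_lemma:
  assumes w: "walk w = - 1"
  shows "\<exists>!r. r < length w \<and> forest_word 1 (rotate r w)"
proof -
  let ?s = "\<lambda>i. walk (take i w)" and ?m = "length w"
  have ne: "w \<noteq> []" using w by auto
  define P where "P r \<longleftrightarrow> r < ?m \<and> (\<forall>i<?m. ?s r \<le> ?s i)" for r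
  have "\<exists>r. r \<in> {..<?m} \<and> (\<forall>i\<in>{..<?m}. ?s r \<le> ?s i)"
    using ex_min_if_finite[of "?s ` {..<?m}"] ne by (auto simp: not_less lessThan_empty_iff)
  then have ex: "\<exists>r. P r" by (auto simp: P_def)
  define r where "r = (LEAST r. P r)"
  have Pr: "P r" unfolding r_def using ex by (rule LeastI_ex)
  have min: "\<not> P i" if "i < r" for i using that not_less_Least unfolding r_def by blast
  have lt: "?s r < ?s i" if "i < r" for i
  proof (rule ccontr)
    assume "\<not> ?s r < ?s i"
    then have le: "?s i \<le> ?s r" by simp
    have "P i" unfolding P_def
    proof (intro conjI allI impI)
      show "i < ?m" using Pr that by (simp add: P_def)
      fix q assume "q < ?m"
      then have "?s r \<le> ?s q" using Pr by (simp add: P_def)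
      with le show "?s i \<le> ?s q" by simp
    qed
    with min that show False by blast
  qed
  show ?thesis
  proof (rule ex1I[of _ r])
    show "r < ?m \<and> forest_word 1 (rotate r w)"
      using Pr lt forest_word_rotate_iff[OF w, of r] unfolding P_def by blast
  next
    fix q assume q: "q < ?m \<and> forest_word 1 (rotate q w)"
    then have h: "\<forall>i<?m. ?s q \<le> ?s i" "\<forall>i<q. ?s q < ?s i"
      using forest_word_rotate_iff[OF w, of q] by auto
    then have "P q" using q by (auto simp: P_def)
    then have "\<not> q < r" using min by blast
    moreover have "\<not> r < q"
    proof
      assume "r < q"
      then have "?s q < ?s r" using h by blast
      moreover have "?s r \<le> ?s q" using Pr q by (simp add: P_def)
      ultimately show False by simp
    qed
    ultimately show "q = r" by simp
  qed
qed

lemma rotate_inverse: "k \<le> length w \<Longrightarrow> rotate (length w - k) (rotate k w) = w"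
  by (simp add: rotate_rotate)

lemma last_rotate_Suc:
  assumes "j < length w" shows "last (rotate (Suc j) w) = w ! j"
proof (cases "Suc j = length w")
  case True
  then show ?thesis by (metis rotate_id mod_self last_conv_nth diff_Suc_1 list.size(3) nat.simps(3))
next
  case False
  then have "rotate (Suc j) w = drop (Suc j) w @ take (Suc j) w"
    using assms by (simp add: rotate_drop_take)
  then show ?thesis using assms by (simp add: take_Suc_conv_app_nth)
qed

lemma finite_mset_eq: "finite {w. mset w = M}"
proof -
  have "{w. mset w = M} \<subseteq> {w. set w \<subseteq> set_mset M \<and> length w = size M}" by auto
  then show ?thesis by (rule finite_subset) (rule finite_lists_length_eq, simp)
qed

text \<open>Marking one of the \<open>n\<close> letters of \<open>B\<close> in a tree word and
  rotating it to the end is a bijection onto the words that end in \<open>B\<close>; the cycle lemma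
  undoes the rotation. This is the origin of the factor \<open>n\<close>.\<close>

lemma card_words_last_in:
  assumes walk: "\<And>w. mset w = M \<Longrightarrow> walk w = - 1"
    and cnt: "size (filter_mset (\<lambda>k. k \<in> B) M) = n"
  shows "card {w. mset w = M \<and> w \<noteq> [] \<and> last w \<in> B} = n * card {w. mset w = M \<and> forest_word 1 w}"
proof -
  let ?L = "{w. mset w = M \<and> forest_word 1 w}"
  let ?R = "{w. mset w = M \<and> w \<noteq> [] \<and> last w \<in> B}"
  let ?J = "\<lambda>w. {j. j < length w \<and> w ! j \<in> B}"
  have uniq: "a = b \<and> v = w" if "v \<in> ?L" "w \<in> ?L" "a < length v" "b < length w"
    "rotate (Suc a) v = rotate (Suc b) w" for a b v w
  proof -
    define u where "u = rotate (Suc a) v"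
    have mu: "mset u = M" using that by (simp add: u_def del: rotate_Suc)
    have lv: "length v = size M" "length w = size M" "length u = size M"
      using that(1,2) mu by (simp_all flip: size_mset)
    have r: "rotate (length v - Suc a) u = v" "rotate (length w - Suc b) u = w"
      using that(3-5) rotate_inverse[of "Suc a" v] rotate_inverse[of "Suc b" w]
      by (auto simp: u_def simp del: rotate_Suc)
    have "\<exists>!r. r < length u \<and> forest_word 1 (rotate r u)"
      using cycle_lemma[OF walk[OF mu]] .
    moreover have "length v - Suc a < length u \<and> forest_word 1 (rotate (length v - Suc a) u)"
      using r that lv by simp
    moreover have "length w - Suc b < length u \<and> forest_word 1 (rotate (length w - Suc b) u)"
      using r that lv by simp
    ultimately have "length v - Suc a = length w - Suc b" by blast
    then show ?thesis using that lv r by auto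
  qed
  have "bij_betw (\<lambda>(w, j). rotate (Suc j) w) (SIGMA w:?L. ?J w) ?R"
    unfolding bij_betw_def
  proof
    show "inj_on (\<lambda>(w, j). rotate (Suc j) w) (SIGMA w:?L. ?J w)"
    proof (rule inj_onI)
      fix p q assume p: "p \<in> (SIGMA w:?L. ?J w)" and q: "q \<in> (SIGMA w:?L. ?J w)"
        and eq: "(case p of (w, j) \<Rightarrow> rotate (Suc j) w) = (case q of (w, j) \<Rightarrow> rotate (Suc j) w)"
      have "snd p = snd q \<and> fst p = fst q"
        by (rule uniq) (use p q eq in \<open>auto simp: case_prod_beta simp del: rotate_Suc\<close>)
      then show "p = q" by (simp add: prod_eq_iff)
    qed
    show "(\<lambda>(w, j). rotate (Suc j) w) ` (SIGMA w:?L. ?J w) = ?R"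
    proof (intro equalityI subsetI)
      fix v assume "v \<in> (\<lambda>(w, j). rotate (Suc j) w) ` (SIGMA w:?L. ?J w)"
      then show "v \<in> ?R" by (auto simp: last_rotate_Suc simp del: rotate_Suc)
    next
      fix v assume v: "v \<in> ?R"
      then obtain r where r: "r < length v" "forest_word 1 (rotate r v)"
        using cycle_lemma[OF walk] by blast
      \<comment> \<open>The inverse of the rotation by \<open>r\<close> is the rotation by
        \<open>length v - r\<close>, which must be \<open>Suc j\<close> for the letter at position
        \<open>j\<close> to come last.\<close>
      define j where "j = length v - Suc r"
      have j: "Suc j = length v - r" "j < length v" using r by (auto simp: j_def)
      have v': "rotate (Suc j) (rotate r v) = v"
        using rotate_inverse[of r v] r j by simp
      have "rotate r v ! j = last v" using last_rotate_Suc[of j "rotate r v"] v' j by simp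
      then show "v \<in> (\<lambda>(w, j). rotate (Suc j) w) ` (SIGMA w:?L. ?J w)"
        using v r(2) j(2) by (intro image_eqI[of _ _ "(rotate r v, j)"]) (simp_all add: v' del: rotate_Suc)
    qed
  qed
  then have "card ?R = card (SIGMA w:?L. ?J w)" by (simp add: bij_betw_same_card)
  also have "\<dots> = (\<Sum>w\<in>?L. card (?J w))"
    by (rule card_SigmaI) (use finite_subset[OF _ finite_mset_eq[of M]] in auto)
  also have "\<dots> = (\<Sum>w\<in>?L. n)"
  proof (rule sum.cong)
    fix w assume "w \<in> ?L"
    then have "filter_mset (\<lambda>k. k \<in> B) M = mset (filter (\<lambda>k. k \<in> B) w)" by auto
    then have "n = length (filter (\<lambda>k. k \<in> B) w)" using cnt by (simp del: mset_filter)
    then show "card (?J w) = n" by (simp add: length_filter_conv_card)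
  qed simp
  finally show ?thesis by simp
qed

section \<open>The Galton--Watson tree as a probability distribution\<close>

lemma nn_integral_list_Cons:
  fixes F :: "'a list \<Rightarrow> ennreal"
  shows "(\<integral>\<^sup>+w. F w \<partial>count_space UNIV)
    = F [] + (\<integral>\<^sup>+x. \<integral>\<^sup>+w. F (x # w) \<partial>count_space UNIV \<partial>count_space UNIV)"
proof -
  have bij: "bij_betw (\<lambda>(x, w). x # w) (UNIV :: ('a \<times> 'a list) set) (- {[]})"
    by (rule bij_betwI') (auto simp: neq_Nil_conv split: prod.splits)
  have "(\<integral>\<^sup>+w. F w \<partial>count_space UNIV)
      = (\<integral>\<^sup>+w. F w * indicator {[]} w + F w * indicator (- {[]}) w \<partial>count_space UNIV)"
    by (intro nn_integral_cong) (auto split: split_indicator)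
  also have "\<dots> = (\<integral>\<^sup>+w. F w * indicator {[]} w \<partial>count_space UNIV)
      + (\<integral>\<^sup>+w. F w * indicator (- {[]}) w \<partial>count_space UNIV)"
    by (rule nn_integral_add) auto
  also have "(\<integral>\<^sup>+w. F w * indicator {[]} w \<partial>count_space UNIV) = F []"
    by (subst nn_integral_indicator_finite) auto
  also have "(\<integral>\<^sup>+w. F w * indicator (- {[]}) w \<partial>count_space UNIV) = (\<integral>\<^sup>+w. F w \<partial>count_space (- {[]}))"
    by (simp add: nn_integral_count_space_indicator)
  also have "\<dots> = (\<integral>\<^sup>+p. F (case p of (x, w) \<Rightarrow> x # w) \<partial>count_space UNIV)"
    by (rule nn_integral_bij_count_space[OF bij, symmetric])
  also have "\<dots> = (\<integral>\<^sup>+x. \<integral>\<^sup>+w. F (x # w) \<partial>count_space UNIV \<partial>count_space UNIV)"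
    by (subst nn_integral_fst_count_space[symmetric]) simp
  finally show ?thesis .
qed

lemma nn_integral_prod_list_length:
  fixes f :: "'a \<Rightarrow> ennreal"
  shows "(\<integral>\<^sup>+w. prod_list (map f w) * indicator {w. length w = k} w \<partial>count_space UNIV)
    = (\<integral>\<^sup>+x. f x \<partial>count_space UNIV) ^ k"
proof (induction k)
  case 0
  then show ?case by (subst nn_integral_list_Cons) (simp add: nn_integral_0_iff_AE)
next
  case (Suc k)
  have "(\<integral>\<^sup>+x. \<integral>\<^sup>+w. prod_list (map f (x # w)) * indicator {w. length w = Suc k} (x # w)
        \<partial>count_space UNIV \<partial>count_space UNIV)
      = (\<integral>\<^sup>+x. \<integral>\<^sup>+w. f x * (prod_list (map f w) * indicator {w. length w = k} w)
        \<partial>count_space UNIV \<partial>count_space UNIV)"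
    by (intro nn_integral_cong) (auto simp: mult.assoc split: split_indicator)
  also have "\<dots> = (\<integral>\<^sup>+x. f x * (\<integral>\<^sup>+x. f x \<partial>count_space UNIV) ^ k \<partial>count_space UNIV)"
    by (simp add: nn_integral_cmult Suc)
  also have "\<dots> = (\<integral>\<^sup>+x. f x \<partial>count_space UNIV) ^ Suc k"
    by (simp add: nn_integral_multc)
  finally show ?case by (subst nn_integral_list_Cons) simp
qed

lemma gw_weight_nonneg: "0 \<le> gw_weight \<mu> t"
  unfolding gw_weight_code by (rule prod_list_nonneg) auto

lemma ennreal_prod_list: "(\<And>x. x \<in> set xs \<Longrightarrow> 0 \<le> f x) \<Longrightarrow>
    ennreal (prod_list (map f xs)) = prod_list (map (\<lambda>x. ennreal (f x)) xs)"
  by (induction xs) (auto simp: ennreal_mult' intro!: prod_list_nonneg)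

text \<open>The weight is a product over the root subtrees, so the sum over all lists of
  \<open>k\<close> subtrees is a \<open>k\<close>-th power. \<open>H = trees_below h\<close> gives a
  recursion in the height, \<open>H = UNIV\<close> a fixed point equation.\<close>

lemma gw_weight_Node_sum:
  "(\<integral>\<^sup>+t. ennreal (gw_weight \<mu> t) * indicator {Node ts |ts. set ts \<subseteq> H} t \<partial>count_space UNIV)
    = (\<integral>\<^sup>+k. (\<integral>\<^sup>+t. ennreal (gw_weight \<mu> t) * indicator H t \<partial>count_space UNIV) ^ k \<partial>measure_pmf \<mu>)"
proof -
  let ?f = "\<lambda>t. ennreal (gw_weight \<mu> t) * indicator H t"
  have bij: "bij_betw Node UNIV (UNIV :: ptree set)"
    by (rule bij_betwI') (auto intro: ptree.exhaust)
  have ind: "(if set ts \<subseteq> H then 1 else 0 :: ennreal) = prod_list (map (indicator H) ts)" for ts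
    by (induction ts) (auto split: split_indicator if_splits)
  have "(\<integral>\<^sup>+t. ennreal (gw_weight \<mu> t) * indicator {Node ts |ts. set ts \<subseteq> H} t \<partial>count_space UNIV)
     = (\<integral>\<^sup>+ts. ennreal (gw_weight \<mu> (Node ts)) * indicator {Node ts |ts. set ts \<subseteq> H} (Node ts) \<partial>count_space UNIV)"
    by (rule nn_integral_bij_count_space[OF bij, symmetric])
  \<comment> \<open>The inserted sum over \<open>k\<close> has the single nonzero term
    \<open>k = length ts\<close>; it groups the lists by length.\<close>
  also have "\<dots> = (\<integral>\<^sup>+ts. (\<Sum>k. ennreal (pmf \<mu> k) *
       (prod_list (map ?f ts) * indicator {w. length w = k} ts)) \<partial>count_space UNIV)"
  proof (intro nn_integral_cong)
    fix ts :: "ptree list"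
    have "prod_list (map ?f ts)
        = prod_list (map (\<lambda>t. ennreal (gw_weight \<mu> t)) ts) * prod_list (map (indicator H) ts)"
      by (induction ts) (auto simp: mult_ac)
    moreover have "(\<Sum>k. ennreal (pmf \<mu> k) * (prod_list (map ?f ts) * indicator {w. length w = k} ts))
      = (\<Sum>k\<in>{length ts}. ennreal (pmf \<mu> k) * (prod_list (map ?f ts) * indicator {w. length w = k} ts))"
      by (rule suminf_finite) auto
    moreover have "indicator {Node ts |ts. set ts \<subseteq> H} (Node ts) = (if set ts \<subseteq> H then 1 else 0 :: ennreal)"
      by auto
    ultimately show "ennreal (gw_weight \<mu> (Node ts)) * indicator {Node ts |ts. set ts \<subseteq> H} (Node ts)
        = (\<Sum>k. ennreal (pmf \<mu> k) * (prod_list (map ?f ts) * indicator {w. length w = k} ts))"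
      by (simp add: ind ennreal_mult' ennreal_prod_list gw_weight_nonneg mult_ac)
  qed
  also have "\<dots> = (\<Sum>k. ennreal (pmf \<mu> k) * (\<integral>\<^sup>+t. ?f t \<partial>count_space UNIV) ^ k)"
    by (subst nn_integral_suminf) (auto simp: nn_integral_cmult nn_integral_prod_list_length)
  also have "\<dots> = (\<integral>\<^sup>+k. (\<integral>\<^sup>+t. ?f t \<partial>count_space UNIV) ^ k \<partial>measure_pmf \<mu>)"
    by (simp add: nn_integral_measure_pmf nn_integral_count_space_nat)
  finally show ?thesis .
qed

section \<open>Total mass of the tree weights\<close>

primrec trees_below :: "nat \<Rightarrow> ptree set" where
  "trees_below 0 = {}"
| "trees_below (Suc h) = {Node ts |ts. set ts \<subseteq> trees_below h}"

lemma trees_below_mono: "trees_below h \<subseteq> trees_below (Suc h)"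
  by (induction h) auto

lemma trees_below_ex: "\<exists>h. t \<in> trees_below h"
proof (induction t)
  case (Node ts)
  have "\<exists>h. set us \<subseteq> trees_below h" if "set us \<subseteq> set ts" for us
    using that
  proof (induction us)
    case (Cons u us)
    obtain a where "u \<in> trees_below a" using Node.IH Cons.prems by auto
    moreover obtain b where "set us \<subseteq> trees_below b" using Cons by auto
    moreover have "trees_below a \<subseteq> trees_below (max a b)" "trees_below b \<subseteq> trees_below (max a b)"
      by (rule lift_Suc_mono_le[of trees_below, OF trees_below_mono]; simp)+
    ultimately show ?case by (intro exI[of _ "max a b"]) auto
  qed simp
  then obtain h where "set ts \<subseteq> trees_below h" by blast
  then have "Node ts \<in> trees_below (Suc h)" by auto
  then show ?case by blast
qed

text \<open>The masses of the trees of bounded height arise from 0 by iterating the generating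
  function, which maps [0, 1] into itself; monotone convergence in the height then reaches all
  trees.\<close>

lemma gw_weight_sum_le_1: "(\<integral>\<^sup>+t. ennreal (gw_weight \<mu> t) \<partial>count_space UNIV) \<le> 1"
proof -
  let ?g = "\<lambda>h t. ennreal (gw_weight \<mu> t) * indicator (trees_below h) t"
  have mono: "trees_below h \<subseteq> trees_below h'" if "h \<le> h'" for h h'
    using that by (rule lift_Suc_mono_le[of trees_below, OF trees_below_mono])
  have le: "(\<integral>\<^sup>+t. ?g h t \<partial>count_space UNIV) \<le> 1" for h
  proof (induction h)
    case (Suc h)
    have "(\<integral>\<^sup>+t. ?g (Suc h) t \<partial>count_space UNIV)
      = (\<integral>\<^sup>+k. (\<integral>\<^sup>+t. ?g h t \<partial>count_space UNIV) ^ k \<partial>measure_pmf \<mu>)"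
      using gw_weight_Node_sum[of \<mu> "trees_below h"] by simp
    also have "\<dots> \<le> (\<integral>\<^sup>+k. 1 \<partial>measure_pmf \<mu>)"
      by (intro nn_integral_mono power_le_one Suc) auto
    finally show ?case by simp
  qed simp
  have sup: "(SUP h. ?g h t) = ennreal (gw_weight \<mu> t)" for t
  proof (rule antisym)
    obtain h where "t \<in> trees_below h" using trees_below_ex by blast
    then show "ennreal (gw_weight \<mu> t) \<le> (SUP h. ?g h t)"
      by (intro SUP_upper2[of h]) auto
  qed (auto intro!: SUP_least split: split_indicator)
  have "(\<integral>\<^sup>+t. ennreal (gw_weight \<mu> t) \<partial>count_space UNIV) = (\<integral>\<^sup>+t. (SUP h. ?g h t) \<partial>count_space UNIV)"
    by (simp add: sup)
  also have "\<dots> = (SUP h. \<integral>\<^sup>+t. ?g h t \<partial>count_space UNIV)"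
    by (rule nn_integral_monotone_convergence_SUP)
       (auto intro!: incseq_SucI le_funI mult_left_mono simp: indicator_def simp del: trees_below.simps
          dest: trees_below_mono[THEN subsetD])
  also have "\<dots> \<le> 1" using le by (rule SUP_least)
  finally show ?thesis .
qed

text \<open>Bernoulli's inequality \<open>q ^ k \<ge> 1 - k * (1 - q)\<close> is strict for \<open>k \<ge> 2\<close> and \<open>q < 1\<close>,
  so the generating function of a critical law charging \<open>{2..}\<close> lies above the diagonal on \<open>[0, 1)\<close>.\<close>

lemma critical_fixed_point:
  fixes q :: real
  assumes crit: "critical \<mu>" and inf: "infinite_variance \<mu>"
    and q: "0 \<le> q" "q \<le> 1" and fp: "measure_pmf.expectation \<mu> (\<lambda>k. q ^ k) = q"
  shows "q = 1"
proof (rule ccontr)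
  assume "q \<noteq> 1"
  with q have q1: "q < 1" by simp
  have bern: "1 - real k * (1 - q) \<le> q ^ k" for k
    using Bernoulli_inequality[of "q - 1" k] q by (simp add: algebra_simps)
  have strict: "1 - real k * (1 - q) < q ^ k" if "k \<ge> 2" for k
  proof -
    from that obtain j where "k = 2 + j" using le_Suc_ex by blast
    then have k: "k = Suc (Suc j)" by simp
    have "1 - real (Suc j) * (1 - q) \<le> q ^ Suc j" by (rule bern)
    then have "1 - q ^ Suc j \<le> real (Suc j) * (1 - q)" by simp
    then have "(1 - q ^ Suc j) * q \<le> real (Suc j) * (1 - q) * q" by (rule mult_right_mono) (use q in simp)
    moreover have "real (Suc j) * (1 - q) * q < real (Suc j) * (1 - q)"
      using q1 by simp
    ultimately have "q - q ^ k < real (Suc j) * (1 - q)" by (simp add: k algebra_simps)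
    then show ?thesis by (simp add: k algebra_simps)
  qed
  have int1: "integrable \<mu> real" and e1: "measure_pmf.expectation \<mu> real = 1"
    using crit by (auto simp: critical_def)
  have int2: "integrable \<mu> (\<lambda>k. q ^ k)"
    by (rule measure_pmf.integrable_const_bound[where B = 1]) (use q in \<open>auto simp: power_le_one\<close>)
  \<comment> \<open>By criticality Bernoulli's lower bound has expectation \<open>q\<close> as well,
    so the nonnegative difference has mean 0 and vanishes almost surely. Strictness for
    \<open>k \<ge> 2\<close> then confines \<mu> to 0 and 1, against the infinite variance.\<close>
  have "measure_pmf.expectation \<mu> (\<lambda>k. q ^ k - (1 - real k * (1 - q))) = 0"
    using int1 int2 by (simp add: fp e1)
  moreover have "integrable \<mu> (\<lambda>k. q ^ k - (1 - real k * (1 - q)))"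
    using int1 int2 by simp
  ultimately have "AE k in \<mu>. q ^ k - (1 - real k * (1 - q)) = 0"
    by (subst (asm) integral_nonneg_eq_0_iff_AE) (use bern in auto)
  then have "\<forall>k\<in>set_pmf \<mu>. q ^ k - (1 - real k * (1 - q)) = 0" by (simp add: AE_measure_pmf_iff)
  then have "k < 2" if "k \<in> set_pmf \<mu>" for k using strict[of k] that by (cases "k < 2") auto
  then have "set_pmf \<mu> \<subseteq> {..<2}" by auto
  then have "finite (set_pmf \<mu>)" by (rule finite_subset) simp
  then have "integrable \<mu> (\<lambda>k. (real k)\<^sup>2)" by (rule integrable_measure_pmf_finite)
  with inf show False by (simp add: infinite_variance_def)
qed

text \<open>The total mass is a fixed point of the generating function in [0, 1], and
  \<open>critical_fixed_point\<close> leaves only 1: extinction is almost sure.\<close>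

lemma gw_weight_sum:
  assumes "critical \<mu>" "infinite_variance \<mu>"
  shows "(\<integral>\<^sup>+t. ennreal (gw_weight \<mu> t) \<partial>count_space UNIV) = 1"
proof -
  define q where "q = (\<integral>\<^sup>+t. ennreal (gw_weight \<mu> t) \<partial>count_space UNIV)"
  have q1: "q \<le> 1" unfolding q_def by (rule gw_weight_sum_le_1)
  then obtain r where r: "q = ennreal r" "0 \<le> r" "r \<le> 1"
    by (metis ennreal_le_1 ennreal_top_neq_one ennreal_cases top.extremum_uniqueI)
  have U: "{Node ts |ts. set ts \<subseteq> UNIV} = UNIV"
    by (auto, metis ptree.exhaust)
  have int: "integrable \<mu> (\<lambda>k. r ^ k)"
    by (rule measure_pmf.integrable_const_bound[where B = 1]) (use r in \<open>auto simp: power_le_one\<close>)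
  have "q = (\<integral>\<^sup>+k. q ^ k \<partial>measure_pmf \<mu>)"
    using gw_weight_Node_sum[of \<mu> UNIV] unfolding U by (simp add: q_def)
  also have "\<dots> = (\<integral>\<^sup>+k. ennreal (r ^ k) \<partial>measure_pmf \<mu>)"
    using r by (simp add: ennreal_power)
  also have "\<dots> = ennreal (measure_pmf.expectation \<mu> (\<lambda>k. r ^ k))"
    by (rule nn_integral_eq_integral[OF int]) (use r in auto)
  finally have "measure_pmf.expectation \<mu> (\<lambda>k. r ^ k) = r"
    using r by (simp add: integral_nonneg)
  then have "r = 1" using critical_fixed_point[OF assms] r by blast
  then show ?thesis using r by (simp add: q_def)
qed

lemma pmf_gw_tree:
  assumes "critical \<mu>" "infinite_variance \<mu>"
  shows "pmf (gw_tree \<mu>) t = gw_weight \<mu> t"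
  unfolding gw_tree_def by (rule pmf_embed_pmf) (simp_all add: gw_weight_nonneg gw_weight_sum assms)

section \<open>Independent blocks\<close>

text \<open>An i.i.d. sequence of outdegrees is cut after each element of \<open>B\<close>; \<open>block_spmf\<close> is the
  law of a piece.\<close>

partial_function (spmf) block_spmf :: "nat pmf \<Rightarrow> nat set \<Rightarrow> nat list spmf" where
  "block_spmf \<mu> B = bind_spmf (spmf_of_pmf \<mu>)
     (\<lambda>x. if x \<in> B then return_spmf [x] else map_spmf ((#) x) (block_spmf \<mu> B))"

locale marked_offspring =
  fixes \<mu> :: "nat pmf" and B :: "nat set"
  assumes B_pos: "measure_pmf.prob \<mu> B > 0"
begin

abbreviation p_B :: real where "p_B \<equiv> measure_pmf.prob \<mu> B"

text \<open>The mass \<open>q\<close> of the runs that stop solves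
  \<open>q = p_B + (1 - p_B) * q\<close>, and \<open>p_B > 0\<close> forces \<open>q = 1\<close>.
  This allows \<open>block\<close> to be an ordinary probability distribution.\<close>

lemma lossless_block_spmf: "lossless_spmf (block_spmf \<mu> B)"
proof -
  let ?q = "weight_spmf (block_spmf \<mu> B)"
  have "?q = measure_pmf.expectation \<mu> (\<lambda>x. if x \<in> B then 1 else ?q)"
    using arg_cong[OF block_spmf.simps[of \<mu> B], of weight_spmf]
    by (simp add: weight_bind_spmf o_def if_distrib del: bind_spmf_of_pmf cong: if_cong)
  also have "\<dots> = measure_pmf.expectation \<mu> (\<lambda>x. ?q + (1 - ?q) * indicator B x)"
    by (intro Bochner_Integration.integral_cong) auto
  also have "\<dots> = ?q + (1 - ?q) * p_B"
  proof -
    have "integrable \<mu> (indicator B :: nat \<Rightarrow> real)"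
      by (rule measure_pmf.integrable_const_bound[where B = 1]) auto
    then show ?thesis by (simp add: measure_pmf.prob_space)
  qed
  finally have "(1 - ?q) * p_B = 0" by simp
  then show ?thesis using B_pos by (simp add: lossless_spmf_def)
qed

definition block :: "nat list pmf" where
  "block = (SOME p. block_spmf \<mu> B = spmf_of_pmf p)"

lemma block_unfold:
  "block = bind_pmf \<mu> (\<lambda>x. if x \<in> B then return_pmf [x] else map_pmf ((#) x) block)"
proof -
  have eq: "block_spmf \<mu> B = spmf_of_pmf block"
    unfolding block_def by (rule someI_ex) (use lossless_block_spmf in \<open>simp add: lossless_spmf_conv_spmf_of_pmf\<close>)
  have "spmf_of_pmf block
      = spmf_of_pmf (bind_pmf \<mu> (\<lambda>x. if x \<in> B then return_pmf [x] else map_pmf ((#) x) block))"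
    by (subst eq[symmetric], subst block_spmf.simps)
       (simp add: eq spmf_of_pmf_bind if_distrib cong: if_cong)
  from arg_cong[OF this, of "\<lambda>p. spmf p _"] show ?thesis
    unfolding spmf_spmf_of_pmf by (rule pmf_eqI)
qed

primrec blocks :: "nat \<Rightarrow> nat list pmf" where
  "blocks 0 = return_pmf []"
| "blocks (Suc n) = bind_pmf block (\<lambda>b. map_pmf ((@) b) (blocks n))"

text \<open>Reading one letter instead of one block is what an induction over the word requires;
  only a letter of \<open>B\<close> uses up a block.\<close>

lemma blocks_Suc_unfold:
  "blocks (Suc n) = bind_pmf \<mu> (\<lambda>x. map_pmf ((#) x) (blocks (if x \<in> B then n else Suc n)))"
proof -
  have "blocks (Suc n) = bind_pmf (bind_pmf \<mu> (\<lambda>x. if x \<in> B then return_pmf [x] else map_pmf ((#) x) block))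
      (\<lambda>b. map_pmf ((@) b) (blocks n))"
    using block_unfold by simp
  also have "\<dots> = bind_pmf \<mu> (\<lambda>x. map_pmf ((#) x) (blocks (if x \<in> B then n else Suc n)))"
    unfolding bind_assoc_pmf
  proof (rule bind_pmf_cong)
    fix x
    show "bind_pmf (if x \<in> B then return_pmf [x] else map_pmf ((#) x) block) (\<lambda>b. map_pmf ((@) b) (blocks n))
        = map_pmf ((#) x) (blocks (if x \<in> B then n else Suc n))"
    proof (cases "x \<in> B")
      case True
      have "(@) [x] = (#) x" by auto
      then show ?thesis using True by (simp add: bind_return_pmf)
    next
      case False
      have "(@) (x # b) = (\<lambda>w. x # b @ w)" for b by auto
      with False show ?thesis
        by (simp add: bind_map_pmf map_bind_pmf pmf.map_comp o_def)
    qed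
  qed simp
  finally show ?thesis .
qed

text \<open>The cuts remain visible after concatenation, since they sit right behind the letters of
  \<open>B\<close>. A word therefore has at most one decomposition into blocks, and its mass is the
  plain product of the letter masses.\<close>

lemma pmf_blocks:
  "pmf (blocks n) w = (if length (filter (\<lambda>k. k \<in> B) w) = n \<and> (w = [] \<or> last w \<in> B)
     then prod_list (map (pmf \<mu>) w) else 0)"
proof (induction w arbitrary: n)
  case Nil
  show ?case
  proof (cases n)
    case (Suc m)
    have "[] \<notin> set_pmf (blocks (Suc m))"
      by (subst blocks_Suc_unfold) auto
    then show ?thesis using Suc by (simp add: pmf_eq_0_set_pmf)
  qed simp
next
  case (Cons x w)
  show ?case
  proof (cases n)
    case (Suc m)
    have "pmf (blocks (Suc m)) (x # w)
        = measure_pmf.expectation \<mu> (\<lambda>y. pmf (map_pmf ((#) y) (blocks (if y \<in> B then m else Suc m))) (x # w))"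
      by (subst blocks_Suc_unfold) (simp add: pmf_bind)
    also have "\<dots> = (\<Sum>y\<in>{x}. pmf (map_pmf ((#) y) (blocks (if y \<in> B then m else Suc m))) (x # w) * pmf \<mu> y)"
    proof (rule integral_measure_pmf_real)
      fix y assume "pmf (map_pmf ((#) y) (blocks (if y \<in> B then m else Suc m))) (x # w) \<noteq> 0"
      then have "x # w \<in> set_pmf (map_pmf ((#) y) (blocks (if y \<in> B then m else Suc m)))"
        by (simp add: set_pmf_iff del: set_map_pmf)
      then show "y \<in> {x}" by auto
    qed simp
    also have "\<dots> = pmf (blocks (if x \<in> B then m else Suc m)) w * pmf \<mu> x"
      by (simp add: pmf_map_inj')
    finally show ?thesis unfolding Cons.IH using Suc by auto
  next
    case 0
    then show ?thesis using last_in_set[of w] by (auto simp: filter_empty_conv)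
  qed
qed

lemma size_filter_mset_mset: "size (filter_mset P (mset w)) = length (filter P w)"
  by (simp flip: mset_filter)

text \<open>Words with the same multiset of letters have the same weight, so both masses are this
  weight times a number of words, and \<open>card_words_last_in\<close> compares the two
  numbers.\<close>

lemma prob_blocks_mset:
  assumes n: "n \<ge> 1" and walk: "\<And>w. mset w = M \<Longrightarrow> walk w = - 1"
    and cnt: "size (filter_mset (\<lambda>k. k \<in> B) M) = n"
    and crit: "critical \<mu>" "infinite_variance \<mu>"
  shows "pmf (map_pmf mset (blocks n)) M = real n * pmf (map_pmf (\<lambda>t. mset (code t)) (gw_tree \<mu>)) M"
proof -
  let ?L = "{w. mset w = M \<and> forest_word 1 w}"
  let ?R = "{w. mset w = M \<and> w \<noteq> [] \<and> last w \<in> B}"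
  let ?c = "prod_mset (image_mset (pmf \<mu>) M)"
  have c: "prod_list (map (pmf \<mu>) w) = ?c" if "mset w = M" for w
    using that by (auto simp: prod_mset_prod_list simp flip: mset_map)
  have fin: "finite ?L" using finite_subset[OF _ finite_mset_eq[of M]] by auto
  have inj: "inj code" using bij_betw_code by (simp add: bij_betw_def)
  have T: "code -` ?L = (\<lambda>t. mset (code t)) -` {M}"
    using forest_word_code by auto
  have finT: "finite (code -` ?L)" using fin inj by (rule finite_vimageI)
  have "pmf (map_pmf (\<lambda>t. mset (code t)) (gw_tree \<mu>)) M = measure_pmf.prob (gw_tree \<mu>) (code -` ?L)"
    unfolding T pmf_map ..
  also have "\<dots> = (\<Sum>t\<in>code -` ?L. pmf (gw_tree \<mu>) t)"
    by (rule measure_measure_pmf_finite[OF finT])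
  also have "\<dots> = (\<Sum>t\<in>code -` ?L. ?c)"
    by (intro sum.cong) (auto simp: pmf_gw_tree[OF crit] gw_weight_code c)
  also have "\<dots> = real (card (code -` ?L)) * ?c" by simp
  also have "card (code -` ?L) = card ?L"
    by (rule card_vimage_inj[OF inj]) (use bij_betw_code in \<open>auto simp: bij_betw_def\<close>)
  finally have 1: "pmf (map_pmf (\<lambda>t. mset (code t)) (gw_tree \<mu>)) M = real (card ?L) * ?c" .
  have "pmf (map_pmf mset (blocks n)) M = measure_pmf.prob (blocks n) {w. mset w = M}"
    by (simp add: pmf_map vimage_def)
  also have "\<dots> = (\<Sum>w\<in>{w. mset w = M}. pmf (blocks n) w)"
    by (rule measure_measure_pmf_finite[OF finite_mset_eq])
  also have "\<dots> = (\<Sum>w\<in>?R. ?c)"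
  proof (rule sum.mono_neutral_cong_right[OF finite_mset_eq])
    show "\<forall>w\<in>{w. mset w = M} - ?R. pmf (blocks n) w = 0" using n by (auto simp: pmf_blocks)
    fix w assume w: "w \<in> ?R"
    then have "length (filter (\<lambda>k. k \<in> B) w) = n"
      using cnt size_filter_mset_mset[of "\<lambda>k. k \<in> B" w] by simp
    then show "pmf (blocks n) w = ?c" using w c by (simp add: pmf_blocks)
  qed auto
  also have "\<dots> = real (card ?R) * ?c" by simp
  also have "card ?R = n * card ?L" by (rule card_words_last_in[OF walk cnt])
  finally show ?thesis using 1 by simp
qed

text \<open>The factor \<open>n\<close> is the same for all multisets in question and cancels when
  both laws are normalised.\<close>

lemma gw_cond_blocks:
  assumes n: "n \<in> admissible \<mu> B" and crit: "critical \<mu>" "infinite_variance \<mu>"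
  shows "measure_pmf.prob (blocks n) {w. walk w = - 1} > 0"
    and "map_pmf (\<lambda>t. mset (code t)) (gw_cond \<mu> B n)
      = map_pmf mset (cond_pmf (blocks n) {w. walk w = - 1})"
proof -
  let ?p = "map_pmf (\<lambda>t. mset (code t)) (gw_tree \<mu>)" and ?r = "map_pmf mset (blocks n)"
  \<comment> \<open>\<open>W\<close> expresses on multisets that the walk ends at -1, and
    \<open>Q\<close> fixes the number of letters in \<open>B\<close> as well. Under the tree law
    \<open>W\<close> is certain, under the block law the count is, so either conditioning amounts to
    conditioning on \<open>Q\<close>.\<close>
  define W where "W = {M. \<exists>w. mset w = M \<and> walk w = - 1}"
  define Q where "Q = {M \<in> W. size (filter_mset (\<lambda>k. k \<in> B) M) = n}"
  have n1: "n \<ge> 1" and pos: "measure_pmf.prob (gw_tree \<mu>) {t. NC B t = n} > 0"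
    using n by (auto simp: admissible_def)
  have W: "mset -` W = {w. walk w = - 1}"
    unfolding W_def by (auto dest: walk_mset_cong)
  have walk_code: "walk (code t) = - 1" for t
    using forest_word_code[of t] unfolding forest_word_iff_walk by simp
  note szf = size_filter_mset_mset
  have Qt: "(\<lambda>t. mset (code t)) -` Q = {t. NC B t = n}"
    using walk_code szf by (auto simp: Q_def W_def NC_code)
  have eq: "pmf ?r M = real n * pmf ?p M" if "M \<in> Q" for M
  proof (rule prob_blocks_mset[OF n1 _ _ crit])
    fix w assume w: "mset w = M"
    from that obtain v where "mset v = M" "walk v = - 1" by (auto simp: Q_def W_def)
    then show "walk w = - 1" using w walk_mset_cong[of w v] by simp
  qed (use that in \<open>simp add: Q_def\<close>)
  have zero: "pmf ?r M = 0" if "M \<notin> Q" "M \<in> W" for M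
  proof -
    have "M \<notin> set_pmf ?r"
    proof
      assume "M \<in> set_pmf ?r"
      then obtain w where "w \<in> set_pmf (blocks n)" "M = mset w" by auto
      then have "length (filter (\<lambda>k. k \<in> B) w) = n" by (auto simp: set_pmf_iff pmf_blocks split: if_splits)
      with \<open>M = mset w\<close> that szf[of "\<lambda>k. k \<in> B" w] show False by (simp add: Q_def)
    qed
    then show ?thesis by (simp add: pmf_eq_0_set_pmf)
  qed
  have "measure_pmf.prob ?r W = measure_pmf.prob ?r Q"
  proof (rule measure_pmf.finite_measure_eq_AE)
    show "AE M in ?r. M \<in> W \<longleftrightarrow> M \<in> Q"
      by (rule AE_pmfI) (use zero in \<open>auto simp: Q_def set_pmf_iff simp del: set_map_pmf\<close>)
  qed auto
  also have "\<dots> = infsetsum (\<lambda>M. real n * pmf ?p M) Q"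
    unfolding measure_pmf_conv_infsetsum by (intro infsetsum_cong eq) auto
  also have "\<dots> = real n * measure_pmf.prob ?p Q"
    by (subst infsetsum_cmult_right) (simp_all add: measure_pmf_conv_infsetsum pmf_abs_summable del: measure_map_pmf)
  finally have meas: "measure_pmf.prob ?r W = real n * measure_pmf.prob ?p Q" .
  have pQ: "measure_pmf.prob ?p Q > 0" using pos Qt by simp
  have rW: "measure_pmf.prob ?r W > 0" unfolding meas using pQ n1 by simp
  then show "measure_pmf.prob (blocks n) {w. walk w = - 1} > 0" using W by simp
  have ne: "set_pmf p \<inter> S \<noteq> {}" if "measure_pmf.prob p S > 0" for p :: "'x pmf" and S
    using that measure_Int_set_pmf[of p S] by (auto simp: inf_commute[of S])
  have "map_pmf (\<lambda>t. mset (code t)) (gw_cond \<mu> B n) = cond_pmf ?p Q"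
    unfolding gw_cond_def Qt[symmetric]
    by (rule cond_map_pmf[symmetric]) (use ne[OF pos] Qt in simp)
  also have "\<dots> = cond_pmf ?r W"
  proof (rule pmf_eqI)
    fix M
    have "pmf (cond_pmf ?p Q) M = (if M \<in> Q then pmf ?p M / measure_pmf.prob ?p Q else 0)"
      by (rule pmf_cond[OF ne[OF pQ]])
    also have "\<dots> = (if M \<in> W then pmf ?r M / measure_pmf.prob ?r W else 0)"
      using eq[of M] zero[of M] n1 unfolding meas by (auto simp: Q_def)
    also have "\<dots> = pmf (cond_pmf ?r W) M"
      by (rule pmf_cond[OF ne[OF rW], symmetric])
    finally show "pmf (cond_pmf ?p Q) M = pmf (cond_pmf ?r W) M" .
  qed
  also have "\<dots> = map_pmf mset (cond_pmf (blocks n) {w. walk w = - 1})"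
    unfolding W[symmetric] by (rule cond_map_pmf) (use ne[OF rW] in auto)
  finally show "map_pmf (\<lambda>t. mset (code t)) (gw_cond \<mu> B n)
      = map_pmf mset (cond_pmf (blocks n) {w. walk w = - 1})" .
qed

end

section \<open>Levy's continuity theorem in Euclidean spaces\<close>

definition charf :: "'a::euclidean_space measure \<Rightarrow> 'a \<Rightarrow> complex" where
  "charf M u = (\<integral>x. iexp (u \<bullet> x) \<partial>M)"

text \<open>Finite combinations of characters: functions whose integrals converge as soon as the
  characteristic functions do.\<close>

inductive trig_poly :: "('a::euclidean_space \<Rightarrow> complex) \<Rightarrow> bool" where
  trig_exp: "trig_poly (\<lambda>x. c * iexp (u \<bullet> x))"
| trig_add: "trig_poly f \<Longrightarrow> trig_poly g \<Longrightarrow> trig_poly (\<lambda>x. f x + g x)"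

lemma trig_poly_const: "trig_poly (\<lambda>x. c)"
  using trig_exp[of c 0] by simp

lemma trig_poly_exp_mult: "trig_poly g \<Longrightarrow> trig_poly (\<lambda>x. c * iexp (u \<bullet> x) * g x)"
proof (induction rule: trig_poly.induct)
  case (trig_exp d v)
  have "(\<lambda>x. c * iexp (u \<bullet> x) * (d * iexp (v \<bullet> x))) = (\<lambda>x. (c * d) * iexp ((u + v) \<bullet> x))"
    by (simp add: inner_add_left distrib_left exp_add mult_ac)
  then show ?case using trig_poly.trig_exp[of "c * d" "u + v"] by simp
next
  case (trig_add f g)
  then show ?case using trig_poly.trig_add[OF trig_add.IH] by (simp add: distrib_left)
qed

lemma trig_poly_mult: "trig_poly f \<Longrightarrow> trig_poly g \<Longrightarrow> trig_poly (\<lambda>x. f x * g x)"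
proof (induction rule: trig_poly.induct)
  case (trig_exp d v)
  then show ?case by (rule trig_poly_exp_mult)
next
  case (trig_add f h)
  then show ?case using trig_poly.trig_add[OF trig_add.IH(1)[OF trig_add.prems] trig_add.IH(2)[OF trig_add.prems]]
    by (simp add: distrib_right)
qed

lemma trig_poly_sum: "finite A \<Longrightarrow> (\<And>i. i \<in> A \<Longrightarrow> trig_poly (f i)) \<Longrightarrow> trig_poly (\<lambda>x. \<Sum>i\<in>A. f i x)"
  by (induction A rule: finite_induct) (auto intro: trig_poly_const trig_add)

lemma trig_poly_sin: "trig_poly (\<lambda>x. of_real (sin (u \<bullet> x)))"
proof -
  have "(\<lambda>x. complex_of_real (sin (u \<bullet> x))) = (\<lambda>x. (- \<i> / 2) * iexp (u \<bullet> x) + (\<i> / 2) * iexp ((- u) \<bullet> x))"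
    by (auto simp: complex_eq_iff Re_exp Im_exp)
  then show ?thesis using trig_add[OF trig_exp trig_exp] by metis
qed

lemma trig_poly_integrable_tendsto:
  fixes M :: "nat \<Rightarrow> 'a::euclidean_space measure"
  assumes p: "trig_poly p"
    and M: "\<And>n. prob_space (M n)" "\<And>n. sets (M n) = sets borel"
    and N: "prob_space N" "sets N = sets borel"
    and conv: "\<And>u. (\<lambda>n. charf (M n) u) \<longlonglongrightarrow> charf N u"
  shows "(\<forall>n. integrable (M n) p) \<and> integrable N p \<and> (\<lambda>n. integral\<^sup>L (M n) p) \<longlonglongrightarrow> integral\<^sup>L N p"
  using p
proof (induction rule: trig_poly.induct)
  case (trig_exp c u)
  have i: "integrable L (\<lambda>x. c * iexp (u \<bullet> x))" if "prob_space L" "sets L = sets borel" for L :: "'a measure"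
  proof -
    interpret prob_space L by fact
    have [measurable_cong]: "sets L = sets borel" by fact
    show ?thesis by (rule integrable_const_bound[where B = "norm c"]) (auto simp: norm_mult)
  qed
  have e: "(\<integral>x. c * iexp (u \<bullet> x) \<partial>L) = c * charf L u" for L :: "'a measure"
    unfolding charf_def by (rule integral_mult_right_zero)
  show ?case using i[OF M] i[OF N] tendsto_mult[OF tendsto_const conv[of u], of c] unfolding e by blast
next
  case (trig_add f g)
  then show ?case by (auto intro: tendsto_add)
qed

lemma trig_poly_polynomial_sin:
  assumes "real_polynomial_function p"
  shows "trig_poly (\<lambda>x. complex_of_real (p (\<Sum>b\<in>Basis. sin (s * (x \<bullet> b)) *\<^sub>R b)))"
  using assms
proof (induction rule: real_polynomial_function.induct)
  case (linear f)
  interpret bounded_linear f by fact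
  have "(\<lambda>x. complex_of_real (f (\<Sum>b\<in>Basis. sin (s * (x \<bullet> b)) *\<^sub>R b)))
      = (\<lambda>x. \<Sum>b\<in>Basis. of_real (f b) * of_real (sin ((s *\<^sub>R b) \<bullet> x)))"
    by (simp add: sum scaleR inner_commute mult.commute)
  then show ?case
    by (simp only:) (intro trig_poly_sum trig_poly_mult trig_poly_const trig_poly_sin finite_Basis)
next
  case (const c)
  then show ?case by (rule trig_poly_const)
next
  case (add f g)
  then show ?case using trig_add by simp
next
  case (mult f g)
  then show ?case using trig_poly_mult by simp
qed

lemma charf_real_distr:
  assumes "prob_space M" "sets M = sets borel"
  shows "char (distr M borel (\<lambda>x. u \<bullet> x)) t = charf M (t *\<^sub>R u)"
proof -
  have [measurable_cong]: "sets M = sets borel" by fact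
  show ?thesis unfolding char_def charf_def by (subst integral_distr) auto
qed

lemma real_distribution_inner:
  assumes "prob_space M" "sets M = sets borel"
  shows "real_distribution (distr M borel (\<lambda>x. u \<bullet> x))"
proof -
  interpret prob_space M by fact
  have [measurable_cong]: "sets M = sets borel" by fact
  have "(\<lambda>x. u \<bullet> x) \<in> borel_measurable borel"
    by (intro borel_measurable_continuous_onI continuous_intros)
  then show ?thesis by (intro real_distribution_distr) simp
qed

text \<open>Coordinates converge by the one-dimensional theorem, which gives tightness.  On the cube of
  half-width \<open>R\<close> the map \<open>x\<^sub>i \<mapsto> sin (pi x\<^sub>i / (2 R))\<close> is invertible, so a polynomial approximation in
  the new coordinates is a trigonometric polynomial that is bounded on the whole space.\<close>

theorem charf_continuity:
  fixes M :: "nat \<Rightarrow> 'a::euclidean_space measure" and f :: "'a \<Rightarrow> real"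
  assumes M: "\<And>n. prob_space (M n)" "\<And>n. sets (M n) = sets borel"
    and N: "prob_space N" "sets N = sets borel"
    and conv: "\<And>u. (\<lambda>n. charf (M n) u) \<longlonglongrightarrow> charf N u"
    and f: "continuous_on UNIV f" "bounded (range f)"
  shows "(\<lambda>n. integral\<^sup>L (M n) f) \<longlonglongrightarrow> integral\<^sup>L N f"
proof (rule tendstoI)
  fix \<epsilon> :: real assume eps: "\<epsilon> > 0"
  obtain F where F: "\<And>x. \<bar>f x\<bar> \<le> F" "F > 0"
    using f(2) by (auto simp: bounded_pos)
  \<comment> \<open>The tail set will have mass at most \<open>DIM('a) * \<eta>\<close>, and
    \<open>f\<close> together with its replacement varies there by at most \<open>2 * F\<close>;
    this choice keeps the product below \<open>\<epsilon> / 4\<close>.\<close>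
  define \<eta> where "\<eta> = \<epsilon> / (8 * (F + 1) * (real DIM('a) + 1))"
  have eta: "\<eta> > 0" using eps F by (simp add: \<eta>_def)
  interpret N: prob_space N by fact
  interpret M: prob_space "M n" for n by (rule M)
  have [measurable_cong]: "sets N = sets borel" "\<And>n. sets (M n) = sets borel" by fact+
  have fmeas [measurable]: "f \<in> borel_measurable borel" using f(1) by (rule borel_measurable_continuous_onI)
  let ?B = "\<lambda>R b. {x::'a. R \<le> \<bar>x \<bullet> b\<bar>}"
  have Bm [measurable]: "?B R b \<in> sets borel" for R b by measurable
  have tailN: "\<exists>R0>0. \<forall>b\<in>Basis. measure N (?B R0 b) < \<eta>"
  proof -
    have "(\<lambda>k. measure N (?B (real k) b)) \<longlonglongrightarrow> 0" for b
    proof -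
      have "(\<lambda>k. measure N (?B (real k) b)) \<longlonglongrightarrow> measure N (\<Inter>k. ?B (real k) b)"
        by (rule N.finite_Lim_measure_decseq) (auto simp: decseq_def)
      moreover have "(\<Inter>k. ?B (real k) b) = {}"
        by (auto, metis linorder_not_le reals_Archimedean2)
      ultimately show ?thesis by simp
    qed
    then have "\<forall>\<^sub>F k in sequentially. measure N (?B (real k) b) < \<eta>" for b
      using order_tendstoD(2) eta by blast
    then have "\<forall>\<^sub>F k in sequentially. (\<forall>b\<in>Basis. measure N (?B (real k) b) < \<eta>) \<and> k > 0"
      by (intro eventually_conj eventually_ball_finite eventually_gt_at_top) auto
    then obtain k :: nat where "(\<forall>b\<in>Basis. measure N (?B (real k) b) < \<eta>) \<and> k > 0"
      using eventually_happens sequentially_bot by blast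
    then show ?thesis by (intro exI[of _ "real k"]) auto
  qed
  then obtain R0 where R0: "R0 > 0" "\<And>b. b \<in> Basis \<Longrightarrow> measure N (?B R0 b) < \<eta>" by blast
  define R where "R = R0 + 1"
  \<comment> \<open>A continuous ramp squeezed between the indicators of the tails beyond
    \<open>R0 + 1\<close> and beyond \<open>R0\<close>, so that weak convergence of the coordinates
    carries the tail bound from \<open>N\<close> to \<open>M n\<close>.\<close>
  define cut where "cut y = max 0 (min 1 (\<bar>y\<bar> - R0))" for y :: real
  have cut01: "0 \<le> cut y" "cut y \<le> 1" for y by (auto simp: cut_def)
  have cutc: "isCont cut y" for y unfolding cut_def[abs_def] by (intro continuous_intros)
  have cutm [measurable]: "cut \<in> borel_measurable borel"
    using cutc by (intro borel_measurable_continuous_onI continuous_at_imp_continuous_on) auto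
  have cut_up: "indicator (?B R b) x \<le> cut (b \<bullet> x)" for b x
    by (auto simp: cut_def R_def inner_commute split: split_indicator)
  have cut_low: "cut (b \<bullet> x) \<le> indicator (?B R0 b) x" for b x
    by (auto simp: cut_def R_def inner_commute split: split_indicator)
  have cutN: "(\<integral>x. cut (b \<bullet> x) \<partial>N) < \<eta>" if "b \<in> Basis" for b
  proof -
    have "(\<integral>x. cut (b \<bullet> x) \<partial>N) \<le> (\<integral>x. indicator (?B R0 b) x \<partial>N)"
      by (intro integral_mono N.integrable_const_bound[where B = 1] AE_I2 cut_low) (auto simp: cut01 abs_of_nonneg)
    also have "\<dots> = measure N (?B R0 b)" by simp
    finally show ?thesis using R0(2)[OF that] by simp
  qed
  have weak: "(\<lambda>n. \<integral>x. cut (b \<bullet> x) \<partial>M n) \<longlonglongrightarrow> (\<integral>x. cut (b \<bullet> x) \<partial>N)" for b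
  proof -
    have w: "weak_conv_m (\<lambda>n. distr (M n) borel (\<lambda>x. b \<bullet> x)) (distr N borel (\<lambda>x. b \<bullet> x))"
    proof (rule levy_continuity)
      show "(\<lambda>n. char (distr (M n) borel (\<lambda>x. b \<bullet> x)) t) \<longlonglongrightarrow> char (distr N borel (\<lambda>x. b \<bullet> x)) t" for t
        unfolding charf_real_distr[OF M] charf_real_distr[OF N] by (rule conv)
    qed (intro real_distribution_inner M N)+
    have "(\<lambda>n. integral\<^sup>L (distr (M n) borel (\<lambda>x. b \<bullet> x)) cut) \<longlonglongrightarrow> integral\<^sup>L (distr N borel (\<lambda>x. b \<bullet> x)) cut"
      by (rule weak_conv_imp_integral_bdd_continuous_conv[OF _ _ w, where B = 1])
         (auto intro!: real_distribution_inner M N cutc simp: cut01)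
    then show ?thesis by (simp add: integral_distr)
  qed
  have tightM: "\<forall>\<^sub>F n in sequentially. \<forall>b\<in>Basis. (\<integral>x. cut (b \<bullet> x) \<partial>M n) < \<eta>"
    by (intro eventually_ball_finite ballI order_tendstoD(2)[OF weak] cutN) auto
  have tail: "measure L (\<Union>b\<in>Basis. ?B R b) \<le> real DIM('a) * \<eta>"
    if L: "prob_space L" "sets L = sets borel" and le: "\<And>b. b \<in> Basis \<Longrightarrow> (\<integral>x. cut (b \<bullet> x) \<partial>L) < \<eta>" for L :: "'a measure"
  proof -
    interpret L: prob_space L by fact
    have [measurable_cong]: "sets L = sets borel" by fact
    have "measure L (\<Union>b\<in>Basis. ?B R b) \<le> (\<Sum>b\<in>Basis. measure L (?B R b))"
      by (rule L.finite_measure_subadditive_finite) auto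
    also have "\<dots> \<le> (\<Sum>b\<in>(Basis :: 'a set). \<eta>)"
    proof (rule sum_mono)
      fix b :: 'a assume b: "b \<in> Basis"
      have "measure L (?B R b) = (\<integral>x. indicator (?B R b) x \<partial>L)" by simp
      also have "\<dots> \<le> (\<integral>x. cut (b \<bullet> x) \<partial>L)"
        by (intro integral_mono L.integrable_const_bound[where B = 1] AE_I2 cut_up) (auto simp: cut01 abs_of_nonneg)
      finally show "measure L (?B R b) \<le> \<eta>" using le[OF b] by simp
    qed
    finally show ?thesis by simp
  qed
  have R: "R > 0" using R0 by (simp add: R_def)
  define s where "s = pi / (2 * R)"
  have s0: "s \<noteq> 0" using R by (simp add: s_def)
  define \<Phi> where "\<Phi> x = (\<Sum>b\<in>Basis. sin (s * (x \<bullet> b)) *\<^sub>R b)" for x :: 'a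
  define \<Psi> where "\<Psi> y = (\<Sum>b\<in>Basis. (arcsin (y \<bullet> b) / s) *\<^sub>R b)" for y :: 'a
  define Q where "Q = cbox (- One) (One :: 'a)"
  have PhiQ: "\<Phi> x \<in> Q" for x
    by (auto simp: Q_def mem_box \<Phi>_def inner_sum_left inner_Basis if_distrib cong: if_cong)
  have PsiPhi: "\<Psi> (\<Phi> x) = x" if "x \<notin> (\<Union>b\<in>Basis. ?B R b)" for x
  proof (rule euclidean_eqI)
    fix b :: 'a assume b: "b \<in> Basis"
    have "\<bar>x \<bullet> b\<bar> < R" using that b by (auto simp: not_le)
    then have "\<bar>s * (x \<bullet> b)\<bar> \<le> pi / 2"
      using R by (simp add: s_def abs_mult field_simps)
    then have "arcsin (sin (s * (x \<bullet> b))) = s * (x \<bullet> b)" by (intro arcsin_sin) auto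
    then show "\<Psi> (\<Phi> x) \<bullet> b = x \<bullet> b"
      using b s0 by (simp add: \<Psi>_def \<Phi>_def inner_sum_left inner_Basis if_distrib cong: if_cong)
  qed
  \<comment> \<open>\<open>\<Phi>\<close> maps the whole space into the compact cube
    \<open>Q\<close>, where \<open>\<Psi>\<close> is continuous; a uniform approximation on
    \<open>Q\<close> is thus uniform along \<open>\<Phi>\<close>.\<close>
  have "continuous_on Q (\<lambda>y. f (\<Psi> y))"
  proof (rule continuous_on_compose2[OF f(1)])
    show "continuous_on Q \<Psi>"
      unfolding \<Psi>_def by (intro continuous_intros) (auto simp: Q_def mem_box s0)
  qed simp
  then obtain p where p: "real_polynomial_function p" "\<And>y. y \<in> Q \<Longrightarrow> \<bar>f (\<Psi> y) - p y\<bar> < \<epsilon> / 8"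
    using Stone_Weierstrass_real_polynomial_function[of Q "\<lambda>y. f (\<Psi> y)" "\<epsilon> / 8"] eps
    by (auto simp: Q_def compact_cbox)
  define tp where "tp x = complex_of_real (p (\<Phi> x))" for x
  have tp: "trig_poly tp" unfolding tp_def[abs_def] \<Phi>_def by (rule trig_poly_polynomial_sin[OF p(1)])
  note tpc = trig_poly_integrable_tendsto[OF tp M N conv]
  have intp: "integrable (M n) (\<lambda>x. p (\<Phi> x))" "integrable N (\<lambda>x. p (\<Phi> x))" for n
    using tpc by (auto simp: tp_def[abs_def] complex_of_real_integrable_eq)
  have "(\<lambda>n. Re (integral\<^sup>L (M n) tp)) \<longlonglongrightarrow> Re (integral\<^sup>L N tp)"
    using tpc by (intro tendsto_Re) blast
  then have pconv: "(\<lambda>n. \<integral>x. p (\<Phi> x) \<partial>M n) \<longlonglongrightarrow> (\<integral>x. p (\<Phi> x) \<partial>N)"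
    by (simp add: tp_def[abs_def])
  have close: "\<bar>(\<integral>x. f x \<partial>L) - (\<integral>x. p (\<Phi> x) \<partial>L)\<bar> \<le> 3 * \<epsilon> / 8"
    if L: "prob_space L" "sets L = sets borel" and le: "\<And>b. b \<in> Basis \<Longrightarrow> (\<integral>x. cut (b \<bullet> x) \<partial>L) < \<eta>"
      and ip: "integrable L (\<lambda>x. p (\<Phi> x))" for L :: "'a measure"
  proof -
    interpret L: prob_space L by fact
    have [measurable_cong]: "sets L = sets borel" by fact
    let ?U = "\<Union>b\<in>Basis. ?B R b"
    have U: "?U \<in> sets L" unfolding L(2) by (intro sets.finite_UN Bm finite_Basis)
    have if': "integrable L f" by (rule L.integrable_const_bound[where B = F]) (use F in auto)
    \<comment> \<open>The polynomial error is small at every \<open>x\<close>, as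
      \<open>\<Phi> x\<close> never leaves the cube. Only the replacement of \<open>f x\<close> by
      \<open>f (\<Psi> (\<Phi> x))\<close> can fail, and only on the tail set.\<close>
    have pw: "\<bar>f x - p (\<Phi> x)\<bar> \<le> \<epsilon> / 8 + 2 * F * indicator ?U x" for x
    proof -
      have "\<bar>f (\<Psi> (\<Phi> x)) - p (\<Phi> x)\<bar> \<le> \<epsilon> / 8" using p(2)[OF PhiQ[of x]] by simp
      moreover have "\<bar>f x - f (\<Psi> (\<Phi> x))\<bar> \<le> 2 * F * indicator ?U x"
        using F(1)[of x] F(1)[of "\<Psi> (\<Phi> x)"] PsiPhi[of x] by (cases "x \<in> ?U") auto
      ultimately show ?thesis by linarith
    qed
    have "\<bar>(\<integral>x. f x \<partial>L) - (\<integral>x. p (\<Phi> x) \<partial>L)\<bar> = \<bar>\<integral>x. f x - p (\<Phi> x) \<partial>L\<bar>" using if' ip by simp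
    also have "\<dots> \<le> (\<integral>x. \<bar>f x - p (\<Phi> x)\<bar> \<partial>L)" by (rule integral_abs_bound)
    also have "\<dots> \<le> (\<integral>x. \<epsilon> / 8 + 2 * F * indicator ?U x \<partial>L)"
      by (intro integral_mono pw integrable_abs Bochner_Integration.integrable_diff if' ip
          Bochner_Integration.integrable_add integrable_mult_right integrable_real_indicator)
         (use U in \<open>auto simp: L.emeasure_eq_measure\<close>)
    also have "\<dots> = \<epsilon> / 8 + 2 * F * measure L ?U"
    proof -
      have "integrable L (indicator ?U :: 'a \<Rightarrow> real)"
        by (rule integrable_real_indicator[OF U]) (simp add: L.emeasure_eq_measure)
      then have "(\<integral>x. \<epsilon> / 8 + 2 * F * indicator ?U x \<partial>L) = (\<integral>x. \<epsilon> / 8 \<partial>L) + (\<integral>x. 2 * F * indicator ?U x \<partial>L)"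
        by (intro Bochner_Integration.integral_add integrable_mult_right) auto
      also have "(\<integral>x. 2 * F * indicator ?U x \<partial>L) = 2 * F * measure L ?U"
        using sets_eq_imp_space_eq[OF L(2)] by simp
      finally show ?thesis by (simp add: L.prob_space)
    qed
    also have "\<dots> \<le> \<epsilon> / 8 + 2 * F * (real DIM('a) * \<eta>)"
      using tail[OF L le] F by (intro add_left_mono mult_left_mono) auto
    also have "2 * F * (real DIM('a) * \<eta>) \<le> 2 * \<epsilon> / 8"
    proof -
      have "F * real DIM('a) \<le> (F + 1) * (real DIM('a) + 1)" using F by (intro mult_mono) auto
      then have "F * real DIM('a) * (8 * \<eta>) \<le> (F + 1) * (real DIM('a) + 1) * (8 * \<eta>)" using eta by (intro mult_right_mono) auto
      also have "\<dots> = \<epsilon>"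
      proof -
        have cancel: "x * y * (8 * (\<epsilon> / (8 * x * y))) = \<epsilon>" if "x \<noteq> 0" "y \<noteq> 0" for x y :: real
          using that by simp
        show ?thesis unfolding \<eta>_def by (rule cancel) (use F in auto)
      qed
      finally show ?thesis by (simp add: mult_ac)
    qed
    finally show ?thesis by simp
  qed
  have closeN: "\<bar>(\<integral>x. f x \<partial>N) - (\<integral>x. p (\<Phi> x) \<partial>N)\<bar> \<le> 3 * \<epsilon> / 8"
    by (rule close[OF N cutN intp(2)])
  have "\<forall>\<^sub>F n in sequentially. dist (\<integral>x. p (\<Phi> x) \<partial>M n) (\<integral>x. p (\<Phi> x) \<partial>N) < \<epsilon> / 8"
    using pconv eps by (intro tendstoD) auto
  then show "\<forall>\<^sub>F n in sequentially. dist (integral\<^sup>L (M n) f) (integral\<^sup>L N f) < \<epsilon>"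
    using tightM
  proof eventually_elim
    case (elim n)
    have "\<bar>(\<integral>x. f x \<partial>M n) - (\<integral>x. p (\<Phi> x) \<partial>M n)\<bar> \<le> 3 * \<epsilon> / 8"
      using elim by (intro close[OF M _ intp(1)]) auto
    then show ?case using elim(1) closeN eps unfolding dist_real_def by linarith
  qed
qed

section \<open>Gaussian laws\<close>

lemma real_distribution_gaussian: "s \<ge> 0 \<Longrightarrow> real_distribution (gaussian m s)"
  unfolding gaussian_def
  by (auto simp: real_distribution_def real_distribution_axioms_def
      intro!: prob_space_return prob_space_normal_density)

lemma distr_std_normal_scale:
  assumes "s > 0"
  shows "distr std_normal_distribution borel (\<lambda>x. s * x) = density lborel (normal_density 0 s)"
proof -
  interpret prob_space std_normal_distribution by (rule prob_space_normal_density) simp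
  have "distributed std_normal_distribution lborel (\<lambda>x. x) std_normal_density"
    by (auto simp: distributed_def distr_id2 sets_eq_imp_space_eq)
  from normal_density_affine[OF this, of s 0] assms
  have "distributed std_normal_distribution lborel (\<lambda>x. s * x) (normal_density 0 s)" by simp
  then have "distr std_normal_distribution lborel (\<lambda>x. s * x) = density lborel (normal_density 0 s)"
    by (simp add: distributed_distr_eq_density)
  moreover have "distr std_normal_distribution lborel (\<lambda>x. s * x) = distr std_normal_distribution borel (\<lambda>x. s * x)"
    by (rule distr_cong) auto
  ultimately show ?thesis by simp
qed

lemma char_gaussian:
  assumes "s \<ge> 0"
  shows "char (gaussian 0 s) t = of_real (exp (- (s * t)\<^sup>2 / 2))"
proof (cases "s = 0")
  case True
  then show ?thesis by (simp add: char_def gaussian_def integral_return)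
next
  case False
  then have s: "s > 0" using assms by simp
  have "char (gaussian 0 s) t = (\<integral>x. iexp (t * x) \<partial>distr std_normal_distribution borel (\<lambda>x. s * x))"
    using False by (simp add: char_def gaussian_def distr_std_normal_scale[OF s])
  also have "\<dots> = (\<integral>x. iexp (t * (s * x)) \<partial>std_normal_distribution)"
    by (rule integral_distr) auto
  also have "\<dots> = char std_normal_distribution (s * t)"
    by (simp add: char_def mult_ac)
  finally show ?thesis by (simp add: char_std_normal_distribution)
qed

lemma psd_Cauchy_Schwarz:
  fixes Q :: "'a::real_vector \<Rightarrow> 'a \<Rightarrow> real"
  assumes lin: "\<And>x. linear (Q x)" and sym: "\<And>x y. Q x y = Q y x" and psd: "\<And>x. 0 \<le> Q x x"
  shows "(Q x y)\<^sup>2 \<le> Q x x * Q y y"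
proof -
  have lin1: "linear (\<lambda>x. Q x y)" for y using lin[of y] sym[of _ y] by simp
  have expand: "Q (x - t *\<^sub>R y) (x - t *\<^sub>R y) = Q x x - 2 * t * Q x y + t\<^sup>2 * Q y y" for t
    using sym[of y x]
    by (simp add: linear_diff[OF lin] linear_diff[OF lin1] linear_cmul[OF lin] linear_cmul[OF lin1] power2_eq_square algebra_simps)
  show ?thesis
  proof (cases "Q y y = 0")
    case False
    then have y: "Q y y > 0" using psd[of y] by simp
    have "0 \<le> Q x x - 2 * (Q x y / Q y y) * Q x y + (Q x y / Q y y)\<^sup>2 * Q y y"
      using psd[of "x - (Q x y / Q y y) *\<^sub>R y"] unfolding expand .
    also have "\<dots> = Q x x - (Q x y)\<^sup>2 / Q y y" using y by (simp add: power2_eq_square)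
    finally show ?thesis using y by (simp add: pos_divide_le_eq)
  next
    case True
    have "Q x y = 0"
    proof (rule ccontr)
      assume ne: "Q x y \<noteq> 0"
      \<comment> \<open>With \<open>Q y y = 0\<close> the form is affine in the multiple of
        \<open>y\<close>; this multiple is chosen to give it the value -1.\<close>
      have "0 \<le> Q x x - 2 * ((Q x x + 1) / (2 * Q x y)) * Q x y"
        using psd[of "x - ((Q x x + 1) / (2 * Q x y)) *\<^sub>R y"] unfolding expand True by simp
      then show False using ne by (simp add: field_simps)
    qed
    then show ?thesis using True by simp
  qed
qed

text \<open>Every positive semidefinite form is a covariance: peel off one basis direction at a time by a
  rank-one form, i.e. by adding an independent normal multiple of a fixed vector.\<close>

lemma gaussian_measure_exists_aux:
  fixes Q :: "'a::euclidean_space \<Rightarrow> 'a \<Rightarrow> real"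
  assumes "finite I" "I \<subseteq> Basis"
    and "\<And>x. linear (Q x)" "\<And>x y. Q x y = Q y x" "\<And>x. 0 \<le> Q x x"
    and "\<And>b u. b \<in> Basis - I \<Longrightarrow> Q b u = 0"
  shows "\<exists>M. prob_space M \<and> sets M = sets borel \<and> (\<forall>u. charf M u = of_real (exp (- Q u u / 2)))"
  using assms
proof (induction I arbitrary: Q rule: finite_induct)
  case empty
  have lin1: "linear (\<lambda>x. Q x y)" for y using empty.prems(2)[of y] empty.prems(3)[of _ y] by simp
  have "Q u u = 0" for u
  proof -
    have "Q u u = Q (\<Sum>b\<in>Basis. (u \<bullet> b) *\<^sub>R b) u" by (simp add: euclidean_representation)
    also have "\<dots> = (\<Sum>b\<in>Basis. (u \<bullet> b) * Q b u)"
      by (simp add: linear_sum[OF lin1] linear_cmul[OF lin1])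
    finally show ?thesis using empty.prems(5) by simp
  qed
  moreover have "charf (return borel (0 :: 'a)) u = 1" for u :: 'a
    unfolding charf_def by (subst integral_return) auto
  ultimately show ?case
    by (intro exI[of _ "return borel 0"]) (auto intro: prob_space_return)
next
  case (insert k I)
  note lin = insert.prems(2) and sym = insert.prems(3) and psd = insert.prems(4)
  note CS = psd_Cauchy_Schwarz[of Q, OF lin sym psd]
  show ?case
  proof (cases "Q k k = 0")
    case True
    then have "Q k u = 0" for u using CS[of k u] by simp
    then have "Q b u = 0" if "b \<in> Basis - I" for b u
      using that insert.prems(5)[of b u] by (cases "b = k") auto
    then show ?thesis using insert.prems(1) by (intro insert.IH[of Q] lin sym psd) auto
  next
    case False
    then have r: "Q k k > 0" using psd[of k] by simp
    define l where "l u = Q k u / sqrt (Q k k)" for u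
    have linl: "linear l" unfolding l_def[abs_def] using linear_compose[OF lin[of k], of "\<lambda>x. x / sqrt (Q k k)"]
      by (simp add: o_def linear_iff add_divide_distrib)
    have l2: "(l u)\<^sup>2 = (Q k u)\<^sup>2 / Q k k" for u using r by (simp add: l_def power_divide)
    define v where "v = (\<Sum>b\<in>Basis. l b *\<^sub>R b)"
    have v: "u \<bullet> v = l u" for u
    proof -
      have "l u = l (\<Sum>b\<in>Basis. (u \<bullet> b) *\<^sub>R b)" by (simp add: euclidean_representation)
      also have "\<dots> = (\<Sum>b\<in>Basis. (u \<bullet> b) * l b)"
        by (simp add: linear_sum[OF linl] linear_cmul[OF linl])
      finally show ?thesis by (simp add: v_def inner_sum_right mult.commute)
    qed
    \<comment> \<open>The Schur complement of the entry \<open>Q k k\<close>: Cauchy-Schwarz keeps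
      it nonnegative, and it vanishes in the direction \<open>k\<close> too. The removed rank-one
      form is the variance of a normal multiple of \<open>v\<close>.\<close>
    define Q' where "Q' x y = Q x y - l x * l y" for x y
    have "\<exists>M. prob_space M \<and> sets M = sets borel \<and> (\<forall>u. charf M u = of_real (exp (- Q' u u / 2)))"
    proof (rule insert.IH[of Q'])
      show "linear (Q' x)" for x
        by (rule linearI)
           (simp_all add: Q'_def linear_add[OF lin] linear_cmul[OF lin] linear_add[OF linl] linear_cmul[OF linl] algebra_simps)
      show "Q' x y = Q' y x" for x y by (simp add: Q'_def sym[of x y])
      show "0 \<le> Q' x x" for x
        using CS[of k x] r by (simp add: Q'_def l2 pos_divide_le_eq mult.commute flip: power2_eq_square)
      fix b u assume b: "b \<in> Basis - I"
      show "Q' b u = 0"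
      proof (cases "b = k")
        case True
        have "l k * l u = Q k u" using r by (simp add: l_def)
        then show ?thesis using True by (simp add: Q'_def)
      next
        case False
        then have "Q b u = 0" for u using insert.prems(5) b by blast
        then show ?thesis using sym[of k b] by (simp add: Q'_def l_def)
      qed
    qed (use insert.prems in auto)
    then obtain M where M: "prob_space M" "sets M = sets borel" "\<And>u. charf M u = of_real (exp (- Q' u u / 2))" by blast
    interpret M: prob_space M by fact
    interpret N: prob_space std_normal_distribution by (rule prob_space_normal_density) simp
    interpret MN: pair_prob_space M std_normal_distribution ..
    have [measurable_cong]: "sets M = sets borel" by fact
    define L where "L = distr (M \<Otimes>\<^sub>M std_normal_distribution) borel (\<lambda>(x, z). x + z *\<^sub>R v)"
    have meas: "(\<lambda>(x, z). x + z *\<^sub>R v) \<in> borel_measurable (M \<Otimes>\<^sub>M std_normal_distribution)"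
      by measurable
    have "prob_space L" unfolding L_def by (rule MN.prob_space_distr[OF meas])
    moreover have "charf L u = of_real (exp (- Q u u / 2))" for u
    proof -
      have "charf L u = (\<integral>p. iexp (u \<bullet> (fst p + snd p *\<^sub>R v)) \<partial>(M \<Otimes>\<^sub>M std_normal_distribution))"
        unfolding charf_def L_def by (subst integral_distr[OF meas]) (auto simp: case_prod_beta)
      also have "\<dots> = (\<integral>x. (\<integral>z. iexp (u \<bullet> (x + z *\<^sub>R v)) \<partial>std_normal_distribution) \<partial>M)"
        by (subst MN.integral_fst'[symmetric]) (auto intro!: MN.integrable_const_bound[where B = 1])
      also have "\<dots> = (\<integral>x. iexp (u \<bullet> x) * char std_normal_distribution (l u) \<partial>M)"
      proof (intro Bochner_Integration.integral_cong refl)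
        fix x
        have "(\<integral>z. iexp (u \<bullet> (x + z *\<^sub>R v)) \<partial>std_normal_distribution) = (\<integral>z. iexp (u \<bullet> x) * iexp (l u * z) \<partial>std_normal_distribution)"
          by (simp add: inner_add_right v distrib_left exp_add mult_ac)
        then show "(\<integral>z. iexp (u \<bullet> (x + z *\<^sub>R v)) \<partial>std_normal_distribution) = iexp (u \<bullet> x) * char std_normal_distribution (l u)"
          by (simp only: char_def integral_mult_right_zero)
      qed
      also have "\<dots> = charf M u * char std_normal_distribution (l u)"
        unfolding charf_def by (rule integral_mult_left_zero)
      also have "\<dots> = of_real (exp (- Q' u u / 2 + - (l u)\<^sup>2 / 2))"
        unfolding M(3) char_std_normal_distribution exp_add by simp
      also have "- Q' u u / 2 + - (l u)\<^sup>2 / 2 = - Q u u / 2" by (simp add: Q'_def power2_eq_square diff_divide_distrib)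
      finally show ?thesis .
    qed
    ultimately show ?thesis by (intro exI[of _ L]) (auto simp: L_def)
  qed
qed

lemma gaussian_measure_exists:
  fixes Q :: "'a::euclidean_space \<Rightarrow> 'a \<Rightarrow> real"
  assumes "\<And>x. linear (Q x)" "\<And>x y. Q x y = Q y x" "\<And>x. 0 \<le> Q x x"
  obtains M where "prob_space M" "sets M = sets borel" "\<And>u. charf M u = of_real (exp (- Q u u / 2))"
  using gaussian_measure_exists_aux[of Basis Q] assms by auto

lemma gaussian_vectorI:
  fixes M :: "(real ^ 'j) measure"
  assumes M: "prob_space M" "sets M = sets borel" "\<And>u. charf M u = of_real (exp (- Q u u / 2))"
    and Q: "\<And>x. linear (Q x)" "\<And>x y. Q x y = Q y x" "\<And>x. 0 \<le> Q x x"
  shows "gaussian_vector M"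
  unfolding gaussian_vector_def
proof (intro conjI allI)
  fix u :: "real ^ 'j"
  have lin1: "linear (\<lambda>x. Q x y)" for y using Q(1)[of y] Q(2)[of _ y] by simp
  have "distr M borel (\<lambda>x. u \<bullet> x) = gaussian 0 (sqrt (Q u u))"
  proof (rule Levy_uniqueness)
    show "char (distr M borel (\<lambda>x. u \<bullet> x)) = char (gaussian 0 (sqrt (Q u u)))"
    proof
      fix t
      have "Q (t *\<^sub>R u) (t *\<^sub>R u) = (sqrt (Q u u) * t)\<^sup>2"
        using Q(3)[of u] by (simp add: linear_cmul[OF Q(1)] linear_cmul[OF lin1] power_mult_distrib power2_eq_square)
      then show "char (distr M borel (\<lambda>x. u \<bullet> x)) t = char (gaussian 0 (sqrt (Q u u))) t"
        using Q(3)[of u] by (simp add: charf_real_distr[OF M(1,2)] M(3) char_gaussian)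
    qed
  qed (use Q(3) real_distribution_inner[OF M(1,2), of u] in \<open>auto intro: real_distribution_gaussian\<close>)
  then show "\<exists>m s. 0 \<le> s \<and> distr M borel (\<lambda>x. u \<bullet> x) = gaussian m s"
    using Q(3)[of u] by (intro exI[of _ 0] exI[of _ "sqrt (Q u u)"]) auto
qed (use M in auto)

text \<open>Off the set \<open>S\<close> the sequence is replaced by its limit, which turns convergence along \<open>S\<close> into
  convergence of a sequence.\<close>

lemma conv_distr_along:
  fixes p :: "nat \<Rightarrow> 'a::euclidean_space pmf"
  assumes N: "prob_space N" "sets N = sets borel"
    and conv: "\<And>u. ((\<lambda>n. measure_pmf.expectation (p n) (\<lambda>x. iexp (u \<bullet> x))) \<longlongrightarrow> charf N u) (inf at_top (principal S))"
  shows "conv_distr (inf at_top (principal S)) (\<lambda>n. measure_pmf (p n)) N"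
  unfolding conv_distr_def
proof (intro allI impI)
  fix f :: "'a \<Rightarrow> real" assume f: "continuous_on UNIV f \<and> bounded (range f)"
  have fm: "f \<in> borel_measurable borel" using f by (intro borel_measurable_continuous_onI) simp
  define M where "M n = (if n \<in> S then distr (measure_pmf (p n)) borel (\<lambda>x. x) else N)" for n
  have M: "prob_space (M n)" "sets (M n) = sets borel" for n
    using N by (auto simp: M_def intro!: measure_pmf.prob_space_distr)
  have int: "integral\<^sup>L (M n) g = (if n \<in> S then measure_pmf.expectation (p n) g else integral\<^sup>L N g)"
    if "g \<in> borel_measurable borel" for g :: "'a \<Rightarrow> 'b::{banach, second_countable_topology}" and n
    using that by (auto simp: M_def integral_distr)
  have cm: "(\<lambda>x. iexp (u \<bullet> x)) \<in> borel_measurable borel" for u :: 'a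
    by (intro borel_measurable_continuous_onI continuous_intros)
  have "(\<lambda>n. integral\<^sup>L (M n) f) \<longlonglongrightarrow> integral\<^sup>L N f"
  proof (rule charf_continuity[OF M N])
    fix u
    show "(\<lambda>n. charf (M n) u) \<longlonglongrightarrow> charf N u"
    proof (rule tendstoI)
      fix e :: real assume "e > 0"
      from tendstoD[OF conv[of u] this]
      have "\<forall>\<^sub>F n in sequentially. n \<in> S \<longrightarrow> dist (measure_pmf.expectation (p n) (\<lambda>x. iexp (u \<bullet> x))) (charf N u) < e"
        by (simp add: eventually_inf_principal)
      then show "\<forall>\<^sub>F n in sequentially. dist (charf (M n) u) (charf N u) < e"
        by eventually_elim (use \<open>e > 0\<close> in \<open>auto simp: charf_def int[OF cm]\<close>)
    qed
  qed (use f in auto)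
  then show "((\<lambda>n. integral\<^sup>L (measure_pmf (p n)) f) \<longlongrightarrow> integral\<^sup>L N f) (inf at_top (principal S))"
    unfolding int[OF fm]
  proof (intro tendstoI)
    fix e :: real
    assume "(\<lambda>n. if n \<in> S then measure_pmf.expectation (p n) f else integral\<^sup>L N f) \<longlonglongrightarrow> integral\<^sup>L N f"
      and "e > 0"
    then have "\<forall>\<^sub>F n in sequentially. dist (if n \<in> S then measure_pmf.expectation (p n) f else integral\<^sup>L N f) (integral\<^sup>L N f) < e"
      by (rule tendstoD)
    then show "\<forall>\<^sub>F n in inf at_top (principal S). dist (measure_pmf.expectation (p n) f) (integral\<^sup>L N f) < e"
      unfolding eventually_inf_principal by eventually_elim auto
  qed
qed

section \<open>Truncated second moments\<close>

definition trunc_mom2 :: "nat pmf \<Rightarrow> real \<Rightarrow> real" where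
  "trunc_mom2 \<mu> y = measure_pmf.expectation \<mu> (\<lambda>k. if real k \<le> y then (real k)\<^sup>2 else 0)"

lemma integrable_truncated:
  fixes f :: "nat \<Rightarrow> real"
  shows "integrable (measure_pmf \<mu>) (\<lambda>k. if real k \<le> y then f k else 0)"
proof (rule measure_pmf.integrable_const_bound)
  have fin: "finite {k. real k \<le> y}"
    by (rule finite_subset[of _ "{..nat \<lceil>y\<rceil>}"]) (auto simp: le_nat_iff, linarith)
  have "norm (if real k \<le> y then f k else 0) \<le> (\<Sum>j | real j \<le> y. \<bar>f j\<bar>)" for k
    using fin by (auto intro: member_le_sum sum_nonneg)
  then show "AE k in \<mu>. norm (if real k \<le> y then f k else 0) \<le> (\<Sum>j | real j \<le> y. \<bar>f j\<bar>)" by simp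
qed simp

lemma trunc_mom2_nonneg: "0 \<le> trunc_mom2 \<mu> y"
  unfolding trunc_mom2_def by (rule integral_nonneg_AE) simp

lemma trunc_mom2_mono: "x \<le> y \<Longrightarrow> trunc_mom2 \<mu> x \<le> trunc_mom2 \<mu> y"
  unfolding trunc_mom2_def by (intro integral_mono integrable_truncated) auto

text \<open>By monotone convergence a bound on the truncated moments would bound the full second
  moment.\<close>

lemma trunc_mom2_at_top:
  assumes "infinite_variance \<mu>"
  shows "filterlim (trunc_mom2 \<mu>) at_top at_top"
proof -
  have ex: "\<exists>y. C \<le> trunc_mom2 \<mu> y" for C
  proof (rule ccontr)
    assume "\<nexists>y. C \<le> trunc_mom2 \<mu> y"
    then have bd: "trunc_mom2 \<mu> y \<le> C" for y by (meson linear)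
    let ?f = "\<lambda>n k. ennreal (if real k \<le> real n then (real k)\<^sup>2 else 0)"
    have sup: "(SUP n. ?f n k) = ennreal ((real k)\<^sup>2)" for k
    proof (rule antisym)
      show "ennreal ((real k)\<^sup>2) \<le> (SUP n. ?f n k)" by (rule SUP_upper2[of k]) auto
    qed (rule SUP_least, auto)
    have "(\<integral>\<^sup>+k. ennreal ((real k)\<^sup>2) \<partial>\<mu>) = (\<integral>\<^sup>+k. (SUP n. ?f n k) \<partial>\<mu>)"
      unfolding sup ..
    also have "\<dots> = (SUP n. \<integral>\<^sup>+k. ?f n k \<partial>\<mu>)"
      by (rule nn_integral_monotone_convergence_SUP) (auto intro!: incseq_SucI le_funI)
    also have "\<dots> \<le> ennreal C"
    proof (rule SUP_least)
      fix n
      have "(\<integral>\<^sup>+k. ?f n k \<partial>\<mu>) = ennreal (trunc_mom2 \<mu> (real n))"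
        unfolding trunc_mom2_def by (rule nn_integral_eq_integral[OF integrable_truncated]) simp
      then show "(\<integral>\<^sup>+k. ?f n k \<partial>\<mu>) \<le> ennreal C" using bd[of "real n"] by (simp add: ennreal_leI)
    qed
    finally have "(\<integral>\<^sup>+k. ennreal ((real k)\<^sup>2) \<partial>\<mu>) < \<infinity>"
      by (rule le_less_trans) simp
    then have "integrable \<mu> (\<lambda>k. (real k)\<^sup>2)" by (intro integrableI_nonneg) auto
    then show False using assms by (simp add: infinite_variance_def)
  qed
  show ?thesis
    unfolding filterlim_at_top
  proof
    fix C
    obtain y where y: "C \<le> trunc_mom2 \<mu> y" using ex by blast
    show "\<forall>\<^sub>F x in at_top. C \<le> trunc_mom2 \<mu> x"
      using eventually_ge_at_top[of y]
      by eventually_elim (use y trunc_mom2_mono order_trans in blast)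
  qed
qed

locale critical_stable =
  fixes \<mu> :: "nat pmf" and \<alpha> :: real
  assumes crit: "critical \<mu>" and inf_var: "infinite_variance \<mu>"
    and alpha: "1 < \<alpha>" "\<alpha> \<le> 2" and dom: "stable_domain \<mu> \<alpha>"
begin

abbreviation K :: "real \<Rightarrow> real" where "K \<equiv> trunc_mom2 \<mu>"

lemma integrable_mean: "integrable \<mu> real" and mean: "measure_pmf.expectation \<mu> real = 1"
  using crit by (auto simp: critical_def)

lemma K_at_top: "filterlim K at_top at_top"
  by (rule trunc_mom2_at_top[OF inf_var])

text \<open>Criticality puts the truncated mean into [0, 1], so variance and second moment differ by
  at most 1. The second moment is preferable because it is monotone in the truncation level.\<close>

lemma trunc_var_bounds: "K y - 1 \<le> trunc_var \<mu> y" "trunc_var \<mu> y \<le> K y"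
proof -
  let ?X = "\<lambda>k. if real k \<le> y then real k else 0"
  let ?m = "measure_pmf.expectation \<mu> ?X"
  have sq: "(\<lambda>k. (?X k)\<^sup>2) = (\<lambda>k. if real k \<le> y then (real k)\<^sup>2 else 0)" by auto
  have "trunc_var \<mu> y = measure_pmf.expectation \<mu> (\<lambda>k. (?X k)\<^sup>2) - ?m\<^sup>2"
    unfolding trunc_var_def
    by (rule measure_pmf.variance_eq) (simp_all only: sq integrable_truncated)
  then have eq: "trunc_var \<mu> y = K y - ?m\<^sup>2" by (simp add: sq trunc_mom2_def)
  have "0 \<le> ?m" by (rule integral_nonneg_AE) simp
  moreover have "?m \<le> measure_pmf.expectation \<mu> real"
    by (intro integral_mono integrable_truncated integrable_mean) auto
  ultimately have "0 \<le> ?m" "?m \<le> 1" using mean by auto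
  then have "?m\<^sup>2 \<le> 1" by (simp add: power_le_one)
  then show "K y - 1 \<le> trunc_var \<mu> y" "trunc_var \<mu> y \<le> K y" by (auto simp: eq)
qed

text \<open>As \<open>K\<close> tends to infinity, its bounded distance to \<open>trunc_var\<close>
  disappears in the ratio, and \<open>K\<close> inherits regular variation of index 2 -
  \<alpha>.\<close>

lemma K_regular:
  assumes l: "l > 0"
  shows "((\<lambda>x. K (l * x) / K x) \<longlongrightarrow> l powr (2 - \<alpha>)) at_top"
proof -
  obtain L where L: "slowly_varying L" "trunc_var \<mu> \<sim>[at_top] (\<lambda>x. x powr (2 - \<alpha>) * L x)"
    using dom by (auto simp: stable_domain_def)
  let ?V = "trunc_var \<mu>" and ?R = "\<lambda>x. x powr (2 - \<alpha>) * L x"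
  have lx: "filterlim (\<lambda>x. l * x) at_top at_top"
    using l by (rule filterlim_tendsto_pos_mult_at_top[OF tendsto_const _ filterlim_ident])
  have VK: "((\<lambda>x. ?V x / K x) \<longlongrightarrow> 1) at_top"
  proof (rule tendsto_sandwich)
    show "\<forall>\<^sub>F x in at_top. 1 - 1 / K x \<le> ?V x / K x"
      using K_at_top[unfolded filterlim_at_top, rule_format, of 1]
    proof eventually_elim
      case (elim x)
      then have "(K x - 1) / K x \<le> ?V x / K x" using trunc_var_bounds(1)[of x] by (intro divide_right_mono) auto
      then show ?case using elim by (simp add: diff_divide_distrib)
    qed
    show "\<forall>\<^sub>F x in at_top. ?V x / K x \<le> 1"
      using K_at_top[unfolded filterlim_at_top, rule_format, of 1]
    proof eventually_elim
      case (elim x)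
      then show ?case using trunc_var_bounds(2)[of x] by (simp add: field_simps)
    qed
    have "((\<lambda>x. 1 - 1 / K x) \<longlongrightarrow> 1 - 0) at_top"
      by (intro tendsto_intros tendsto_divide_0[OF tendsto_const] filterlim_at_top_imp_at_infinity K_at_top)
    then show "((\<lambda>x. 1 - 1 / K x) \<longlongrightarrow> 1) at_top" by simp
  qed simp
  have K2: "\<forall>\<^sub>F x in at_top. K x > 1"
    using K_at_top[unfolded filterlim_at_top_dense] by blast
  have Lpos: "\<forall>\<^sub>F x in at_top. L x > 0" using L by (simp add: slowly_varying_def)
  have Rne: "\<forall>\<^sub>F x in at_top. ?R x \<noteq> 0"
    using Lpos eventually_gt_at_top[of 0] by eventually_elim auto
  have VR: "((\<lambda>x. ?V x / ?R x) \<longlongrightarrow> 1) at_top"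
    using asymp_equivD_strong[OF L(2)] Rne by (simp add: eventually_mono)
  have R: "((\<lambda>x. ?R (l * x) / ?R x) \<longlongrightarrow> l powr (2 - \<alpha>)) at_top"
  proof (rule Lim_transform_eventually)
    show "((\<lambda>x. l powr (2 - \<alpha>) * (L (l * x) / L x)) \<longlongrightarrow> l powr (2 - \<alpha>)) at_top"
    proof -
      have "((\<lambda>x. L (l * x) / L x) \<longlongrightarrow> 1) at_top" using L(1) l by (simp add: slowly_varying_def)
      from tendsto_mult[OF tendsto_const this] show ?thesis by simp
    qed
    show "\<forall>\<^sub>F x in at_top. l powr (2 - \<alpha>) * (L (l * x) / L x) = ?R (l * x) / ?R x"
      using eventually_gt_at_top[of 0] by eventually_elim (use l in \<open>simp add: powr_mult\<close>)
  qed
  have KR: "((\<lambda>x. K x / ?R x) \<longlongrightarrow> 1) at_top"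
  proof (rule Lim_transform_eventually)
    show "((\<lambda>x. (?V x / ?R x) / (?V x / K x)) \<longlongrightarrow> 1) at_top"
      using tendsto_divide[OF VR VK] by simp
    show "\<forall>\<^sub>F x in at_top. (?V x / ?R x) / (?V x / K x) = K x / ?R x"
      using K2
    proof eventually_elim
      case (elim x)
      then have "?V x > 0" using trunc_var_bounds(1)[of x] by linarith
      then show ?case by (simp add: field_simps)
    qed
  qed
  have KR': "((\<lambda>x. K (l * x) / ?R (l * x)) \<longlongrightarrow> 1) at_top"
    using filterlim_compose[OF KR lx] .
  have "((\<lambda>x. (K (l * x) / ?R (l * x)) * (?R (l * x) / ?R x) / (K x / ?R x)) \<longlongrightarrow> 1 * l powr (2 - \<alpha>) / 1) at_top"
    by (intro tendsto_intros KR KR' R) simp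
  moreover have "\<forall>\<^sub>F x in at_top. (K (l * x) / ?R (l * x)) * (?R (l * x) / ?R x) / (K x / ?R x) = K (l * x) / K x"
    using Rne eventually_compose_filterlim[OF Rne lx]
    by eventually_elim (simp add: field_simps)
  ultimately show ?thesis by (auto intro: Lim_transform_eventually)
qed

text \<open>The midpoint of 2 - \<alpha> and 1. It lies strictly above the index of
  \<open>K\<close>, as the Potter bound requires, and strictly below 1, so that
  \<open>z powr (\<gamma> - 2)\<close> is integrable at infinity and \<open>kk s / s\<close>
  vanishes at 0.\<close>

definition \<gamma> :: real where "\<gamma> = (3 - \<alpha>) / 2"

lemma gamma_bounds: "0 < \<gamma>" "\<gamma> < 1" "2 - \<alpha> < \<gamma>"
  using alpha by (auto simp: \<gamma>_def)

text \<open>A one-sided Potter bound by doubling: beyond \<open>y0\<close> each doubling costs at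
  most \<open>2 powr \<gamma>\<close>, and monotonicity bridges the gaps between powers of two. The
  constant 2 pays for the one doubling by which the exponent is rounded up.\<close>

lemma K_Potter:
  obtains y0 where "y0 \<ge> 1" "K y0 \<ge> 1"
    "\<And>y r. y \<ge> y0 \<Longrightarrow> r \<ge> 1 \<Longrightarrow> K (r * y) \<le> 2 * r powr \<gamma> * K y"
proof -
  have lt: "2 powr (2 - \<alpha>) < (2::real) powr \<gamma>" using gamma_bounds by simp
  have "\<forall>\<^sub>F x in at_top. K (2 * x) / K x < 2 powr \<gamma>"
    using order_tendstoD(2)[OF K_regular[of 2] lt] by simp
  moreover have "\<forall>\<^sub>F x in at_top. K x \<ge> 1" using K_at_top by (simp add: filterlim_at_top)
  ultimately have "\<forall>\<^sub>F x in at_top. K (2 * x) / K x < 2 powr \<gamma> \<and> K x \<ge> 1 \<and> x \<ge> 1"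
    using eventually_ge_at_top[of 1] by (intro eventually_conj)
  then obtain y0 where y0: "\<And>x. x \<ge> y0 \<Longrightarrow> K (2 * x) / K x < 2 powr \<gamma> \<and> K x \<ge> 1 \<and> x \<ge> 1"
    by (auto simp: eventually_at_top_linorder)
  have dbl: "K (2 ^ j * y) \<le> (2 powr \<gamma>) ^ j * K y" if "y \<ge> y0" for j y
  proof (induction j)
    case (Suc j)
    have "y \<ge> 1" using y0 that by blast
    then have "2 ^ j * y \<ge> y" by (simp add: mult_le_cancel_right1)
    then have "2 ^ j * y \<ge> y0" using that by linarith
    from y0[OF this] have "K (2 * (2 ^ j * y)) \<le> 2 powr \<gamma> * K (2 ^ j * y)"
      by (auto simp: field_simps split: if_splits)
    also have "\<dots> \<le> 2 powr \<gamma> * ((2 powr \<gamma>) ^ j * K y)" using Suc by simp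
    finally show ?case by (simp add: mult_ac)
  qed simp
  have "K (r * y) \<le> 2 * r powr \<gamma> * K y" if "y \<ge> y0" "r \<ge> 1" for y r
  proof -
    define j where "j = nat \<lfloor>log 2 r\<rfloor>"
    have l0: "0 \<le> log 2 r" using that by simp
    then have j: "real j \<le> log 2 r" "log 2 r \<le> real (Suc j)"
      unfolding j_def by (simp_all add: of_nat_nat) linarith
    have rj: "r \<le> 2 ^ Suc j"
    proof -
      have "r = 2 powr (log 2 r)" using that by simp
      also have "\<dots> \<le> 2 powr real (Suc j)" by (rule powr_mono[OF j(2)]) simp
      also have "\<dots> = 2 ^ Suc j" by (rule powr_realpow) simp
      finally show ?thesis .
    qed
    have "y \<ge> 1" using y0 that by blast
    then have "r * y \<le> 2 ^ Suc j * y" using rj by (intro mult_right_mono) auto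
    then have "K (r * y) \<le> K (2 ^ Suc j * y)" by (rule trunc_mom2_mono)
    also have "\<dots> \<le> (2 powr \<gamma>) ^ Suc j * K y" by (rule dbl[OF that(1)])
    also have "(2 powr \<gamma>) ^ Suc j = 2 powr \<gamma> * (2 powr real j) powr \<gamma>"
    proof -
      have "(2 powr \<gamma>) ^ j = (2 powr \<gamma>) powr real j" by (simp add: powr_realpow)
      also have "\<dots> = (2 powr real j) powr \<gamma>" unfolding powr_powr by (simp add: mult.commute)
      finally show ?thesis by simp
    qed
    also have "\<dots> * K y \<le> 2 * r powr \<gamma> * K y"
    proof (intro mult_right_mono mult_mono powr_mono2)
      show "2 powr real j \<le> r"
        using powr_mono[OF j(1), of 2] that by simp
      have "2 powr \<gamma> \<le> 2 powr (1::real)" by (rule powr_mono) (use gamma_bounds in auto)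
      then show "2 powr \<gamma> \<le> (2::real)" by simp
    qed (use gamma_bounds trunc_mom2_nonneg in auto)
    finally show ?thesis .
  qed
  then show thesis using that[of y0] y0[of y0] by blast
qed

end

section \<open>The characteristic function of a law in a stable domain\<close>

text \<open>The exponential remainder of second order, with the sign that makes its real part
  \<open>1 - cos x\<close> nonnegative.\<close>

definition e2 :: "real \<Rightarrow> complex" where
  "e2 x = 1 + \<i> * of_real x - iexp x"

lemma e2_0 [simp]: "e2 0 = 0" by (simp add: e2_def)

lemma norm_e2_le_square: "norm (e2 x) \<le> x\<^sup>2 / 2"
proof -
  have "(\<Sum>k\<le>1. (\<i> * complex_of_real x) ^ k / fact k) = 1 + \<i> * of_real x"
    by (simp add: numeral_eq_Suc)
  with iexp_approx1[of x 1] show ?thesis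
    by (simp add: e2_def norm_minus_commute numeral_eq_Suc)
qed

lemma norm_e2_le: "norm (e2 x) \<le> 2 * \<bar>x\<bar>"
proof -
  have "(\<Sum>k\<le>1. (\<i> * complex_of_real x) ^ k / fact k) = 1 + \<i> * of_real x"
    by (simp add: numeral_eq_Suc)
  with iexp_approx2[of x 1] show ?thesis
    by (simp add: e2_def norm_minus_commute)
qed

lemma norm_e2_minus: "norm (e2 x - of_real (x\<^sup>2 / 2)) \<le> \<bar>x\<bar> ^ 3 / 6"
proof -
  have "(\<Sum>k\<le>2. (\<i> * complex_of_real x) ^ k / fact k) = 1 + \<i> * of_real x - of_real (x\<^sup>2 / 2)"
    by (simp add: numeral_eq_Suc power2_eq_square complex_eq_iff)
  with iexp_approx1[of x 2] show ?thesis
    by (simp add: e2_def norm_minus_commute numeral_eq_Suc algebra_simps)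
qed

lemma Re_e2: "Re (e2 x) = 1 - cos x"
  by (simp add: e2_def Re_exp)

lemma Re_e2_ge: "\<bar>x\<bar> \<le> 1 \<Longrightarrow> x\<^sup>2 / 3 \<le> Re (e2 x)"
proof -
  assume x: "\<bar>x\<bar> \<le> 1"
  have "Re (of_real (x\<^sup>2 / 2) - e2 x) \<le> \<bar>x\<bar> ^ 3 / 6"
    using complex_Re_le_cmod norm_e2_minus[of x] by (metis norm_minus_commute order_trans)
  moreover have "\<bar>x\<bar> ^ 3 \<le> x\<^sup>2"
  proof -
    have "\<bar>x\<bar> ^ 3 = \<bar>x\<bar> * x\<^sup>2" by (simp add: power3_eq_cube power2_eq_square)
    also have "\<dots> \<le> 1 * x\<^sup>2" using x by (intro mult_right_mono) auto
    finally show ?thesis by simp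
  qed
  ultimately show ?thesis by simp
qed

text \<open>The derivative of \<open>e2 z / z\<^sup>2\<close>.\<close>

definition q :: "real \<Rightarrow> complex" where
  "q z = (1 / z\<^sup>2) *\<^sub>R (\<i> * (1 - iexp z)) - (2 / z ^ 3) *\<^sub>R e2 z"

lemma has_vector_derivative_e2: "(e2 has_vector_derivative \<i> * (1 - iexp z)) (at z)"
proof -
  have "((\<lambda>x. complex_of_real x) has_vector_derivative of_real 1) (at z)"
    by (rule has_vector_derivative_of_real) (auto intro!: derivative_eq_intros)
  then have "((\<lambda>x. 1 + \<i> * complex_of_real x - iexp x) has_vector_derivative (0 + \<i> * of_real 1 - \<i> * iexp z)) (at z)"
    by (intro has_vector_derivative_diff has_vector_derivative_add has_vector_derivative_const
        has_vector_derivative_mult_right has_vector_derivative_iexp)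
  then show ?thesis unfolding e2_def[abs_def] by (simp add: algebra_simps)
qed

lemma has_vector_derivative_q:
  assumes "z > 0"
  shows "((\<lambda>z. (1 / z\<^sup>2) *\<^sub>R e2 z) has_vector_derivative q z) (at z)"
proof -
  have "((\<lambda>z. 1 / z\<^sup>2) has_real_derivative - (2 / z ^ 3)) (at z)"
    using assms by (auto intro!: derivative_eq_intros simp: field_simps power2_eq_square power3_eq_cube)
  from has_vector_derivative_scaleR[OF this has_vector_derivative_e2]
  show ?thesis by (simp add: q_def)
qed

text \<open>Both terms of \<open>q\<close> blow up at 0. After multiplication by
  \<open>z ^ 3\<close> their leading parts cancel and Taylor remainders are left, with constants 1/2
  and 1/3.\<close>

lemma norm_q_le_1: assumes "z > 0" shows "norm (q z) \<le> 1"
proof -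
  have "of_real (z ^ 3) * q z = \<i> * of_real z * e2 z - 2 * (e2 z - of_real (z\<^sup>2 / 2))"
    using assms by (simp add: q_def e2_def scaleR_conv_of_real field_simps power2_eq_square power3_eq_cube)
  then have "z ^ 3 * norm (q z) = norm (\<i> * of_real z * e2 z - 2 * (e2 z - of_real (z\<^sup>2 / 2)))"
    using assms by (metis abs_of_pos norm_mult norm_of_real zero_less_power)
  also have "\<dots> \<le> norm (\<i> * of_real z * e2 z) + norm (2 * (e2 z - of_real (z\<^sup>2 / 2)))"
    by (rule norm_triangle_ineq4)
  also have "\<dots> \<le> z * (z\<^sup>2 / 2) + 2 * (z ^ 3 / 6)"
  proof (rule add_mono)
    show "norm (\<i> * of_real z * e2 z) \<le> z * (z\<^sup>2 / 2)"
      using norm_e2_le_square[of z] assms by (simp add: norm_mult)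
    show "norm (2 * (e2 z - of_real (z\<^sup>2 / 2))) \<le> 2 * (z ^ 3 / 6)"
      using norm_e2_minus[of z] assms by (simp only: norm_mult) simp
  qed
  also have "\<dots> \<le> z ^ 3 * 1" using assms by (simp add: power2_eq_square power3_eq_cube)
  finally show ?thesis using assms by (simp add: mult_le_cancel_left_pos)
qed

lemma norm_q_le: assumes "z > 0" shows "norm (q z) \<le> 6 * z powr (- 2)"
proof -
  have "norm (q z) \<le> norm ((1 / z\<^sup>2) *\<^sub>R (\<i> * (1 - iexp z))) + norm ((2 / z ^ 3) *\<^sub>R e2 z)"
    unfolding q_def by (rule norm_triangle_ineq4)
  also have "norm ((1 / z\<^sup>2) *\<^sub>R (\<i> * (1 - iexp z))) \<le> 1 / z\<^sup>2 * 2"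
  proof -
    have "norm (1 - iexp z) \<le> norm (1 :: complex) + norm (iexp z)" by (rule norm_triangle_ineq4)
    then have "norm (1 - iexp z) \<le> 2" by simp
    then show ?thesis by (simp add: norm_mult divide_right_mono)
  qed
  also have "norm ((2 / z ^ 3) *\<^sub>R e2 z) \<le> 2 / z ^ 3 * (2 * z)"
    using norm_e2_le[of z] assms by (simp add: divide_right_mono)
  finally show ?thesis
    using assms by (simp add: powr_minus powr_numeral field_simps power2_eq_square power3_eq_cube)
qed

lemma measurable_q [measurable]: "q \<in> borel_measurable borel"
  unfolding q_def[abs_def] e2_def[abs_def] by measurable

lemma integrable_powr_atLeast:
  fixes e a :: real
  assumes e: "e < - 1" and a: "a > 0"
  shows "integrable lborel (\<lambda>z. indicator {a..} z * z powr e)"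
    and "(\<integral>z. indicator {a..} z * z powr e \<partial>lborel) = - (a powr (e + 1)) / (e + 1)"
proof -
  have "(\<integral>\<^sup>+z. ennreal (z powr e) * indicator {a..} z \<partial>lborel) = ennreal (0 - a powr (e + 1) / (e + 1))"
  proof (rule nn_integral_FTC_atLeast)
    fix x assume "a \<le> x"
    then show "DERIV (\<lambda>x. x powr (e + 1) / (e + 1)) x :> x powr e"
      using a e by (auto intro!: derivative_eq_intros)
  next
    have "((\<lambda>x. x powr (e + 1)) \<longlongrightarrow> 0) at_top"
      by (rule tendsto_neg_powr) (use e in \<open>auto simp: filterlim_ident\<close>)
    from tendsto_divide_zero[OF this] show "((\<lambda>x. x powr (e + 1) / (e + 1)) \<longlongrightarrow> 0) at_top" .
  qed auto
  moreover have "(\<integral>\<^sup>+z. ennreal (z powr e) * indicator {a..} z \<partial>lborel)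
      = (\<integral>\<^sup>+z. ennreal (indicator {a..} z * z powr e) \<partial>lborel)"
    by (intro nn_integral_cong) (auto split: split_indicator)
  ultimately have eq: "(\<integral>\<^sup>+z. ennreal (indicator {a..} z * z powr e) \<partial>lborel)
      = ennreal (- (a powr (e + 1)) / (e + 1))" by simp
  have nn: "0 \<le> - (a powr (e + 1)) / (e + 1)" using e by (simp add: divide_nonneg_neg)
  show "integrable lborel (\<lambda>z. indicator {a..} z * z powr e)"
    by (rule integrableI_nonneg) (auto simp: eq)
  show "(\<integral>z. indicator {a..} z * z powr e \<partial>lborel) = - (a powr (e + 1)) / (e + 1)"
  proof -
    have "(\<integral>z. indicator {a..} z * z powr e \<partial>lborel)
        = enn2real (\<integral>\<^sup>+z. ennreal (indicator {a..} z * z powr e) \<partial>lborel)"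
      by (rule integral_eq_nn_integral) auto
    also have "\<dots> = - (a powr (e + 1)) / (e + 1)" unfolding eq by (rule enn2real_ennreal[OF nn])
    finally show ?thesis .
  qed
qed

lemma integrable_q_atLeast:
  assumes a: "a > 0"
  shows "integrable lborel (\<lambda>z. indicator {a..} z *\<^sub>R q z)"
    and "(\<integral>z. norm (indicator {a..} z *\<^sub>R q z) \<partial>lborel) \<le> 6 / a"
proof -
  have i: "integrable lborel (\<lambda>z. 6 * (indicator {a..} z * z powr (- 2)))"
    using integrable_powr_atLeast(1)[of "- 2" a] a by simp
  have le: "norm (indicator {a..} z *\<^sub>R q z) \<le> 6 * (indicator {a..} z * z powr (- 2))" for z
    using norm_q_le[of z] a by (auto split: split_indicator)
  show int: "integrable lborel (\<lambda>z. indicator {a..} z *\<^sub>R q z)"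
    by (rule Bochner_Integration.integrable_bound[OF i]) (use le in \<open>auto intro: order_trans\<close>)
  have "(\<integral>z. norm (indicator {a..} z *\<^sub>R q z) \<partial>lborel) \<le> (\<integral>z. 6 * (indicator {a..} z * z powr (- 2)) \<partial>lborel)"
    by (rule integral_mono[OF integrable_norm[OF int] i le])
  also have "\<dots> = 6 * (\<integral>z. indicator {a..} z * z powr (- 2) \<partial>lborel)" by simp
  also have "\<dots> = 6 / a"
    by (subst integrable_powr_atLeast(2)) (use a in \<open>simp_all add: powr_minus_divide\<close>)
  finally show "(\<integral>z. norm (indicator {a..} z *\<^sub>R q z) \<partial>lborel) \<le> 6 / a" .
qed

lemma integral_q_atLeast:
  assumes a: "a > 0"
  shows "(\<integral>z. indicator {a..} z *\<^sub>R q z \<partial>lborel) = - ((1 / a\<^sup>2) *\<^sub>R e2 a)"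
proof -
  have ei: "einterval (ereal a) \<infinity> = {a<..}" by (auto simp: einterval_def)
  have ae: "AE z in lborel. indicator {a<..} z *\<^sub>R q z = indicator {a..} z *\<^sub>R q z"
    using AE_lborel_singleton[of a] by eventually_elim (auto split: split_indicator)
  have si: "set_integrable lborel (einterval (ereal a) \<infinity>) q"
    unfolding set_integrable_def ei
    by (rule integrable_cong_AE_imp[OF integrable_q_atLeast(1)[OF a]]) (use ae in auto)
  have lim0: "((\<lambda>z. (1 / z\<^sup>2) *\<^sub>R e2 z) \<longlongrightarrow> 0) at_top"
  proof (rule Lim_null_comparison)
    show "\<forall>\<^sub>F z in at_top. norm ((1 / z\<^sup>2) *\<^sub>R e2 z) \<le> 2 / z"
      using eventually_gt_at_top[of 0]
    proof eventually_elim
      case (elim z)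
      have "norm ((1 / z\<^sup>2) *\<^sub>R e2 z) = norm (e2 z) / z\<^sup>2" by simp
      also have "\<dots> \<le> 2 * z / z\<^sup>2" using norm_e2_le[of z] elim by (intro divide_right_mono) auto
      finally show ?case using elim by (simp add: power2_eq_square)
    qed
    show "((\<lambda>z. 2 / z :: real) \<longlongrightarrow> 0) at_top"
      by (rule tendsto_divide_0[OF tendsto_const filterlim_at_top_imp_at_infinity[OF filterlim_ident]])
  qed
  have "(LBINT z=ereal a..\<infinity>. q z) = 0 - (1 / a\<^sup>2) *\<^sub>R e2 a"
  proof (rule interval_integral_FTC_integrable)
    fix x assume "ereal a < ereal x"
    then have x: "x > 0" using a by simp
    show "((\<lambda>z. (1 / z\<^sup>2) *\<^sub>R e2 z) has_vector_derivative q x) (at x)"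
      by (rule has_vector_derivative_q[OF x])
    show "isCont q x"
      unfolding q_def[abs_def] e2_def[abs_def] using x by (intro continuous_intros) auto
  next
    have "isCont (\<lambda>z. (1 / z\<^sup>2) *\<^sub>R e2 z) a"
      using has_vector_derivative_q[OF a] has_vector_derivative_continuous by blast
    then have "((\<lambda>z. (1 / z\<^sup>2) *\<^sub>R e2 z) \<longlongrightarrow> (1 / a\<^sup>2) *\<^sub>R e2 a) (at_right a)"
      by (auto simp: isCont_def intro: tendsto_within_subset)
    then show "(((\<lambda>z. (1 / z\<^sup>2) *\<^sub>R e2 z) \<circ> real_of_ereal) \<longlongrightarrow> (1 / a\<^sup>2) *\<^sub>R e2 a) (at_right (ereal a))"
      by (simp add: ereal_tendsto_simps)
    show "(((\<lambda>z. (1 / z\<^sup>2) *\<^sub>R e2 z) \<circ> real_of_ereal) \<longlongrightarrow> 0) (at_left \<infinity>)"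
      using lim0 by (simp add: ereal_tendsto_simps)
  qed (use si in auto)
  moreover have "(LBINT z=ereal a..\<infinity>. q z) = (\<integral>z. indicator {a<..} z *\<^sub>R q z \<partial>lborel)"
    by (simp add: interval_lebesgue_integral_def set_lebesgue_integral_def ei)
  moreover have "\<dots> = (\<integral>z. indicator {a..} z *\<^sub>R q z \<partial>lborel)"
    by (rule integral_cong_AE) (use ae in auto)
  ultimately show ?thesis by simp
qed

section \<open>Asymptotics at 0 of the characteristic function of one step\<close>

context critical_stable
begin

text \<open>\<open>e2 x\<close> is \<open>- x\<^sup>2\<close> times the integral of \<open>q\<close>
  over \<open>{x..}\<close>. With \<open>x = real k / t\<close>, Fubini collects the squares of all
  \<open>k \<le> t * z\<close> into \<open>K (t * z)\<close>, so the law enters through its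
  truncated second moment alone. The term \<open>k = 0\<close>, where \<open>q\<close> is not
  integrated from a positive point, has the factor 0.\<close>

lemma integral_e2_eq:
  assumes t: "t > 0"
  shows "measure_pmf.expectation \<mu> (\<lambda>k. e2 (real k / t)) * of_real (t\<^sup>2)
    = - (\<integral>z. K (t * z) *\<^sub>R q z \<partial>lborel)"
proof -
  let ?H = "\<lambda>k z. (real k)\<^sup>2 *\<^sub>R (indicator {real k / t..} z *\<^sub>R q z)"
  interpret pair_sigma_finite "measure_pmf \<mu>" lborel ..
  have int1: "integrable lborel (?H k)" for k
    by (rule integrable_scaleR_right) (use integrable_q_atLeast(1)[of "real k / t"] t in auto)
  have int2: "integrable \<mu> (\<lambda>k. \<integral>z. norm (?H k z) \<partial>lborel)"
  proof (rule Bochner_Integration.integrable_bound)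
    show "integrable \<mu> (\<lambda>k. 6 * t * real k)" using integrable_mean by simp
    have "norm (\<integral>z. norm (?H k z) \<partial>lborel) \<le> norm (6 * t * real k)" for k
    proof (cases "k = 0")
      case False
      have "(\<integral>z. norm (?H k z) \<partial>lborel) = (real k)\<^sup>2 * (\<integral>z. norm (indicator {real k / t..} z *\<^sub>R q z) \<partial>lborel)"
        by (simp add: mult.assoc flip: Bochner_Integration.integral_mult_right_zero)
      also have "\<dots> \<le> (real k)\<^sup>2 * (6 / (real k / t))"
        using integrable_q_atLeast(2)[of "real k / t"] False t by (intro mult_left_mono) auto
      finally show ?thesis using t False by (simp add: power2_eq_square abs_of_nonneg integral_nonneg mult_ac)
    qed simp
    then show "AE k in \<mu>. norm (\<integral>z. norm (?H k z) \<partial>lborel) \<le> norm (6 * t * real k)" by simp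
  qed simp
  have meas: "(\<lambda>(k, z). ?H k z) \<in> borel_measurable (measure_pmf \<mu> \<Otimes>\<^sub>M lborel)"
  proof -
    have "(\<lambda>(k, z). ?H k z) \<in> borel_measurable (count_space UNIV \<Otimes>\<^sub>M lborel)"
      by (rule measurable_pair_measure_countable1) auto
    moreover have "sets (measure_pmf \<mu> \<Otimes>\<^sub>M lborel) = sets (count_space UNIV \<Otimes>\<^sub>M lborel)"
      by (rule sets_pair_measure_cong) auto
    ultimately show ?thesis by (simp cong: measurable_cong_sets)
  qed
  have int: "integrable (measure_pmf \<mu> \<Otimes>\<^sub>M lborel) (\<lambda>(k, z). ?H k z)"
    by (rule Fubini_integrable[OF meas]) (use int1 int2 in auto)
  have "(\<integral>k. (\<integral>z. ?H k z \<partial>lborel) \<partial>\<mu>) = (\<integral>z. (\<integral>k. ?H k z \<partial>\<mu>) \<partial>lborel)"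
    using Fubini_integral[OF int] by simp
  moreover have "(\<integral>z. ?H k z \<partial>lborel) = - (e2 (real k / t) * of_real (t\<^sup>2))" for k
  proof (cases "k = 0")
    case False
    have "(\<integral>z. ?H k z \<partial>lborel) = (real k)\<^sup>2 *\<^sub>R (- ((1 / (real k / t)\<^sup>2) *\<^sub>R e2 (real k / t)))"
      using integral_q_atLeast[of "real k / t"] False t by (subst integral_scaleR_right) simp
    then show ?thesis using False t by (simp add: scaleR_conv_of_real field_simps)
  qed simp
  moreover have "(\<integral>k. ?H k z \<partial>\<mu>) = K (t * z) *\<^sub>R q z" for z
  proof -
    have "(\<integral>k. ?H k z \<partial>\<mu>) = (\<integral>k. (if real k \<le> t * z then (real k)\<^sup>2 else 0) *\<^sub>R q z \<partial>\<mu>)"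
      by (intro Bochner_Integration.integral_cong refl)
         (use t in \<open>auto simp: field_simps split: split_indicator\<close>)
    then show ?thesis using integrable_truncated[of \<mu> "t * z"] by (simp add: trunc_mom2_def)
  qed
  ultimately have "- (measure_pmf.expectation \<mu> (\<lambda>k. e2 (real k / t)) * of_real (t\<^sup>2))
      = (\<integral>z. K (t * z) *\<^sub>R q z \<partial>lborel)" by simp
  from arg_cong[OF this, of uminus] show ?thesis by simp
qed

text \<open>Dominates \<open>K (t * z) / K t * norm (q z)\<close>: up to 1 both factors are at most
  1, and beyond 1 the Potter bound \<open>2 * z powr \<gamma>\<close> meets
  \<open>6 * z powr (- 2)\<close>.\<close>

definition dom_fun :: "real \<Rightarrow> real" where
  "dom_fun z = 2 * indicator {0<..1} z + 12 * (indicator {1..} z * z powr (\<gamma> - 2))"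

lemma integrable_dom_fun: "integrable lborel dom_fun"
  unfolding dom_fun_def using integrable_powr_atLeast(1)[of "\<gamma> - 2" 1] gamma_bounds
  by (intro Bochner_Integration.integrable_add integrable_mult_right) (auto intro: integrable_real_indicator)

lemma K_nonpos: "y \<le> 0 \<Longrightarrow> K y = 0"
  unfolding trunc_mom2_def by (rule integral_eq_zero_AE) auto

text \<open>The rescaled integrand of \<open>integral_e2_eq\<close> with
  \<open>K (t * z) / K t\<close> replaced by its limit.\<close>

definition c_lim :: complex where
  "c_lim = - (\<integral>z. (if 0 < z then z powr (2 - \<alpha>) else 0) *\<^sub>R q z \<partial>lborel)"

text \<open>An Abelian theorem by dominated convergence: regular variation supplies the pointwise
  limit for \<open>z > 0\<close>, and \<open>dom_fun\<close> the majorant.\<close>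

lemma e2_tendsto:
  "((\<lambda>t. measure_pmf.expectation \<mu> (\<lambda>k. e2 (real k / t)) * of_real (t\<^sup>2) / of_real (K t)) \<longlongrightarrow> c_lim) at_top"
proof -
  obtain y0 where y0: "y0 \<ge> 1" "K y0 \<ge> 1"
    and Potter: "\<And>y r. y \<ge> y0 \<Longrightarrow> r \<ge> 1 \<Longrightarrow> K (r * y) \<le> 2 * r powr \<gamma> * K y"
    using K_Potter by blast
  let ?s = "\<lambda>t z. (K (t * z) / K t) *\<^sub>R q z"
  have Kpos: "K t > 0" if "t \<ge> y0" for t
    using trunc_mom2_mono[OF that, of \<mu>] y0 by linarith
  have "((\<lambda>t. \<integral>z. ?s t z \<partial>lborel) \<longlongrightarrow> (\<integral>z. (if 0 < z then z powr (2 - \<alpha>) else 0) *\<^sub>R q z \<partial>lborel)) at_top"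
  proof (rule integral_dominated_convergence_at_top[where w = dom_fun])
    show "AE z in lborel. ((\<lambda>t. ?s t z) \<longlongrightarrow> (if 0 < z then z powr (2 - \<alpha>) else 0) *\<^sub>R q z) at_top"
    proof (rule AE_I2)
      fix z :: real
      show "((\<lambda>t. ?s t z) \<longlongrightarrow> (if 0 < z then z powr (2 - \<alpha>) else 0) *\<^sub>R q z) at_top"
      proof (cases "0 < z")
        case True
        then show ?thesis
          using tendsto_scaleR[OF K_regular[OF True] tendsto_const, of "q z"] by (simp add: mult.commute)
      next
        case False
        have "\<forall>\<^sub>F t in at_top. ?s t z = 0"
          using eventually_gt_at_top[of 0]
          by eventually_elim (use False in \<open>simp add: K_nonpos mult_nonneg_nonpos\<close>)
        then show ?thesis using False by (simp add: tendsto_eventually)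
      qed
    qed
    show "\<forall>\<^sub>F t in at_top. AE z in lborel. norm (?s t z) \<le> dom_fun z"
      using eventually_ge_at_top[of y0]
    proof eventually_elim
      case (elim t)
      have t: "t > 0" using elim y0 by simp
      note Kt = Kpos[OF elim]
      show ?case
      proof (rule AE_I2)
        fix z :: real
        consider "z \<le> 0" | "0 < z" "z < 1" | "1 \<le> z" by linarith
        then show "norm (?s t z) \<le> dom_fun z"
        proof cases
          case 1
          then show ?thesis using t by (simp add: K_nonpos mult_nonneg_nonpos dom_fun_def)
        next
          case 2
          have "K (t * z) \<le> K t" using 2 t by (intro trunc_mom2_mono) (simp add: mult_left_le)
          then have "K (t * z) / K t \<le> 1" using Kt by simp
          then have "K (t * z) / K t * norm (q z) \<le> 1 * 1"
            using norm_q_le_1[OF 2(1)] Kt trunc_mom2_nonneg[of \<mu> "t * z"] by (intro mult_mono) auto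
          moreover have "norm (?s t z) = K (t * z) / K t * norm (q z)"
            using Kt trunc_mom2_nonneg[of \<mu> "t * z"] by simp
          moreover have "dom_fun z = 2" using 2 by (simp add: dom_fun_def)
          ultimately show ?thesis by linarith
        next
          case 3
          have "K (t * z) / K t \<le> 2 * z powr \<gamma>"
            using Potter[OF elim 3] Kt by (simp add: mult.commute pos_divide_le_eq)
          then have "K (t * z) / K t * norm (q z) \<le> (2 * z powr \<gamma>) * (6 * z powr (- 2))"
            using norm_q_le[of z] 3 Kt trunc_mom2_nonneg[of \<mu> "t * z"] by (intro mult_mono) auto
          also have "\<dots> = 12 * z powr (\<gamma> - 2)" by (simp add: powr_add[symmetric])
          finally show ?thesis using 3 Kt trunc_mom2_nonneg[of \<mu> "t * z"] by (auto simp: dom_fun_def split: split_indicator)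
        qed
      qed
    qed
    show "?s t \<in> borel_measurable lborel" for t
    proof -
      have "mono (\<lambda>z. K z)" by (rule monoI) (rule trunc_mom2_mono)
      then have [measurable]: "K \<in> borel_measurable borel" by (rule borel_measurable_mono)
      show ?thesis by measurable
    qed
  qed (use integrable_dom_fun in auto)
  then have lim: "((\<lambda>t. - (\<integral>z. ?s t z \<partial>lborel)) \<longlongrightarrow> c_lim) at_top"
    unfolding c_lim_def by (rule tendsto_minus)
  show ?thesis
  proof (rule Lim_transform_eventually[OF lim])
    show "\<forall>\<^sub>F t in at_top. - (\<integral>z. ?s t z \<partial>lborel)
        = measure_pmf.expectation \<mu> (\<lambda>k. e2 (real k / t)) * of_real (t\<^sup>2) / of_real (K t)"
      using eventually_gt_at_top[of 0]
    proof eventually_elim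
      case (elim t)
      have "(\<integral>z. ?s t z \<partial>lborel) = (\<integral>z. (1 / K t) *\<^sub>R (K (t * z) *\<^sub>R q z) \<partial>lborel)"
        by (simp add: field_simps)
      also have "\<dots> = (1 / K t) *\<^sub>R (\<integral>z. K (t * z) *\<^sub>R q z \<partial>lborel)"
        by (rule Bochner_Integration.integral_scaleR_right) 
      finally show ?case unfolding integral_e2_eq[OF elim] by (simp add: scaleR_conv_of_real field_simps)
    qed
  qed
qed

lemma integrable_e2: "integrable \<mu> (\<lambda>k. e2 (s * real k))"
proof (rule Bochner_Integration.integrable_bound)
  show "integrable \<mu> (\<lambda>k. 2 * \<bar>s\<bar> * real k)" using integrable_mean by simp
  show "AE k in \<mu>. norm (e2 (s * real k)) \<le> norm (2 * \<bar>s\<bar> * real k)"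
    using norm_e2_le[of "s * real _"] by (intro AE_I2) (simp add: abs_mult mult.assoc)
qed simp

text \<open>The integral is not evaluated. For \<open>k \<le> t\<close> the real part of
  \<open>e2 (real k / t)\<close> is at least a third of the square, the other terms are nonnegative,
  and so the converging expression has real part at least 1/3.\<close>

lemma Re_c_lim_pos: "Re c_lim > 0"
proof -
  let ?F = "\<lambda>t. measure_pmf.expectation \<mu> (\<lambda>k. e2 (real k / t)) * of_real (t\<^sup>2) / of_real (K t)"
  have lim: "((\<lambda>t. Re (?F t)) \<longlongrightarrow> Re c_lim) at_top"
    by (rule tendsto_Re[OF e2_tendsto])
  have K1: "\<forall>\<^sub>F t in at_top. K t \<ge> 1" using K_at_top by (simp add: filterlim_at_top)
  have ev: "\<forall>\<^sub>F t in at_top. 1 / 3 \<le> Re (?F t)"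
    using K1 eventually_gt_at_top[of 0]
  proof eventually_elim
    case (elim t)
    have inte: "integrable \<mu> (\<lambda>k. e2 (real k / t))"
      using integrable_e2[of "1 / t"] by simp
    have "K t * (1 / (3 * t\<^sup>2)) = measure_pmf.expectation \<mu> (\<lambda>k. (if real k \<le> t then (real k)\<^sup>2 else 0) * (1 / (3 * t\<^sup>2)))"
      unfolding trunc_mom2_def by (rule Bochner_Integration.integral_mult_left_zero[symmetric])
    also have "\<dots> \<le> measure_pmf.expectation \<mu> (\<lambda>k. Re (e2 (real k / t)))"
    proof (rule integral_mono)
      show "integrable \<mu> (\<lambda>k. (if real k \<le> t then (real k)\<^sup>2 else 0) * (1 / (3 * t\<^sup>2)))"
        by (intro integrable_mult_left integrable_truncated)
      show "integrable \<mu> (\<lambda>k. Re (e2 (real k / t)))" using inte by (rule integrable_Re)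
      fix k
      show "(if real k \<le> t then (real k)\<^sup>2 else 0) * (1 / (3 * t\<^sup>2)) \<le> Re (e2 (real k / t))"
      proof (cases "real k \<le> t")
        case True
        then have "(real k / t)\<^sup>2 / 3 \<le> Re (e2 (real k / t))" using elim by (intro Re_e2_ge) simp
        then show ?thesis using True by (simp add: power_divide)
      qed (simp add: Re_e2)
    qed
    also have "\<dots> = Re (measure_pmf.expectation \<mu> (\<lambda>k. e2 (real k / t)))" using inte by simp
    finally have "K t * (1 / (3 * t\<^sup>2)) * (t\<^sup>2 / K t) \<le> Re (measure_pmf.expectation \<mu> (\<lambda>k. e2 (real k / t))) * (t\<^sup>2 / K t)"
      using elim by (intro mult_right_mono) auto
    moreover have "Re (?F t) = Re (measure_pmf.expectation \<mu> (\<lambda>k. e2 (real k / t))) * (t\<^sup>2 / K t)"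
    proof -
      have "?F t = measure_pmf.expectation \<mu> (\<lambda>k. e2 (real k / t)) * of_real (t\<^sup>2 / K t)" by simp
      then show ?thesis by (simp only: Re_complex_of_real Im_complex_of_real times_complex.simps mult_zero_right diff_zero)
    qed
    ultimately show ?case using elim by (simp add: field_simps)
  qed
  have "1 / 3 \<le> Re c_lim"
    by (rule tendsto_lowerbound[OF lim ev]) simp
  then show ?thesis by simp
qed

definition w :: "real \<Rightarrow> complex" where
  "w s = 1 - measure_pmf.expectation \<mu> (\<lambda>k. iexp (s * (real k - 1)))"

text \<open>The gauge of \<open>w\<close> at 0, regularly varying of index \<alpha>: frequency
  \<open>s\<close> sees the second moment truncated at \<open>1 / s\<close>.\<close>

definition kk :: "real \<Rightarrow> real" where "kk s = s\<^sup>2 * K (1 / s)"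

lemma w_eq: "w s = (1 - iexp (- s) * (1 + \<i> * of_real s))
    + iexp (- s) * measure_pmf.expectation \<mu> (\<lambda>k. e2 (s * real k))"
proof -
  have "measure_pmf.expectation \<mu> (\<lambda>k. iexp (s * (real k - 1)))
      = measure_pmf.expectation \<mu> (\<lambda>k. iexp (- s) * (1 + \<i> * of_real s * of_real (real k) - e2 (s * real k)))"
  proof (intro Bochner_Integration.integral_cong refl)
    fix k
    have "iexp (s * (real k - 1)) = iexp (- s) * iexp (s * real k)"
      by (simp add: exp_add[symmetric] algebra_simps)
    then show "iexp (s * (real k - 1)) = iexp (- s) * (1 + \<i> * of_real s * of_real (real k) - e2 (s * real k))"
      by (simp add: e2_def mult_ac)
  qed
  also have "\<dots> = iexp (- s) * measure_pmf.expectation \<mu> (\<lambda>k. 1 + \<i> * of_real s * of_real (real k) - e2 (s * real k))"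
    by (rule integral_mult_right_zero)
  also have "measure_pmf.expectation \<mu> (\<lambda>k. 1 + \<i> * of_real s * of_real (real k) - e2 (s * real k))
      = 1 + \<i> * of_real s - measure_pmf.expectation \<mu> (\<lambda>k. e2 (s * real k))"
  proof -
    have 1: "integrable \<mu> (\<lambda>k. \<i> * of_real s * complex_of_real (real k))"
      by (intro integrable_mult_right integrable_of_real integrable_mean)
    have "measure_pmf.expectation \<mu> (\<lambda>k. complex_of_real (real k)) = 1"
      using mean by (subst integral_complex_of_real) simp
    then show ?thesis using 1 integrable_e2[of s] by simp
  qed
  finally show ?thesis unfolding w_def by (simp add: algebra_simps)
qed

text \<open>Centring the steps at their mean leaves a deterministic term of order
  \<open>s\<^sup>2\<close>, which is negligible against \<open>kk s\<close> because \<open>K\<close>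
  is unbounded.\<close>

lemma w_over_kk: "((\<lambda>s. w s / of_real (kk s)) \<longlongrightarrow> c_lim) (at_right 0)"
proof -
  let ?E = "\<lambda>t. measure_pmf.expectation \<mu> (\<lambda>k. e2 (real k / t))"
  have "((\<lambda>t. w (1 / t) / of_real (kk (1 / t))) \<longlongrightarrow> 0 + 1 * c_lim) at_top"
  proof (rule Lim_transform_eventually)
    have it: "((\<lambda>t::real. - (1 / t)) \<longlongrightarrow> - 0) at_top"
      by (intro tendsto_minus tendsto_divide_0[OF tendsto_const] filterlim_at_top_imp_at_infinity filterlim_ident)
    have ex: "((\<lambda>t. iexp (- (1 / t))) \<longlongrightarrow> 1) at_top"
    proof -
      have "((\<lambda>t. iexp (- (1 / t))) \<longlongrightarrow> iexp (- 0)) at_top" by (intro tendsto_intros it)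
      then show ?thesis by simp
    qed
    have small: "((\<lambda>t. (1 - iexp (- (1 / t)) * (1 + \<i> * of_real (1 / t))) * of_real (t\<^sup>2) / of_real (K t)) \<longlongrightarrow> 0) at_top"
    proof (rule Lim_null_comparison)
      show "\<forall>\<^sub>F t in at_top. norm ((1 - iexp (- (1 / t)) * (1 + \<i> * of_real (1 / t))) * of_real (t\<^sup>2) / of_real (K t)) \<le> 1 / K t"
        using eventually_gt_at_top[of 0]
      proof eventually_elim
        case (elim t)
        have "1 - iexp (- (1 / t)) * (1 + \<i> * of_real (1 / t)) = - (iexp (- (1 / t)) * e2 (1 / t))"
          by (simp add: e2_def exp_minus field_simps)
        then have "norm (1 - iexp (- (1 / t)) * (1 + \<i> * of_real (1 / t))) = norm (e2 (1 / t))"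
          by (simp add: norm_mult del: of_real_minus of_real_divide)
        also have "\<dots> \<le> (1 / t)\<^sup>2"
          using norm_e2_le_square[of "1 / t"] zero_le_power2[of "1 / t"] by linarith
        finally have "norm (1 - iexp (- (1 / t)) * (1 + \<i> * of_real (1 / t))) * t\<^sup>2 \<le> 1"
          using elim by (simp add: field_simps)
        then show ?case
          using trunc_mom2_nonneg[of \<mu> t] by (simp add: norm_mult norm_divide norm_power divide_right_mono)
      qed
      show "((\<lambda>t. 1 / K t) \<longlongrightarrow> 0) at_top"
        by (intro tendsto_divide_0[OF tendsto_const] filterlim_at_top_imp_at_infinity K_at_top)
    qed
    show "((\<lambda>t. (1 - iexp (- (1 / t)) * (1 + \<i> * of_real (1 / t))) * of_real (t\<^sup>2) / of_real (K t)
        + iexp (- (1 / t)) * (?E t * of_real (t\<^sup>2) / of_real (K t))) \<longlongrightarrow> 0 + 1 * c_lim) at_top"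
      by (intro tendsto_add small tendsto_mult ex e2_tendsto)
    show "\<forall>\<^sub>F t in at_top. (1 - iexp (- (1 / t)) * (1 + \<i> * of_real (1 / t))) * of_real (t\<^sup>2) / of_real (K t)
        + iexp (- (1 / t)) * (?E t * of_real (t\<^sup>2) / of_real (K t)) = w (1 / t) / of_real (kk (1 / t))"
      using eventually_gt_at_top[of 0]
    proof eventually_elim
      case (elim t)
      have "complex_of_real (kk (1 / t)) = of_real (K t) / of_real (t\<^sup>2)"
        by (simp add: kk_def power_divide)
      moreover have "w (1 / t) = (1 - iexp (- (1 / t)) * (1 + \<i> * of_real (1 / t))) + iexp (- (1 / t)) * ?E t"
        using w_eq[of "1 / t"] by simp
      moreover have "a * d / c + b * (e * d / c) = (a + b * e) / (c / d)" for a b c d e :: complex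
        by (simp add: add_divide_distrib distrib_right)
      ultimately show ?case by (simp only:)
    qed
  qed
  then show ?thesis
    by (simp add: filterlim_at_right_to_top inverse_eq_divide)
qed

lemma kk_regular:
  assumes u: "u > 0"
  shows "((\<lambda>s. kk (u * s) / kk s) \<longlongrightarrow> u powr \<alpha>) (at_right 0)"
proof -
  have "((\<lambda>t. u\<^sup>2 * (K ((1 / u) * t) / K t)) \<longlongrightarrow> u\<^sup>2 * (1 / u) powr (2 - \<alpha>)) at_top"
    by (intro tendsto_intros K_regular) (use u in auto)
  moreover have "u\<^sup>2 * (1 / u) powr (2 - \<alpha>) = u powr \<alpha>"
    using u by (simp add: powr_divide powr_diff field_simps)
  moreover have "\<forall>\<^sub>F t in at_top. u\<^sup>2 * (K ((1 / u) * t) / K t) = kk (u * (1 / t)) / kk (1 / t)"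
    using eventually_gt_at_top[of 0]
    by eventually_elim (use u in \<open>simp add: kk_def field_simps\<close>)
  ultimately have "((\<lambda>t. kk (u * (1 / t)) / kk (1 / t)) \<longlongrightarrow> u powr \<alpha>) at_top"
    by (auto intro: Lim_transform_eventually)
  then show ?thesis by (simp add: filterlim_at_right_to_top inverse_eq_divide)
qed

text \<open>The Potter bound at \<open>y = 1 / s'\<close> with ratio \<open>s' / s\<close>. It is a
  substitute for monotonicity of \<open>kk s / s\<close> and yields lower bounds that hold on whole
  intervals, not just in the limit at 0.\<close>

lemma kk_almost_mono:
  obtains \<eta> where "\<eta> > 0" "\<And>s. 0 < s \<Longrightarrow> s \<le> \<eta> \<Longrightarrow> kk s > 0"
    "\<And>s s'. 0 < s \<Longrightarrow> s \<le> s' \<Longrightarrow> s' \<le> \<eta> \<Longrightarrow> kk s / s \<le> 2 * (s / s') powr (1 - \<gamma>) * (kk s' / s')"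
proof -
  obtain y0 where y0: "y0 \<ge> 1" "K y0 \<ge> 1"
    and Potter: "\<And>y r. y \<ge> y0 \<Longrightarrow> r \<ge> 1 \<Longrightarrow> K (r * y) \<le> 2 * r powr \<gamma> * K y"
    using K_Potter by blast
  show thesis
  proof (rule that[of "1 / y0"])
    fix s :: real assume s: "0 < s" "s \<le> 1 / y0"
    then have "y0 \<le> 1 / s" using y0 by (simp add: field_simps)
    then have "K (1 / s) \<ge> 1" using trunc_mom2_mono[of y0 "1 / s" \<mu>] y0 by linarith
    then show "kk s > 0" using s by (simp add: kk_def)
  next
    fix s s' :: real assume s: "0 < s" "s \<le> s'" "s' \<le> 1 / y0"
    then have y: "y0 \<le> 1 / s'" using y0 by (simp add: field_simps)
    have "K ((s' / s) * (1 / s')) \<le> 2 * (s' / s) powr \<gamma> * K (1 / s')"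
      using s by (intro Potter y) simp
    then have "s * K (1 / s) \<le> s * (2 * (s' / s) powr \<gamma> * K (1 / s'))"
      using s by simp
    also have "\<dots> = 2 * (s / s') powr (1 - \<gamma>) * (s' * K (1 / s'))"
      using s by (simp add: powr_divide powr_diff field_simps)
    finally show "kk s / s \<le> 2 * (s / s') powr (1 - \<gamma>) * (kk s' / s')"
      using s by (simp add: kk_def power2_eq_square)
  qed (use y0 in simp)
qed

text \<open>\<open>kk_almost_mono\<close> with \<open>s' = \<eta>\<close> fixed leaves the vanishing
  power \<open>s powr (1 - \<gamma>)\<close>. At the scale \<open>th n\<close> this says that
  \<open>n * th n\<close> tends to infinity.\<close>

lemma kk_over_s: "((\<lambda>s. kk s / s) \<longlongrightarrow> 0) (at_right 0)"
proof -
  obtain \<eta> where e: "\<eta> > 0" "\<And>s. 0 < s \<Longrightarrow> s \<le> \<eta> \<Longrightarrow> kk s > 0"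
    "\<And>s s'. 0 < s \<Longrightarrow> s \<le> s' \<Longrightarrow> s' \<le> \<eta> \<Longrightarrow> kk s / s \<le> 2 * (s / s') powr (1 - \<gamma>) * (kk s' / s')"
    by (rule kk_almost_mono) blast
  have ev: "\<forall>\<^sub>F s in at_right 0. 0 < s \<and> s \<le> \<eta>"
    using eventually_at_right_less[of 0] eventually_at_right_real[OF e(1)] by eventually_elim auto
  show ?thesis
  proof (rule tendsto_sandwich)
    show "\<forall>\<^sub>F s in at_right 0. 0 \<le> kk s / s"
      using ev by eventually_elim (use e(2) in \<open>auto simp: less_imp_le\<close>)
    show "\<forall>\<^sub>F s in at_right 0. kk s / s \<le> 2 * (s / \<eta>) powr (1 - \<gamma>) * (kk \<eta> / \<eta>)"
      using ev by eventually_elim (use e(3) in auto)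
    have "((\<lambda>s. 2 * (s / \<eta>) powr (1 - \<gamma>) * (kk \<eta> / \<eta>)) \<longlongrightarrow> 2 * (0 / \<eta>) powr (1 - \<gamma>) * (kk \<eta> / \<eta>)) (at_right 0)"
    proof -
      have "((\<lambda>s. (s / \<eta>) powr (1 - \<gamma>)) \<longlongrightarrow> (0 / \<eta>) powr (1 - \<gamma>)) (at_right 0)"
      proof (rule tendsto_powr2)
        show "\<forall>\<^sub>F s in at_right 0. 0 \<le> s / \<eta>" using ev by eventually_elim (use e(1) in simp)
        show "((\<lambda>s. s / \<eta>) \<longlongrightarrow> 0 / \<eta>) (at_right 0)" by (intro tendsto_intros) (use e(1) in auto)
      qed (use gamma_bounds in auto)
      then show ?thesis by (intro tendsto_mult tendsto_const)
    qed
    then show "((\<lambda>s. 2 * (s / \<eta>) powr (1 - \<gamma>) * (kk \<eta> / \<eta>)) \<longlongrightarrow> 0) (at_right 0)"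
      using gamma_bounds by simp
  qed simp
qed

text \<open>The ratio is \<open>1 / K (1 / s)\<close>. At the scale \<open>th n\<close> this says
  that the walk moves on a scale larger than \<open>sqrt n\<close>.\<close>

lemma square_over_kk: "((\<lambda>s. s\<^sup>2 / kk s) \<longlongrightarrow> 0) (at_right 0)"
proof -
  have "((\<lambda>t. 1 / K t) \<longlongrightarrow> 0) at_top"
    by (intro tendsto_divide_0[OF tendsto_const] filterlim_at_top_imp_at_infinity K_at_top)
  then have "((\<lambda>t. (1 / t)\<^sup>2 / kk (1 / t)) \<longlongrightarrow> 0) at_top"
    by (rule Lim_transform_eventually)
       (use eventually_gt_at_top[of 0] in eventually_elim, simp add: kk_def)
  then show ?thesis by (simp add: filterlim_at_right_to_top inverse_eq_divide)
qed

end

section \<open>Additive functionals of a block\<close>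

lemma integral_bind_pmf_real:
  fixes f :: "'b \<Rightarrow> real"
  assumes "\<And>x. \<bar>f x\<bar> \<le> C"
  shows "measure_pmf.expectation (bind_pmf p N) f
    = measure_pmf.expectation p (\<lambda>x. measure_pmf.expectation (N x) f)"
  unfolding measure_pmf_bind
  by (rule integral_bind[where K = "count_space UNIV" and B' = 1 and B = C])
     (use assms in \<open>auto simp: space_subprob_algebra subprob_space_measure_pmf intro: measure_pmf.finite_measure_axioms\<close>)

lemma integrable_pmf_bounded:
  fixes f :: "'a \<Rightarrow> 'b :: {banach, second_countable_topology}"
  assumes "\<And>x. norm (f x) \<le> C"
  shows "integrable (measure_pmf p) f"
  by (rule measure_pmf.integrable_const_bound[where B = C]) (use assms in auto)

lemma norm_expectation_le:
  fixes f :: "'a \<Rightarrow> 'b :: {banach, second_countable_topology}"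
  assumes "\<And>x. norm (f x) \<le> C"
  shows "norm (measure_pmf.expectation p f) \<le> C"
proof -
  have "norm (measure_pmf.expectation p f) \<le> measure_pmf.expectation p (\<lambda>x. norm (f x))"
    by (rule integral_norm_bound)
  also have "\<dots> \<le> measure_pmf.expectation p (\<lambda>_. C)"
    by (rule integral_mono) (use assms in \<open>auto intro!: integrable_pmf_bounded[where C = C]\<close>)
  finally show ?thesis by simp
qed

lemma integral_bind_pmf_complex:
  fixes f :: "'b \<Rightarrow> complex"
  assumes f: "\<And>x. norm (f x) \<le> C"
  shows "measure_pmf.expectation (bind_pmf p N) f
    = measure_pmf.expectation p (\<lambda>x. measure_pmf.expectation (N x) f)"
proof -
  have i: "integrable (measure_pmf r) f" for r :: "'b pmf" by (rule integrable_pmf_bounded[OF f])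
  have j: "integrable (measure_pmf p) (\<lambda>x. measure_pmf.expectation (N x) f)"
    by (rule integrable_pmf_bounded[OF norm_expectation_le[OF f]])
  have "\<bar>Re (f x)\<bar> \<le> C" "\<bar>Im (f x)\<bar> \<le> C" for x
    using f[of x] abs_Re_le_cmod[of "f x"] abs_Im_le_cmod[of "f x"] by linarith+
  note * = integral_bind_pmf_real[where f = "\<lambda>x. Re (f x)", OF this(1)]
    integral_bind_pmf_real[where f = "\<lambda>x. Im (f x)", OF this(2)]
  show ?thesis
    by (rule complex_eqI)
       (simp_all only: integral_Re[OF i, symmetric] integral_Im[OF i, symmetric]
         integral_Re[OF j, symmetric] integral_Im[OF j, symmetric] *)
qed

definition total :: "(nat \<Rightarrow> real) \<Rightarrow> nat list \<Rightarrow> real" where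
  "total g w = (\<Sum>k\<leftarrow>w. g k)"

lemma total_simps [simp]:
  "total g [] = 0" "total g (k # w) = g k + total g w" "total g (v @ w) = total g v + total g w"
  by (simp_all add: total_def)

lemma total_lincomb: "total (\<lambda>k. a * g k + b * h k) w = a * total g w + b * total h w"
  by (induction w) (simp_all add: algebra_simps)

lemma real_walk: "real_of_int (walk w) = total (\<lambda>k. real k - 1) w"
  by (induction w) simp_all

lemma total_const: "total (\<lambda>_. c) w = c * real (length w)"
  by (induction w) (simp_all add: algebra_simps)

lemma abs_total_le: "(\<And>k. \<bar>g k\<bar> \<le> c) \<Longrightarrow> \<bar>total g w\<bar> \<le> c * real (length w)"
proof (induction w)
  case (Cons k w)
  have "\<bar>total g (k # w)\<bar> \<le> \<bar>g k\<bar> + \<bar>total g w\<bar>" by simp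
  also have "\<dots> \<le> c + c * real (length w)" using Cons by (intro add_mono) auto
  finally show ?case by (simp add: algebra_simps)
qed simp

lemma summable_poly4_geometric:
  fixes r :: real
  assumes "0 \<le> r" "r < 1"
  shows "summable (\<lambda>n. real n ^ 4 * r ^ n)"
proof -
  obtain c where c: "r < c" "c < 1" using assms(2) dense by blast
  have "(\<lambda>n. (real (Suc n) / real n) ^ 4 * r) \<longlonglongrightarrow> 1 ^ 4 * r"
    by (intro tendsto_intros LIMSEQ_Suc_n_over_n)
  then have "\<forall>\<^sub>F n in sequentially. (real (Suc n) / real n) ^ 4 * r < c"
    by (rule order_tendstoD) (use c in simp)
  then obtain N where N: "\<And>n. n \<ge> N \<Longrightarrow> (real (Suc n) / real n) ^ 4 * r < c"
    by (auto simp: eventually_sequentially)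
  show ?thesis
  proof (rule summable_ratio_test[OF c(2)])
    fix n assume n: "max 1 N \<le> n"
    have "real (Suc n) ^ 4 * r ^ Suc n = ((real (Suc n) / real n) ^ 4 * r) * (real n ^ 4 * r ^ n)"
      using n by (simp add: power_divide)
    also have "\<dots> \<le> c * (real n ^ 4 * r ^ n)"
      using N[of n] n assms by (intro mult_right_mono) auto
    finally show "norm (real (Suc n) ^ 4 * r ^ Suc n) \<le> c * norm (real n ^ 4 * r ^ n)"
      using assms by simp
  qed
qed

lemma isCont_expectation_iexp:
  "isCont (\<lambda>s. measure_pmf.expectation p (\<lambda>x. iexp (s * f x + g x))) s"
proof (rule continuous_at_sequentiallyI)
  fix u :: "nat \<Rightarrow> real" assume u: "u \<longlonglongrightarrow> s"
  show "(\<lambda>n. measure_pmf.expectation p (\<lambda>x. iexp (u n * f x + g x)))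
      \<longlonglongrightarrow> measure_pmf.expectation p (\<lambda>x. iexp (s * f x + g x))"
  proof (rule integral_dominated_convergence[where w = "\<lambda>_. 1"])
    show "AE x in p. (\<lambda>n. iexp (u n * f x + g x)) \<longlonglongrightarrow> iexp (s * f x + g x)"
      by (intro AE_I2 tendsto_intros u)
  qed auto
qed

context marked_offspring
begin

lemma p_B_le_1: "p_B \<le> 1" by simp

lemma expectation_block:
  fixes F :: "nat list \<Rightarrow> complex"
  assumes F: "\<And>b. norm (F b) \<le> C"
  shows "measure_pmf.expectation block F = measure_pmf.expectation \<mu>
    (\<lambda>x. if x \<in> B then F [x] else measure_pmf.expectation block (\<lambda>b. F (x # b)))"
  by (subst block_unfold, subst integral_bind_pmf_complex[OF F])
     (intro Bochner_Integration.integral_cong refl, simp)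

lemma nn_integral_block:
  "(\<integral>\<^sup>+b. F b \<partial>block) = (\<integral>\<^sup>+x. (if x \<in> B then F [x] else (\<integral>\<^sup>+b. F (x # b) \<partial>block)) \<partial>\<mu>)"
  by (subst block_unfold, subst nn_integral_bind_pmf) (intro nn_integral_cong, simp)

lemma emeasure_Compl_B: "emeasure (measure_pmf \<mu>) (- B) = ennreal (1 - p_B)"
  using measure_pmf.prob_compl[of B \<mu>] by (simp add: measure_pmf.emeasure_eq_measure Compl_eq_Diff_UNIV)

lemma block_length_tail: "(\<integral>\<^sup>+b. indicator {b. length b > l} b \<partial>block) = ennreal ((1 - p_B) ^ l)"
proof (induction l)
  case 0
  have "(\<integral>\<^sup>+b. indicator {b. length b > 0} b \<partial>block) = (\<integral>\<^sup>+x. 1 \<partial>\<mu>)"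
    by (subst nn_integral_block) (intro nn_integral_cong, auto)
  then show ?case by simp
next
  case (Suc l)
  have "(\<integral>\<^sup>+b. indicator {b. length b > Suc l} b \<partial>block)
      = (\<integral>\<^sup>+x. (\<integral>\<^sup>+b. indicator {b. length b > l} b \<partial>block) * indicator (- B) x \<partial>\<mu>)"
  proof (subst nn_integral_block, intro nn_integral_cong)
    fix x :: nat
    have "(indicator {b. length b > Suc l} (x # b) :: ennreal) = indicator {b. length b > l} b" for b
      by (auto split: split_indicator)
    then show "(if x \<in> B then indicator {b. length b > Suc l} [x]
        else (\<integral>\<^sup>+b. indicator {b. length b > Suc l} (x # b) \<partial>block))
      = (\<integral>\<^sup>+b. indicator {b. length b > l} b \<partial>block) * indicator (- B) x"
      by (auto simp del: nn_integral_indicator)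
  qed
  also have "\<dots> = ennreal ((1 - p_B) ^ l) * ennreal (1 - p_B)"
    by (subst nn_integral_cmult_indicator) (simp_all only: Suc emeasure_Compl_B, simp)
  finally show ?case by (simp add: ennreal_mult[symmetric] mult.commute)
qed

text \<open>The length of a block is geometric. The fourth moment is the one that
  \<open>cross_term\<close> uses when it dominates large counts.\<close>

lemma integrable_block_length4: "integrable block (\<lambda>b. real (length b) ^ 4)"
proof -
  define N where "N = map_pmf length block"
  let ?r = "1 - p_B"
  have r: "0 \<le> ?r" "?r < 1" using B_pos by auto
  have pN: "pmf N k * ?r \<le> ?r ^ k" for k
  proof (cases k)
    case (Suc l)
    have "ennreal (pmf N k) = (\<integral>\<^sup>+b. indicator {b. length b = k} b \<partial>block)"
      by (simp add: N_def pmf_map vimage_def measure_pmf.emeasure_eq_measure)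
    also have "\<dots> \<le> (\<integral>\<^sup>+b. indicator {b. length b > l} b \<partial>block)"
      by (intro nn_integral_mono) (auto simp: Suc indicator_def)
    finally have "pmf N k \<le> ?r ^ l" using r by (simp add: block_length_tail)
    then have "pmf N k * ?r \<le> ?r ^ l * ?r" using r by (intro mult_right_mono) auto
    then show ?thesis by (simp add: Suc mult.commute)
  qed (use r in \<open>auto intro: mult_le_one pmf_le_1\<close>)
  show ?thesis
  proof (cases "?r = 0")
    case True
    \<comment> \<open>Here \<open>p_B = 1\<close> and blocks have length at most 1; the geometric
      bound of the other case divides by \<open>1 - p_B\<close>.\<close>
    have "(\<integral>\<^sup>+b. indicator {b. length b > 1} b \<partial>block) = 0"
      using block_length_tail[of 1] True by simp
    then have "AE b in block. \<not> length b > 1"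
      by (subst (asm) nn_integral_0_iff_AE) (auto elim: eventually_mono simp: indicator_def split: if_splits)
    then have "AE b in block. norm (real (length b) ^ 4) \<le> 1"
      by eventually_elim (auto simp: power_le_one)
    then show ?thesis by (rule measure_pmf.integrable_const_bound) simp
  next
    case False
    have "(\<integral>\<^sup>+b. ennreal (real (length b) ^ 4) \<partial>block) = (\<integral>\<^sup>+k. ennreal (real k ^ 4) \<partial>N)"
      by (simp add: N_def)
    also have "\<dots> = (\<Sum>k. ennreal (pmf N k) * ennreal (real k ^ 4))"
      by (simp add: nn_integral_measure_pmf nn_integral_count_space_nat)
    also have "\<dots> \<le> (\<Sum>k. ennreal (real k ^ 4 * ?r ^ k / ?r))"
    proof (intro suminf_le summableI)
      fix k
      have "0 < ?r" by (rule le_neq_trans[OF r(1)]) (use False in simp)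
      then have "pmf N k \<le> ?r ^ k / ?r" using pN[of k] by (subst pos_le_divide_eq)
      then have "pmf N k * real k ^ 4 \<le> (?r ^ k / ?r) * real k ^ 4" by (rule mult_right_mono) simp
      then show "ennreal (pmf N k) * ennreal (real k ^ 4) \<le> ennreal (real k ^ 4 * ?r ^ k / ?r)"
        by (simp add: ennreal_mult[symmetric] mult.commute ennreal_leI)
    qed
    also have "\<dots> < \<infinity>"
    proof -
      have "summable (\<lambda>k. real k ^ 4 * ?r ^ k / ?r)"
        by (intro summable_divide summable_poly4_geometric r)
      then have "(\<Sum>k. ennreal (real k ^ 4 * ?r ^ k / ?r)) = ennreal (\<Sum>k. real k ^ 4 * ?r ^ k / ?r)"
        using r by (intro suminf_ennreal2) auto
      then show ?thesis by simp
    qed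
    finally show ?thesis by (intro integrableI_nonneg) auto
  qed
qed

lemma integrable_block_total_power:
  assumes g: "\<And>k. \<bar>g k\<bar> \<le> c" and j: "j \<le> 4"
  shows "integrable block (\<lambda>b. (total g b - m) ^ j)"
proof (rule Bochner_Integration.integrable_bound)
  show "integrable block (\<lambda>b. 1 + 8 * (c ^ 4 * real (length b) ^ 4 + m ^ 4))"
    using integrable_block_length4 by simp
  have "norm ((total g b - m) ^ j) \<le> norm (1 + 8 * (c ^ 4 * real (length b) ^ 4 + m ^ 4))" for b
  proof -
    define x where "x = total g b"
    have pw: "\<bar>y\<bar> ^ j \<le> 1 + y ^ 4" for y :: real
    proof (cases "\<bar>y\<bar> \<le> 1")
      case True
      then have "\<bar>y\<bar> ^ j \<le> 1" by (intro power_le_one) auto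
      then show ?thesis by (smt (verit) zero_le_power_eq_numeral even_numeral zero_le_even_power)
    next
      case False
      then have "\<bar>y\<bar> ^ j \<le> \<bar>y\<bar> ^ 4" using j by (intro power_increasing) auto
      then show ?thesis by (simp add: power_even_abs)
    qed
    have sq: "(a - d)\<^sup>2 \<le> 2 * (a\<^sup>2 + d\<^sup>2)" for a d :: real
      using zero_le_power2[of "a + d"] by (simp add: power2_eq_square algebra_simps)
    have "(x - m) ^ 4 = ((x - m)\<^sup>2)\<^sup>2" by (simp flip: power_mult)
    also have "\<dots> \<le> (2 * (x\<^sup>2 + m\<^sup>2))\<^sup>2" by (rule power_mono[OF sq]) simp
    also have "\<dots> \<le> 8 * ((x\<^sup>2)\<^sup>2 + (m\<^sup>2)\<^sup>2)"
      using zero_le_power2[of "x\<^sup>2 - m\<^sup>2"] by (simp add: power2_eq_square algebra_simps)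
    also have "\<dots> = 8 * (\<bar>x\<bar> ^ 4 + m ^ 4)" by (simp add: power_even_abs flip: power_mult)
    also have "\<dots> \<le> 8 * ((c * real (length b)) ^ 4 + m ^ 4)"
      unfolding x_def using abs_total_le[of g c b] g by (intro mult_left_mono add_right_mono power_mono) auto
    finally have "(x - m) ^ 4 \<le> 8 * (c ^ 4 * real (length b) ^ 4 + m ^ 4)" by (simp add: power_mult_distrib)
    moreover have "norm ((x - m) ^ j) \<le> 1 + (x - m) ^ 4" using pw[of "x - m"] by (simp add: power_abs)
    ultimately show ?thesis unfolding x_def by simp
  qed
  then show "AE b in block. norm ((total g b - m) ^ j) \<le> norm (1 + 8 * (c ^ 4 * real (length b) ^ 4 + m ^ 4))"
    by simp
qed simp

lemma integrable_block_total: "(\<And>k. \<bar>g k\<bar> \<le> c) \<Longrightarrow> integrable block (total g)"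
  using integrable_block_total_power[of g c 1 0] by simp

text \<open>Wald's identity: conditioning on the first letter gives
  \<open>E = E g + (1 - p_B) * E\<close>. As \<open>total g\<close> is unbounded, the conditioning
  is done with nonnegative integrals.\<close>

lemma expectation_block_total_nonneg:
  assumes g: "\<And>k. 0 \<le> g k" "\<And>k. g k \<le> c"
  shows "measure_pmf.expectation block (total g) = measure_pmf.expectation \<mu> g / p_B"
proof -
  have ab: "\<bar>g k\<bar> \<le> c" for k using g[of k] by simp
  have tn: "0 \<le> total g b" for b by (induction b) (use g in auto)
  let ?E = "measure_pmf.expectation block (total g)"
  have E: "(\<integral>\<^sup>+b. ennreal (total g b) \<partial>block) = ennreal ?E"
    by (rule nn_integral_eq_integral[OF integrable_block_total[OF ab]]) (use tn in auto)
  have E0: "0 \<le> ?E" by (rule integral_nonneg_AE) (use tn in auto)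
  have ig: "integrable \<mu> g" by (rule integrable_pmf_bounded) (use ab in auto)
  have iB: "integrable \<mu> (\<lambda>x. ?E * indicator (- B) x)"
    by (rule integrable_pmf_bounded[where C = "?E"]) (use E0 in \<open>auto split: split_indicator\<close>)
  have "ennreal ?E = (\<integral>\<^sup>+x. (if x \<in> B then ennreal (total g [x]) else (\<integral>\<^sup>+b. ennreal (total g (x # b)) \<partial>block)) \<partial>\<mu>)"
    unfolding E[symmetric] by (rule nn_integral_block)
  also have "\<dots> = (\<integral>\<^sup>+x. ennreal (g x + ?E * indicator (- B) x) \<partial>\<mu>)"
  proof (intro nn_integral_cong)
    fix x
    have "(\<integral>\<^sup>+b. ennreal (total g (x # b)) \<partial>block) = (\<integral>\<^sup>+b. ennreal (g x) + ennreal (total g b) \<partial>block)"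
      using g tn by (intro nn_integral_cong) (simp add: ennreal_plus)
    also have "\<dots> = ennreal (g x) + ennreal ?E" by (subst nn_integral_add) (simp_all add: E)
    finally have "(\<integral>\<^sup>+b. ennreal (total g (x # b)) \<partial>block) = ennreal (g x) + ennreal ?E" .
    then show "(if x \<in> B then ennreal (total g [x]) else (\<integral>\<^sup>+b. ennreal (total g (x # b)) \<partial>block))
      = ennreal (g x + ?E * indicator (- B) x)"
      using g E0 by (auto simp: ennreal_plus)
  qed
  also have "\<dots> = ennreal (measure_pmf.expectation \<mu> (\<lambda>x. g x + ?E * indicator (- B) x))"
    by (rule nn_integral_eq_integral) (use g E0 ig iB in \<open>auto intro!: AE_I2\<close>)
  also have "measure_pmf.expectation \<mu> (\<lambda>x. g x + ?E * indicator (- B) x)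
      = measure_pmf.expectation \<mu> g + ?E * (1 - p_B)"
    using ig iB measure_pmf.prob_compl[of B \<mu>] by (simp add: Compl_eq_Diff_UNIV)
  finally have "?E = measure_pmf.expectation \<mu> g + ?E * (1 - p_B)"
    using E0 g p_B_le_1 by (subst (asm) ennreal_inj) (auto intro!: add_nonneg_nonneg integral_nonneg_AE)
  then show ?thesis using B_pos by (simp add: field_simps)
qed

text \<open>Adding the constant \<open>c\<close> makes \<open>g\<close> nonnegative, and Wald's
  identity for the constant takes it off again.\<close>

lemma expectation_block_total:
  assumes g: "\<And>k. \<bar>g k\<bar> \<le> c"
  shows "measure_pmf.expectation block (total g) = measure_pmf.expectation \<mu> g / p_B"
proof -
  have ig: "integrable \<mu> g" by (rule integrable_pmf_bounded) (use g in auto)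
  have 1: "0 \<le> g k + c" "g k + c \<le> 2 * c" for k using g[of k] by auto
  have 2: "0 \<le> c" using g[of 0] by linarith
  have "total (\<lambda>k. g k + c) b = total g b + total (\<lambda>_. c) b" for b
    by (induction b) simp_all
  then have "measure_pmf.expectation block (total g)
      = measure_pmf.expectation block (\<lambda>b. total (\<lambda>k. g k + c) b - total (\<lambda>_. c) b)" by simp
  also have "\<dots> = measure_pmf.expectation block (total (\<lambda>k. g k + c)) - measure_pmf.expectation block (total (\<lambda>_. c))"
    using 1 2 by (intro Bochner_Integration.integral_diff integrable_block_total[where c = "2 * c"]) auto
  also have "measure_pmf.expectation block (total (\<lambda>k. g k + c)) = measure_pmf.expectation \<mu> (\<lambda>k. g k + c) / p_B"
    by (rule expectation_block_total_nonneg[OF 1])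
  also have "measure_pmf.expectation block (total (\<lambda>_. c)) = measure_pmf.expectation \<mu> (\<lambda>_. c) / p_B"
    by (rule expectation_block_total_nonneg[of _ c]) (use 2 in auto)
  also have "measure_pmf.expectation \<mu> (\<lambda>k. g k + c) = measure_pmf.expectation \<mu> g + c" using ig by simp
  finally show ?thesis by (simp add: diff_divide_distrib[symmetric])
qed

definition phi :: "(nat \<Rightarrow> real) \<Rightarrow> complex" where
  "phi h = measure_pmf.expectation block (\<lambda>b. iexp (total h b))"

lemma expectation_blocks_iexp:
  "measure_pmf.expectation (blocks n) (\<lambda>b. iexp (total h b)) = phi h ^ n"
proof (induction n)
  case (Suc n)
  have "measure_pmf.expectation (blocks (Suc n)) (\<lambda>b. iexp (total h b))
      = measure_pmf.expectation block (\<lambda>b. measure_pmf.expectation (blocks n) (\<lambda>w. iexp (total h b) * iexp (total h w)))"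
    unfolding blocks.simps
    by (subst integral_bind_pmf_complex[where C = 1]) (simp_all add: exp_add distrib_left)
  also have "\<dots> = measure_pmf.expectation block (\<lambda>b. iexp (total h b) * phi h ^ n)"
    by (simp only: integral_mult_right_zero Suc)
  also have "\<dots> = phi h * phi h ^ n"
    unfolding phi_def by (rule integral_mult_left_zero)
  finally show ?case by simp
qed simp

text \<open>Conditioning on the first letter gives \<open>phi h = gB h + gC h * phi h\<close>. The
  bound on \<open>gC\<close> makes \<open>1 - gC h\<close> invertible, so \<open>1 - phi h\<close>
  is the corresponding quantity for one letter divided by \<open>1 - gC h\<close>.\<close>

lemma phi_eq:
  defines "gB \<equiv> \<lambda>h. measure_pmf.expectation \<mu> (\<lambda>x. indicator B x *\<^sub>R iexp (h x))"
    and "gC \<equiv> \<lambda>h. measure_pmf.expectation \<mu> (\<lambda>x. indicator (- B) x *\<^sub>R iexp (h x))"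
  shows "phi h * (1 - gC h) = gB h" "norm (gC h) \<le> 1 - p_B" "gB h + gC h = measure_pmf.expectation \<mu> (\<lambda>x. iexp (h x))"
proof -
  have i: "integrable \<mu> (\<lambda>x. indicator S x *\<^sub>R iexp (h x))" for S :: "nat set"
    by (rule integrable_pmf_bounded[where C = 1]) (auto split: split_indicator)
  have "phi h = measure_pmf.expectation \<mu> (\<lambda>x. if x \<in> B then iexp (total h [x]) else measure_pmf.expectation block (\<lambda>b. iexp (total h (x # b))))"
    unfolding phi_def by (rule expectation_block[where C = 1]) simp
  also have "\<dots> = measure_pmf.expectation \<mu> (\<lambda>x. indicator B x *\<^sub>R iexp (h x) + (indicator (- B) x *\<^sub>R iexp (h x)) * phi h)"
  proof (intro Bochner_Integration.integral_cong refl)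
    fix x
    have "measure_pmf.expectation block (\<lambda>b. iexp (total h (x # b))) = measure_pmf.expectation block (\<lambda>b. iexp (h x) * iexp (total h b))"
      by (simp add: exp_add distrib_left)
    also have "\<dots> = iexp (h x) * phi h" unfolding phi_def by (rule integral_mult_right_zero)
    finally show "(if x \<in> B then iexp (total h [x]) else measure_pmf.expectation block (\<lambda>b. iexp (total h (x # b))))
      = indicator B x *\<^sub>R iexp (h x) + (indicator (- B) x *\<^sub>R iexp (h x)) * phi h" by simp
  qed
  also have "\<dots> = gB h + measure_pmf.expectation \<mu> (\<lambda>x. (indicator (- B) x *\<^sub>R iexp (h x)) * phi h)"
    unfolding gB_def by (rule Bochner_Integration.integral_add[OF i integrable_mult_left[OF i]])
  also have "measure_pmf.expectation \<mu> (\<lambda>x. (indicator (- B) x *\<^sub>R iexp (h x)) * phi h) = gC h * phi h"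
    unfolding gC_def by (rule integral_mult_left_zero)
  finally have "phi h = gB h + gC h * phi h" .
  then show "phi h * (1 - gC h) = gB h" by (simp add: algebra_simps)
  have "norm (gC h) \<le> measure_pmf.expectation \<mu> (\<lambda>x. norm (indicator (- B) x *\<^sub>R iexp (h x)))"
    unfolding gC_def by (rule integral_norm_bound)
  also have "\<dots> = measure_pmf.expectation \<mu> (indicator (- B))"
    by (intro Bochner_Integration.integral_cong refl) (auto split: split_indicator)
  also have "\<dots> = 1 - p_B" using measure_pmf.prob_compl[of B \<mu>] by (simp add: Compl_eq_Diff_UNIV)
  finally show "norm (gC h) \<le> 1 - p_B" .
  have "gB h + gC h = measure_pmf.expectation \<mu> (\<lambda>x. indicator B x *\<^sub>R iexp (h x) + indicator (- B) x *\<^sub>R iexp (h x))"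
    unfolding gB_def gC_def by (rule Bochner_Integration.integral_add[OF i i, symmetric])
  also have "\<dots> = measure_pmf.expectation \<mu> (\<lambda>x. iexp (h x))"
    by (intro Bochner_Integration.integral_cong refl) (auto split: split_indicator)
  finally show "gB h + gC h = measure_pmf.expectation \<mu> (\<lambda>x. iexp (h x))" .
qed

end

lemma (in marked_offspring) blocks_Suc_pair:
  "blocks (Suc n) = map_pmf (\<lambda>(b, w). b @ w) (pair_pmf block (blocks n))"
  by (simp add: pair_pmf_def map_bind_pmf map_pmf_def bind_assoc_pmf bind_return_pmf)

lemma integrable_of_square_pmf:
  fixes f :: "'a \<Rightarrow> real"
  assumes "integrable (measure_pmf p) (\<lambda>x. (f x)\<^sup>2)"
  shows "integrable (measure_pmf p) f"
proof (rule Bochner_Integration.integrable_bound)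
  show "integrable (measure_pmf p) (\<lambda>x. 1 + (f x)\<^sup>2)" using assms by simp
  have "\<bar>y\<bar> \<le> 1 + y\<^sup>2" for y :: real
    using zero_le_power2[of "\<bar>y\<bar> - 1"] zero_le_power2[of y] by (simp add: power2_eq_square algebra_simps)
  then show "AE x in p. norm (f x) \<le> norm (1 + (f x)\<^sup>2)" by (auto intro!: AE_I2)
qed simp

section \<open>Mean and variance of sums over blocks\<close>

context marked_offspring
begin

text \<open>By Wald's identity the mean of \<open>total g\<close> over a block; for an indicator it
  is the ratio of masses that appears in the limit.\<close>

definition bmean :: "(nat \<Rightarrow> real) \<Rightarrow> real" where
  "bmean g = measure_pmf.expectation \<mu> g / p_B"

definition bvar :: "(nat \<Rightarrow> real) \<Rightarrow> real" where
  "bvar g = measure_pmf.expectation block (\<lambda>b. (total g b - bmean g)\<^sup>2)"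

lemma bvar_nonneg: "0 \<le> bvar g"
  unfolding bvar_def by (rule integral_nonneg_AE) simp

lemma block_centered:
  assumes g: "\<And>k. \<bar>g k\<bar> \<le> c"
  shows "measure_pmf.expectation block (\<lambda>b. total g b - bmean g) = 0"
  using integrable_block_total[OF g] expectation_block_total[OF g] by (simp add: bmean_def)

text \<open>Independence of the first block removes the mixed term. The second moment is computed as
  a nonnegative integral, which proves integrability at the same time.\<close>

lemma blocks_moments:
  assumes g: "\<And>k. \<bar>g k\<bar> \<le> c"
  shows "integrable (blocks n) (\<lambda>w. (total g w - real n * bmean g)\<^sup>2)
    \<and> measure_pmf.expectation (blocks n) (\<lambda>w. (total g w - real n * bmean g)\<^sup>2) = real n * bvar g
    \<and> measure_pmf.expectation (blocks n) (\<lambda>w. total g w - real n * bmean g) = 0"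
proof (induction n)
  case (Suc n)
  define z where "z w = total g w - real n * bmean g" for w
  define Z where "Z b = total g b - bmean g" for b
  have iZ2: "integrable block (\<lambda>b. (Z b)\<^sup>2)"
    unfolding Z_def using g by (rule integrable_block_total_power) simp
  have iz2: "integrable (blocks n) (\<lambda>w. (z w)\<^sup>2)" and vz: "measure_pmf.expectation (blocks n) (\<lambda>w. (z w)\<^sup>2) = real n * bvar g"
    and mz: "measure_pmf.expectation (blocks n) z = 0"
    using Suc unfolding z_def[abs_def] by auto
  have iZ: "integrable block Z" and iz: "integrable (blocks n) z"
    using iZ2 iz2 by (auto intro: integrable_of_square_pmf)
  have mZ: "measure_pmf.expectation block Z = 0" unfolding Z_def[abs_def] by (rule block_centered[OF g])
  have split: "total g (b @ w) - real (Suc n) * bmean g = Z b + z w" for b w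
    by (simp add: Z_def z_def algebra_simps)
  have inner: "(\<integral>\<^sup>+w. ennreal ((Z b + z w)\<^sup>2) \<partial>blocks n) = ennreal ((Z b)\<^sup>2 + real n * bvar g)" for b
  proof -
    have sq: "(Z b + z w)\<^sup>2 = (Z b)\<^sup>2 + (2 * Z b * z w + (z w)\<^sup>2)" for w
      by (simp add: power2_eq_square algebra_simps)
    have "integrable (blocks n) (\<lambda>w. (Z b + z w)\<^sup>2)" unfolding sq using iz iz2 by simp
    then have "(\<integral>\<^sup>+w. ennreal ((Z b + z w)\<^sup>2) \<partial>blocks n) = ennreal (measure_pmf.expectation (blocks n) (\<lambda>w. (Z b + z w)\<^sup>2))"
      by (rule nn_integral_eq_integral) simp
    also have "measure_pmf.expectation (blocks n) (\<lambda>w. (Z b + z w)\<^sup>2) = (Z b)\<^sup>2 + real n * bvar g"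
      unfolding sq using iz iz2 by (simp add: vz mz)
    finally show ?thesis .
  qed
  have "(\<integral>\<^sup>+w. ennreal ((total g w - real (Suc n) * bmean g)\<^sup>2) \<partial>blocks (Suc n))
      = (\<integral>\<^sup>+b. (\<integral>\<^sup>+w. ennreal ((Z b + z w)\<^sup>2) \<partial>blocks n) \<partial>block)"
    unfolding blocks.simps by (subst nn_integral_bind_pmf) (simp only: nn_integral_map_pmf split)
  also have "\<dots> = (\<integral>\<^sup>+b. ennreal ((Z b)\<^sup>2 + real n * bvar g) \<partial>block)" by (simp only: inner)
  also have "\<dots> = ennreal (measure_pmf.expectation block (\<lambda>b. (Z b)\<^sup>2 + real n * bvar g))"
    by (rule nn_integral_eq_integral) (use iZ2 bvar_nonneg in auto)
  also have "measure_pmf.expectation block (\<lambda>b. (Z b)\<^sup>2 + real n * bvar g) = real (Suc n) * bvar g"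
    using iZ2 by (simp add: bvar_def Z_def algebra_simps)
  finally have nn: "(\<integral>\<^sup>+w. ennreal ((total g w - real (Suc n) * bmean g)\<^sup>2) \<partial>blocks (Suc n)) = ennreal (real (Suc n) * bvar g)" .
  have int: "integrable (blocks (Suc n)) (\<lambda>w. (total g w - real (Suc n) * bmean g)\<^sup>2)"
    by (rule integrableI_nonneg) (use nn in auto)
  moreover have "measure_pmf.expectation (blocks (Suc n)) (\<lambda>w. (total g w - real (Suc n) * bmean g)\<^sup>2) = real (Suc n) * bvar g"
    using nn nn_integral_eq_integral[OF int] bvar_nonneg[of g] by (simp add: integral_nonneg_AE)
  moreover have "measure_pmf.expectation (blocks (Suc n)) (\<lambda>w. total g w - real (Suc n) * bmean g) = 0"
  proof -
    have "integrable (map_pmf fst (pair_pmf block (blocks n))) Z" "integrable (map_pmf snd (pair_pmf block (blocks n))) z"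
      using iZ iz by (simp_all only: map_fst_pair_pmf map_snd_pair_pmf)
    then have ip: "integrable (pair_pmf block (blocks n)) (\<lambda>p. Z (fst p))" "integrable (pair_pmf block (blocks n)) (\<lambda>p. z (snd p))"
      by (simp_all only: integrable_map_pmf_eq)
    have "measure_pmf.expectation (map_pmf fst (pair_pmf block (blocks n))) Z = 0"
      "measure_pmf.expectation (map_pmf snd (pair_pmf block (blocks n))) z = 0"
      using mZ mz by (simp_all only: map_fst_pair_pmf map_snd_pair_pmf)
    then have ep: "measure_pmf.expectation (pair_pmf block (blocks n)) (\<lambda>p. Z (fst p)) = 0"
      "measure_pmf.expectation (pair_pmf block (blocks n)) (\<lambda>p. z (snd p)) = 0"
      by (simp_all only: integral_map_pmf)
    have "measure_pmf.expectation (blocks (Suc n)) (\<lambda>w. total g w - real (Suc n) * bmean g)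
        = measure_pmf.expectation (pair_pmf block (blocks n)) (\<lambda>p. Z (fst p) + z (snd p))"
      unfolding blocks_Suc_pair integral_map_pmf by (simp only: case_prod_beta split)
    also have "\<dots> = 0" using ip ep by simp
    finally show ?thesis .
  qed
  ultimately show ?case by blast
qed (simp add: integrable_measure_pmf_finite)

end

section \<open>Spread of a characteristic function\<close>

text \<open>The variance of the complex variable \<open>iexp (u x)\<close>. As a least mean square
  distance to constants it reacts gently to perturbations of \<open>u\<close>, and it vanishes only
  if this variable is constant on the support.\<close>

definition spread :: "'a pmf \<Rightarrow> ('a \<Rightarrow> real) \<Rightarrow> real" where
  "spread p u = 1 - (norm (measure_pmf.expectation p (\<lambda>x. iexp (u x))))\<^sup>2"

lemma expectation_dist_iexp:
  "measure_pmf.expectation p (\<lambda>x. (norm (iexp (u x) - z))\<^sup>2)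
    = spread p u + (norm (measure_pmf.expectation p (\<lambda>x. iexp (u x)) - z))\<^sup>2"
proof -
  let ?E = "measure_pmf.expectation p (\<lambda>x. iexp (u x))"
  have i: "integrable (measure_pmf p) (\<lambda>x. iexp (u x))" by (rule integrable_pmf_bounded[where C = 1]) simp
  have eq: "(norm (a - z))\<^sup>2 = (norm a)\<^sup>2 - 2 * Re (cnj z * a) + (norm z)\<^sup>2" for a
    unfolding cmod_power2 by (simp add: power2_eq_square algebra_simps)
  define R where "R x = Re (cnj z * iexp (u x))" for x
  have iR: "integrable (measure_pmf p) R"
    unfolding R_def[abs_def] by (rule integrable_Re[OF integrable_mult_right[OF i]])
  have "measure_pmf.expectation p (\<lambda>x. (norm (iexp (u x) - z))\<^sup>2)
      = measure_pmf.expectation p (\<lambda>x. 1 + (norm z)\<^sup>2 - 2 * R x)"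
    unfolding eq R_def by (intro Bochner_Integration.integral_cong refl) simp
  also have "\<dots> = 1 + (norm z)\<^sup>2 - 2 * measure_pmf.expectation p R"
    using iR by simp
  also have "measure_pmf.expectation p R = Re (cnj z * ?E)"
    unfolding R_def[abs_def] integral_Re[OF integrable_mult_right[OF i, of "cnj z"]] integral_mult_right_zero ..
  finally show ?thesis using eq[of ?E] by (simp add: spread_def)
qed

lemma spread_le_dist: "spread p u \<le> measure_pmf.expectation p (\<lambda>x. (norm (iexp (u x) - z))\<^sup>2)"
  unfolding expectation_dist_iexp by simp

lemma spread_eq_dist:
  "spread p u = measure_pmf.expectation p (\<lambda>x. (norm (iexp (u x) - measure_pmf.expectation p (\<lambda>x. iexp (u x))))\<^sup>2)"
  unfolding expectation_dist_iexp by simp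

lemma integrable_dist_iexp: "integrable (measure_pmf p) (\<lambda>x. (norm (iexp (u x) - z))\<^sup>2)"
proof (rule integrable_pmf_bounded)
  fix x
  have "norm (iexp (u x) - z) \<le> norm (iexp (u x)) + norm z" by (rule norm_triangle_ineq4)
  then have "norm (iexp (u x) - z) \<le> 1 + norm z" by simp
  then show "norm ((norm (iexp (u x) - z))\<^sup>2) \<le> (1 + norm z)\<^sup>2" by (simp add: power_mono)
qed

lemma spread_nonneg: "0 \<le> spread p u"
  unfolding spread_eq_dist by (rule integral_nonneg_AE) simp

lemma norm_expectation_iexp_le: "norm (measure_pmf.expectation p (\<lambda>x. iexp (u x))) \<le> 1"
  by (rule norm_expectation_le) simp

text \<open>\<open>iexp (u x)\<close> is \<open>iexp (u x + v x)\<close> times the conjugate of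
  \<open>iexp (v x)\<close>, and the product of the two expectations is a competitor among the
  constants. Decay known for the phase \<open>u\<close> thus survives adding a small phase
  \<open>v\<close>, however the two depend on each other.\<close>

lemma spread_triangle: "spread p u \<le> 2 * spread p (\<lambda>x. u x + v x) + 2 * spread p v"
proof -
  let ?a = "measure_pmf.expectation p (\<lambda>x. iexp (u x + v x))" and ?b = "measure_pmf.expectation p (\<lambda>x. iexp (v x))"
  have "spread p u \<le> measure_pmf.expectation p (\<lambda>x. (norm (iexp (u x) - ?a * cnj ?b))\<^sup>2)" by (rule spread_le_dist)
  also have "\<dots> \<le> measure_pmf.expectation p (\<lambda>x. 2 * (norm (iexp (u x + v x) - ?a))\<^sup>2 + 2 * (norm (iexp (v x) - ?b))\<^sup>2)"
  proof (rule integral_mono)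
    fix x
    have "iexp (u x) = iexp (u x + v x) * cnj (iexp (v x))"
      by (simp add: exp_cnj distrib_left flip: exp_add)
    then have "iexp (u x) - ?a * cnj ?b = (iexp (u x + v x) - ?a) * cnj (iexp (v x)) + ?a * cnj (iexp (v x) - ?b)"
      by (simp add: algebra_simps)
    then have "norm (iexp (u x) - ?a * cnj ?b) \<le> norm ((iexp (u x + v x) - ?a) * cnj (iexp (v x))) + norm (?a * cnj (iexp (v x) - ?b))"
      by (simp only: norm_triangle_ineq)
    also have "\<dots> \<le> norm (iexp (u x + v x) - ?a) + 1 * norm (iexp (v x) - ?b)"
    proof (rule add_mono)
      show "norm (?a * cnj (iexp (v x) - ?b)) \<le> 1 * norm (iexp (v x) - ?b)"
        unfolding norm_mult complex_mod_cnj by (intro mult_right_mono norm_expectation_iexp_le) simp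
    qed (simp add: norm_mult)
    finally have "(norm (iexp (u x) - ?a * cnj ?b))\<^sup>2 \<le> (norm (iexp (u x + v x) - ?a) + norm (iexp (v x) - ?b))\<^sup>2"
      by (intro power_mono) auto
    also have "\<dots> \<le> 2 * (norm (iexp (u x + v x) - ?a))\<^sup>2 + 2 * (norm (iexp (v x) - ?b))\<^sup>2"
      using zero_le_power2[of "norm (iexp (u x + v x) - ?a) - norm (iexp (v x) - ?b)"]
      by (simp add: power2_eq_square algebra_simps)
    finally show "(norm (iexp (u x) - ?a * cnj ?b))\<^sup>2 \<le> 2 * (norm (iexp (u x + v x) - ?a))\<^sup>2 + 2 * (norm (iexp (v x) - ?b))\<^sup>2" .
  qed (intro integrable_dist_iexp Bochner_Integration.integrable_add integrable_mult_right)+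
  also have "\<dots> = 2 * spread p (\<lambda>x. u x + v x) + 2 * spread p v"
    unfolding spread_eq_dist
    by (subst Bochner_Integration.integral_add)
       (intro integrable_mult_right integrable_dist_iexp, intro integrable_mult_right integrable_dist_iexp, simp)
  finally show ?thesis .
qed

lemma norm_iexp_minus_1: "norm (iexp x - 1) \<le> \<bar>x\<bar>"
  using iexp_approx1[of x 0] by simp

lemma spread_le_square:
  assumes "integrable (measure_pmf p) (\<lambda>x. (u x)\<^sup>2)"
  shows "spread p u \<le> measure_pmf.expectation p (\<lambda>x. (u x)\<^sup>2)"
proof -
  have "spread p u \<le> measure_pmf.expectation p (\<lambda>x. (norm (iexp (u x) - 1))\<^sup>2)" by (rule spread_le_dist)
  also have "\<dots> \<le> measure_pmf.expectation p (\<lambda>x. (u x)\<^sup>2)"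
  proof (rule integral_mono[OF integrable_dist_iexp assms])
    fix x
    have "(norm (iexp (u x) - 1))\<^sup>2 \<le> \<bar>u x\<bar>\<^sup>2" by (rule power_mono[OF norm_iexp_minus_1]) simp
    then show "(norm (iexp (u x) - 1))\<^sup>2 \<le> (u x)\<^sup>2" by simp
  qed
  finally show ?thesis .
qed

lemma spread_zero_imp_const:
  assumes "spread p u = 0" "x \<in> set_pmf p"
  shows "iexp (u x) = measure_pmf.expectation p (\<lambda>x. iexp (u x))"
proof -
  have "AE x in p. (norm (iexp (u x) - measure_pmf.expectation p (\<lambda>x. iexp (u x))))\<^sup>2 = 0"
    using assms(1) unfolding spread_eq_dist
    by (subst (asm) integral_nonneg_eq_0_iff_AE[OF integrable_dist_iexp]) auto
  then show ?thesis using assms(2) by (auto simp: AE_measure_pmf_iff)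
qed

section \<open>The walk over blocks\<close>

locale stable_blocks = critical_stable \<mu> \<alpha> + marked_offspring \<mu> B for \<mu> \<alpha> B
begin

definition phiY :: "real \<Rightarrow> complex" where
  "phiY s = phi (\<lambda>k. s * (real k - 1))"

lemma total_walk: "total (\<lambda>k. s * (real k - 1)) b = s * real_of_int (walk b)"
  using total_lincomb[of s "\<lambda>k. real k - 1" 0 "\<lambda>_. 0" b] by (simp add: real_walk)

lemma phiY_eq: "phiY s = measure_pmf.expectation block (\<lambda>b. iexp (s * real_of_int (walk b)))"
  unfolding phiY_def phi_def total_walk ..

lemma isCont_phiY: "isCont phiY s"
  using isCont_expectation_iexp[where p = block and f = "\<lambda>b. real_of_int (walk b)" and g = "\<lambda>_. 0" and s = s] unfolding phiY_eq[abs_def] by simp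

lemma phiY_0 [simp]: "phiY 0 = 1"
  by (simp add: phiY_eq)

lemma phiY_minus: "phiY (- s) = cnj (phiY s)"
proof -
  have "cnj (phiY s) = measure_pmf.expectation block (\<lambda>b. cnj (iexp (s * real_of_int (walk b))))"
    unfolding phiY_eq by simp
  then show ?thesis unfolding phiY_eq by (simp add: exp_cnj)
qed

definition gC :: "real \<Rightarrow> complex" where
  "gC s = measure_pmf.expectation \<mu> (\<lambda>x. indicator (- B) x *\<^sub>R iexp (s * (real x - 1)))"

lemma isCont_w: "isCont w s"
  unfolding w_def[abs_def]
  using isCont_expectation_iexp[where p = \<mu> and f = "\<lambda>k. real k - 1" and g = "\<lambda>_. 0" and s = s] by (intro continuous_intros) simp

lemma w_0 [simp]: "w 0 = 0" by (simp add: w_def)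

text \<open>The divisor tends to \<open>p_B\<close> at 0, so the walk over one block has the
  asymptotics of a single step up to the factor \<open>1 / p_B\<close>.\<close>

lemma one_minus_phiY: "1 - phiY s = w s / (1 - gC s)" and gC_ne_1: "1 - gC s \<noteq> 0"
proof -
  let ?h = "\<lambda>k. s * (real k - 1)"
  have n: "norm (gC s) \<le> 1 - p_B" using phi_eq(2)[of ?h] by (simp add: gC_def)
  show ne: "1 - gC s \<noteq> 0" using n B_pos by auto
  have "phiY s * (1 - gC s) + gC s = 1 - w s"
    using phi_eq(1,3)[of ?h] by (simp add: gC_def phiY_def w_def)
  then have "(1 - phiY s) * (1 - gC s) = w s" by (simp add: algebra_simps)
  then show "1 - phiY s = w s / (1 - gC s)" using ne by (simp add: field_simps)
qed

lemma gC_tendsto: "(gC \<longlongrightarrow> of_real (1 - p_B)) (at 0)"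
proof -
  have "isCont gC 0"
  proof (rule continuous_at_sequentiallyI)
    fix u :: "nat \<Rightarrow> real" assume u: "u \<longlonglongrightarrow> 0"
    show "(\<lambda>n. gC (u n)) \<longlonglongrightarrow> gC 0"
      unfolding gC_def
    proof (rule integral_dominated_convergence[where w = "\<lambda>_. 1"])
      show "AE x in \<mu>. (\<lambda>n. indicat_real (- B) x *\<^sub>R iexp (u n * (real x - 1))) \<longlonglongrightarrow> indicat_real (- B) x *\<^sub>R iexp (0 * (real x - 1))"
        by (intro AE_I2 tendsto_intros u)
    qed (auto split: split_indicator)
  qed
  moreover have "gC 0 = of_real (1 - p_B)"
  proof -
    have "gC 0 = measure_pmf.expectation \<mu> (\<lambda>x. complex_of_real (indicator (- B) x))"
      unfolding gC_def by (simp add: scaleR_conv_of_real)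
    also have "\<dots> = of_real (measure_pmf.expectation \<mu> (indicator (- B)))"
      by (rule integral_complex_of_real)
    also have "measure_pmf.expectation \<mu> (indicator (- B) :: nat \<Rightarrow> real) = 1 - p_B"
      using measure_pmf.prob_compl[of B \<mu>] by (simp add: Compl_eq_Diff_UNIV)
    finally show ?thesis .
  qed
  ultimately show ?thesis by (simp add: isCont_def)
qed

lemma phiY_over_kk: "((\<lambda>s. (1 - phiY s) / of_real (kk s)) \<longlongrightarrow> c_lim / of_real p_B) (at_right 0)"
proof -
  have g: "(gC \<longlongrightarrow> of_real (1 - p_B)) (at_right 0)"
    using gC_tendsto by (auto intro: tendsto_within_subset)
  have "((\<lambda>s. (w s / of_real (kk s)) / (1 - gC s)) \<longlongrightarrow> c_lim / (1 - of_real (1 - p_B))) (at_right 0)"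
    by (intro tendsto_intros w_over_kk g) (use B_pos in auto)
  then show ?thesis by (simp add: one_minus_phiY mult.commute)
qed

definition D :: "real \<Rightarrow> real" where "D s = 1 - (norm (phiY s))\<^sup>2"

lemma D_spread: "D s = spread block (\<lambda>b. s * real_of_int (walk b))"
  by (simp add: D_def spread_def phiY_eq)

lemma D_nonneg: "0 \<le> D s" unfolding D_spread by (rule spread_nonneg)

lemma D_minus: "D (- s) = D s" by (simp add: D_def phiY_minus)

lemma isCont_D: "isCont D s"
  unfolding D_def[abs_def] by (intro continuous_intros isCont_phiY)

lemma eventually_kk_pos: "\<forall>\<^sub>F s in at_right 0. kk s > 0"
proof -
  obtain \<eta> where e: "\<eta> > 0" "\<And>s. 0 < s \<Longrightarrow> s \<le> \<eta> \<Longrightarrow> kk s > 0" by (rule kk_almost_mono) blast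
  show ?thesis using eventually_at_right_real[OF e(1)] by eventually_elim (use e(2) in auto)
qed

text \<open>\<open>D\<close> is twice the real part of \<open>1 - phiY\<close> minus the square of
  its modulus, and that square is of smaller order because \<open>phiY\<close> is continuous at
  0.\<close>

lemma D_over_kk: "((\<lambda>s. D s / kk s) \<longlongrightarrow> 2 * Re c_lim / p_B) (at_right 0)"
proof -
  let ?r = "\<lambda>s. (1 - phiY s) / of_real (kk s)"
  have p: "(phiY \<longlongrightarrow> phiY 0) (at_right 0)"
    using isCont_phiY[of 0] by (auto simp: isCont_def intro: tendsto_within_subset)
  have "((\<lambda>s. 2 * Re (?r s) - norm (?r s) * norm (1 - phiY s)) \<longlongrightarrow>
      2 * Re (c_lim / of_real p_B) - norm (c_lim / of_real p_B) * norm (1 - phiY 0)) (at_right 0)"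
    by (intro tendsto_intros phiY_over_kk p)
  moreover have "\<forall>\<^sub>F s in at_right 0. 2 * Re (?r s) - norm (?r s) * norm (1 - phiY s) = D s / kk s"
    using eventually_kk_pos
  proof eventually_elim
    case (elim s)
    have "D s = 2 * Re (1 - phiY s) - (norm (1 - phiY s))\<^sup>2"
      unfolding D_def cmod_power2 by (simp add: power2_eq_square algebra_simps)
    moreover have "Re (?r s) = Re (1 - phiY s) / kk s" by (rule Re_divide_of_real)
    moreover have "norm (?r s) = norm (1 - phiY s) / kk s" using elim by (simp add: norm_divide)
    ultimately show ?case by (simp add: diff_divide_distrib power2_eq_square)
  qed
  ultimately show ?thesis by (simp add: Lim_transform_eventually Re_divide_of_real)
qed

text \<open>The least period of \<open>|phiY|\<close>, i.e. \<open>2 \<pi>\<close> divided by the span of the walk.\<close>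

definition P :: real where "P = Inf {s. 0 < s \<and> D s = 0}"

lemma D_2pi: "D (2 * pi) = 0"
proof -
  have "iexp (2 * pi * real_of_int j) = 1" for j :: int
    using exp_integer_2pi[of "of_int j"] by (simp add: mult_ac)
  then show ?thesis by (simp add: D_def phiY_eq)
qed

text \<open>Close to 0 the ratio \<open>D / kk\<close> is positive, so the zeros of \<open>D\<close>
  stay away from 0; \<open>2 * pi\<close> is one of them, and by continuity the infimum is
  attained.\<close>

lemma P_pos: "0 < P" and D_P: "D P = 0" and D_pos: "\<And>s. 0 < s \<Longrightarrow> s < P \<Longrightarrow> 0 < D s"
proof -
  let ?S = "{s. 0 < s \<and> D s = 0}"
  have "0 < 2 * Re c_lim / p_B" using Re_c_lim_pos B_pos by simp
  from order_tendstoD(1)[OF D_over_kk this] have "\<forall>\<^sub>F s in at_right 0. 0 < D s / kk s" .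
  then have "\<forall>\<^sub>F s in at_right 0. 0 < D s"
    using eventually_kk_pos by eventually_elim (simp add: zero_less_divide_iff)
  then obtain e where e: "e > 0" "\<And>s. 0 < s \<Longrightarrow> s < e \<Longrightarrow> 0 < D s"
    by (auto simp: eventually_at_right_field)
  have ne: "?S \<noteq> {}" using D_2pi by (auto intro!: exI[of _ "2 * pi"])
  have lb: "e \<le> s" if "s \<in> ?S" for s using e(2)[of s] that by force
  have Pe: "e \<le> P" unfolding P_def using ne lb by (rule cInf_greatest)
  then show "0 < P" using e by simp
  have bdd: "bdd_below ?S" using lb by (rule bdd_belowI)
  have "?S = {s. D s = 0} \<inter> {e..}" using e lb by auto
  moreover have "closed {s. D s = 0}"
    by (intro closed_Collect_eq continuous_intros continuous_at_imp_continuous_on ballI isCont_D)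
  ultimately have "closed ?S" by (metis closed_Int closed_atLeast)
  then have "P \<in> ?S" unfolding P_def using ne bdd by (intro closed_contains_Inf)
  then show "D P = 0" by simp
  show "0 < D s" if "0 < s" "s < P" for s
  proof (rule ccontr)
    assume "\<not> 0 < D s"
    then have "s \<in> ?S" using that D_nonneg[of s] by simp
    then have "P \<le> s" unfolding P_def using bdd by (rule cInf_lower)
    then show False using that by simp
  qed
qed

text \<open>With \<open>t = th n\<close> and \<open>s = u * t\<close> this becomes a bound linear in
  \<open>u\<close>, enough for an integrable majorant. Near 0 it follows from the almost
  monotonicity of \<open>kk s / s\<close>; further out \<open>D\<close> has a positive minimum up to
  half its first zero, while \<open>kk t / t\<close> tends to 0.\<close>

lemma D_lower_bound:
  obtains c where "c > 0" "\<forall>\<^sub>F t in at_right 0. \<forall>s. t \<le> s \<longrightarrow> s \<le> P / 2 \<longrightarrow> c * (s / t) * kk t \<le> D s"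
proof -
  obtain \<eta> where e: "\<eta> > 0" "\<And>s. 0 < s \<Longrightarrow> s \<le> \<eta> \<Longrightarrow> kk s > 0"
    "\<And>s s'. 0 < s \<Longrightarrow> s \<le> s' \<Longrightarrow> s' \<le> \<eta> \<Longrightarrow> kk s / s \<le> 2 * (s / s') powr (1 - \<gamma>) * (kk s' / s')"
    by (rule kk_almost_mono) blast
  define c1 where "c1 = Re c_lim / p_B"
  have c1: "0 < c1" "c1 < 2 * Re c_lim / p_B" using Re_c_lim_pos B_pos by (auto simp: c1_def field_simps)
  from order_tendstoD(1)[OF D_over_kk c1(2)] have "\<forall>\<^sub>F s in at_right 0. c1 < D s / kk s" .
  then obtain e1 where e1: "e1 > 0" "\<And>s. 0 < s \<Longrightarrow> s < e1 \<Longrightarrow> c1 < D s / kk s"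
    by (auto simp: eventually_at_right_field)
  define a where "a = min (min \<eta> (e1 / 2)) (P / 2)"
  have a: "0 < a" "a \<le> \<eta>" "a < e1" "a \<le> P / 2" using e(1) e1(1) P_pos by (auto simp: a_def)
  have near: "(c1 / 2) * (s / t) * kk t \<le> D s" if "0 < t" "t \<le> s" "s \<le> a" for s t
  proof -
    have "(t / s) powr (1 - \<gamma>) \<le> 1" using that gamma_bounds by (intro powr_le1) auto
    moreover have "kk s > 0" using that a e(2)[of s] by simp
    ultimately have "2 * (t / s) powr (1 - \<gamma>) * (kk s / s) \<le> 2 * 1 * (kk s / s)"
      using that by (intro mult_right_mono mult_left_mono) auto
    then have "kk t / t \<le> 2 * (kk s / s)" using e(3)[of t s] that a by linarith
    then have "(s / t) * kk t \<le> 2 * kk s" using that by (simp add: field_simps)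
    then have "(c1 / 2) * ((s / t) * kk t) \<le> (c1 / 2) * (2 * kk s)" using c1 by (intro mult_left_mono) auto
    also have "\<dots> \<le> D s" using e1(2)[of s] \<open>kk s > 0\<close> that a by (simp add: pos_less_divide_eq)
    finally show ?thesis by (simp add: mult.assoc)
  qed
  have "\<exists>x\<in>{a..P / 2}. \<forall>y\<in>{a..P / 2}. D x \<le> D y"
    using a by (intro continuous_attains_inf continuous_at_imp_continuous_on ballI isCont_D) auto
  then obtain x where x: "a \<le> x" "x \<le> P / 2" "\<And>y. a \<le> y \<Longrightarrow> y \<le> P / 2 \<Longrightarrow> D x \<le> D y" by auto
  have Dx: "D x > 0" using x a P_pos by (intro D_pos) auto
  show thesis
  proof (rule that[of "c1 / 2"])
    have "\<forall>\<^sub>F t in at_right 0. kk t / t < D x / (c1 / 2 * (P / 2))"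
      by (rule order_tendstoD(2)[OF kk_over_s]) (use Dx c1 P_pos in simp)
    then show "\<forall>\<^sub>F t in at_right 0. \<forall>s. t \<le> s \<longrightarrow> s \<le> P / 2 \<longrightarrow> c1 / 2 * (s / t) * kk t \<le> D s"
      using eventually_at_right_real[OF a(1)]
    proof eventually_elim
      case (elim t)
      show ?case
      proof (intro allI impI)
        fix s assume s: "t \<le> s" "s \<le> P / 2"
        have t: "0 < t" "t < a" using elim by auto
        show "c1 / 2 * (s / t) * kk t \<le> D s"
        proof (cases "s \<le> a")
          case True then show ?thesis using near s t by blast
        next
          case False
          have kt: "0 < kk t" using t a e(2)[of t] by simp
          have "c1 / 2 * (s / t) * kk t = (c1 / 2 * s) * (kk t / t)" by simp
          also have "\<dots> \<le> (c1 / 2 * (P / 2)) * (kk t / t)" using s c1 kt t by (intro mult_right_mono mult_left_mono) auto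
          also have "\<dots> \<le> D x" using elim(1) c1 P_pos by (simp add: pos_less_divide_eq mult.commute)
          also have "\<dots> \<le> D s" using x(3)[of s] s False by simp
          finally show ?thesis .
        qed
      qed
    qed
  qed (use c1 in simp)
qed

end

text \<open>Complex logarithms are avoided: \<open>z n\<close> and \<open>exp (z n - 1)\<close> both
  have modulus at most 1, so their \<open>n\<close>-th powers differ by at most \<open>n\<close>
  times their own difference.\<close>

lemma power_complex_tendsto_exp:
  fixes z :: "nat \<Rightarrow> complex"
  assumes lim: "(\<lambda>n. of_nat n * (1 - z n)) \<longlonglongrightarrow> l" and le1: "\<And>n. norm (z n) \<le> 1"
  shows "(\<lambda>n. z n ^ n) \<longlonglongrightarrow> exp (- l)"
proof -
  define h where "h n = z n - 1" for n
  have nh: "(\<lambda>n. of_nat n * h n) \<longlonglongrightarrow> - l"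
    using tendsto_minus[OF lim] by (simp add: h_def algebra_simps)
  have h0: "h \<longlonglongrightarrow> 0"
  proof -
    have "(\<lambda>n. (1 / of_nat n) * (of_nat n * h n)) \<longlonglongrightarrow> 0 * - l"
      by (intro tendsto_mult nh lim_const_over_n[of 1, simplified])
    moreover have "\<forall>\<^sub>F n in sequentially. (1 / of_nat n) * (of_nat n * h n) = h n"
      using eventually_gt_at_top[of 0] by eventually_elim simp
    ultimately show ?thesis by (auto intro: Lim_transform_eventually)
  qed
  \<comment> \<open>The difference quotient of \<open>exp\<close> at 0, extended continuously. It
    gives \<open>n * (z n - exp (h n))\<close> as \<open>n * h n\<close> times
    \<open>1 - F (h n)\<close>, a bounded factor times a vanishing one.\<close>
  define F where "F x = (if x = 0 then 1 else (exp x - 1) / x)" for x :: complex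
  have "((\<lambda>x::complex. (exp x - 1) / x) \<longlongrightarrow> 1) (at 0)"
    using DERIV_exp[of "0 :: complex"] by (simp add: DERIV_def)
  then have "(F \<longlongrightarrow> 1) (at 0)"
    by (rule Lim_transform_eventually) (auto simp: F_def eventually_at_filter)
  then have "isCont F 0" by (simp add: isCont_def F_def)
  then have Fh: "(\<lambda>n. F (h n)) \<longlonglongrightarrow> 1"
    using isCont_tendsto_compose[OF _ h0] by (force simp: F_def)
  have eh: "exp (h n) - 1 = h n * F (h n)" for n by (simp add: F_def)
  have "(\<lambda>n. of_nat n * h n - (of_nat n * h n) * F (h n)) \<longlonglongrightarrow> - l - (- l) * 1"
    by (intro tendsto_intros nh Fh)
  moreover have "of_nat n * h n - (of_nat n * h n) * F (h n) = of_nat n * (z n - exp (h n))" for n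
  proof -
    have "exp (h n) = 1 + h n * F (h n)" "z n = 1 + h n" using eh[of n] by (simp_all add: h_def algebra_simps)
    then show ?thesis by (simp only:) (simp add: algebra_simps)
  qed
  ultimately have "(\<lambda>n. of_nat n * (z n - exp (h n))) \<longlonglongrightarrow> 0" by simp
  from tendsto_norm[OF this] have small: "(\<lambda>n. real n * norm (z n - exp (h n))) \<longlonglongrightarrow> 0"
    by (simp add: norm_mult)
  have "norm (exp (h n)) \<le> 1" for n
    using complex_Re_le_cmod[of "z n"] le1[of n] by (simp add: h_def)
  then have "norm (z n ^ n - exp (h n) ^ n) \<le> real n * norm (z n - exp (h n))" for n
    using le1 by (intro norm_power_diff)
  then have "(\<lambda>n. z n ^ n - exp (h n) ^ n) \<longlonglongrightarrow> 0"
    by (intro Lim_null_comparison[OF _ small] always_eventually allI)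
  moreover have "(\<lambda>n. exp (h n) ^ n) \<longlonglongrightarrow> exp (- l)"
    using tendsto_exp[OF nh] by (simp add: exp_of_nat_mult)
  ultimately have "(\<lambda>n. (z n ^ n - exp (h n) ^ n) + exp (h n) ^ n) \<longlonglongrightarrow> 0 + exp (- l)"
    by (rule tendsto_add)
  then show ?thesis by simp
qed

section \<open>The scale of the walk and its stable limit\<close>

context stable_blocks
begin

text \<open>The intermediate value theorem solves the equation on a fixed interval
  \<open>(0, a]\<close>. The solutions tend to 0 because the modulus of \<open>w\<close> is bounded
  below on every \<open>[\<epsilon>, a]\<close>.\<close>

lemma scale_exists:
  "\<exists>th :: nat \<Rightarrow> real. filterlim th (at_right 0) sequentially \<and>
     (\<forall>\<^sub>F n in sequentially. real n * norm (w (th n)) = 1)"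
proof -
  obtain \<eta> where e: "\<eta> > 0" "\<And>s. 0 < s \<Longrightarrow> s \<le> \<eta> \<Longrightarrow> kk s > 0"
    "\<And>s s'. 0 < s \<Longrightarrow> s \<le> s' \<Longrightarrow> s' \<le> \<eta> \<Longrightarrow> kk s / s \<le> 2 * (s / s') powr (1 - \<gamma>) * (kk s' / s')"
    by (rule kk_almost_mono) blast
  have c0: "norm c_lim > 0" using Re_c_lim_pos by auto
  have "((\<lambda>s. norm (w s / of_real (kk s))) \<longlongrightarrow> norm c_lim) (at_right 0)"
    by (intro tendsto_norm w_over_kk)
  from order_tendstoD(1)[OF this, of "norm c_lim / 2"]
  have "\<forall>\<^sub>F s in at_right 0. norm c_lim / 2 < norm (w s / of_real (kk s))" using c0 by simp
  then obtain e1 where e1: "e1 > 0" "\<And>s. 0 < s \<Longrightarrow> s < e1 \<Longrightarrow> norm c_lim / 2 < norm (w s / of_real (kk s))"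
    by (auto simp: eventually_at_right_field)
  define a where "a = min \<eta> (e1 / 2)"
  have a: "0 < a" "a \<le> \<eta>" "a < e1" using e(1) e1(1) by (auto simp: a_def)
  have wlow: "norm (w s) \<ge> norm c_lim / 2 * kk s" if "0 < s" "s \<le> a" for s
    using e1(2)[of s] e(2)[of s] that a by (simp add: norm_divide pos_less_divide_eq)
  have wfar: "norm (w s) \<ge> norm c_lim / 4 * kk \<epsilon>" if "0 < \<epsilon>" "\<epsilon> \<le> s" "s \<le> a" for s \<epsilon>
  proof -
    have k: "kk s > 0" "kk \<epsilon> > 0" using that a e(2) by auto
    have "(\<epsilon> / s) powr (1 - \<gamma>) \<le> 1" using that gamma_bounds by (intro powr_le1) auto
    then have "2 * (\<epsilon> / s) powr (1 - \<gamma>) * (kk s / s) \<le> 2 * 1 * (kk s / s)"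
      using that k by (intro mult_right_mono mult_left_mono) auto
    then have "kk \<epsilon> / \<epsilon> \<le> 2 * (kk s / s)" using e(3)[of \<epsilon> s] that a by linarith
    also have "\<dots> \<le> 2 * (kk s / \<epsilon>)" using that k by (intro mult_left_mono divide_left_mono) auto
    finally have "kk \<epsilon> \<le> 2 * kk s" using that by (simp add: field_simps)
    then have "norm c_lim / 4 * kk \<epsilon> \<le> norm c_lim / 4 * (2 * kk s)" by (intro mult_left_mono) auto
    also have "\<dots> = norm c_lim / 2 * kk s" by simp
    finally show ?thesis using wlow[of s] that by linarith
  qed
  have ivt: "\<exists>s. 0 < s \<and> s \<le> a \<and> real n * norm (w s) = 1" if n: "n > 0" "1 / real n \<le> norm (w a)" for n
  proof -
    have "\<exists>s\<ge>0. s \<le> a \<and> norm (w s) = 1 / real n"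
      using n a by (intro IVT') (auto intro!: continuous_intros continuous_at_imp_continuous_on isCont_w)
    then obtain s where s: "0 \<le> s" "s \<le> a" "norm (w s) = 1 / real n" by blast
    moreover have "s \<noteq> 0" using s(3) n by auto
    ultimately show ?thesis using n by (intro exI[of _ s]) auto
  qed
  define th where "th n = (SOME s. 0 < s \<and> s \<le> a \<and> real n * norm (w s) = 1)" for n :: nat
  have wa: "norm (w a) > 0"
  proof -
    have "0 < norm c_lim / 2 * kk a" using c0 e(2)[of a] a by simp
    then show ?thesis using wlow[of a] a by linarith
  qed
  have inv0: "\<forall>\<^sub>F n in sequentially. n > 0 \<and> 1 / real n < x" if "x > 0" for x
    using order_tendstoD(2)[OF lim_1_over_n that] eventually_gt_at_top[of 0]
    by eventually_elim simp
  have th: "\<forall>\<^sub>F n in sequentially. 0 < th n \<and> th n \<le> a \<and> real n * norm (w (th n)) = 1"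
    using inv0[OF wa]
  proof eventually_elim
    case (elim n)
    have "\<exists>s. 0 < s \<and> s \<le> a \<and> real n * norm (w s) = 1" using ivt[of n] elim by simp
    from someI_ex[OF this] show ?case unfolding th_def .
  qed
  have "th \<longlonglongrightarrow> 0"
  proof (rule order_tendstoI)
    fix x :: real assume x: "x < 0"
    from th show "\<forall>\<^sub>F n in sequentially. x < th n" by eventually_elim (use x in auto)
  next
    fix x :: real assume x: "0 < x"
    define \<epsilon> where "\<epsilon> = min x a"
    have \<epsilon>: "0 < \<epsilon>" "\<epsilon> \<le> x" "\<epsilon> \<le> a" using x a by (auto simp: \<epsilon>_def)
    have "norm c_lim / 4 * kk \<epsilon> > 0" using c0 e(2)[of \<epsilon>] \<epsilon> a by simp
    from inv0[OF this] th show "\<forall>\<^sub>F n in sequentially. th n < x"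
    proof eventually_elim
      case (elim n)
      have "norm (w (th n)) = 1 / real n" using elim by (simp add: field_simps)
      then have "\<not> \<epsilon> \<le> th n" using wfar[of \<epsilon> "th n"] \<epsilon> elim by auto
      then show ?case using \<epsilon> by simp
    qed
  qed
  then have "filterlim th (at_right 0) sequentially"
    using th by (auto simp: filterlim_at elim: eventually_mono)
  moreover have "\<forall>\<^sub>F n in sequentially. real n * norm (w (th n)) = 1" using th by eventually_elim simp
  ultimately show ?thesis by blast
qed

text \<open>\<open>1 / th n\<close> is the order of magnitude of the walk over \<open>n\<close>
  blocks.\<close>

definition th :: "nat \<Rightarrow> real" where
  "th = (SOME th. filterlim th (at_right 0) sequentially \<and>
     (\<forall>\<^sub>F n in sequentially. real n * norm (w (th n)) = 1))"

lemma th_at_right: "filterlim th (at_right 0) sequentially"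
  and th_scale: "\<forall>\<^sub>F n in sequentially. real n * norm (w (th n)) = 1"
  using someI_ex[OF scale_exists] unfolding th_def by blast+

lemma th_pos: "\<forall>\<^sub>F n in sequentially. th n > 0"
  using th_at_right by (auto simp: filterlim_at elim: eventually_mono)

lemma th_kk: "(\<lambda>n. real n * kk (th n)) \<longlonglongrightarrow> 1 / norm c_lim"
proof -
  have c0: "norm c_lim \<noteq> 0" using Re_c_lim_pos by auto
  have "(\<lambda>n. norm (w (th n) / of_real (kk (th n)))) \<longlonglongrightarrow> norm c_lim"
    by (rule filterlim_compose[OF tendsto_norm[OF w_over_kk] th_at_right])
  then have "(\<lambda>n. 1 / norm (w (th n) / of_real (kk (th n)))) \<longlonglongrightarrow> 1 / norm c_lim"
    by (rule tendsto_divide[OF tendsto_const _ c0])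
  moreover have "\<forall>\<^sub>F n in sequentially. 1 / norm (w (th n) / of_real (kk (th n))) = real n * kk (th n)"
    using th_scale eventually_compose_filterlim[OF eventually_kk_pos th_at_right]
  proof eventually_elim
    case (elim n)
    then have "w (th n) \<noteq> 0" by auto
    then show ?case using elim by (simp add: norm_divide field_simps)
  qed
  ultimately show ?thesis by (rule Lim_transform_eventually)
qed

text \<open>The unbounded truncated second moment makes \<open>sqrt n\<close> small against the
  scale of the walk; this drives \<open>cross_term\<close>.\<close>

lemma n_th_square: "(\<lambda>n. real n * (th n)\<^sup>2) \<longlonglongrightarrow> 0"
proof -
  have "(\<lambda>n. (real n * kk (th n)) * ((th n)\<^sup>2 / kk (th n))) \<longlonglongrightarrow> (1 / norm c_lim) * 0"
    by (intro tendsto_mult th_kk filterlim_compose[OF square_over_kk th_at_right])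
  moreover have "\<forall>\<^sub>F n in sequentially. (real n * kk (th n)) * ((th n)\<^sup>2 / kk (th n)) = real n * (th n)\<^sup>2"
    using eventually_compose_filterlim[OF eventually_kk_pos th_at_right] by eventually_elim simp
  ultimately show ?thesis by (auto intro: Lim_transform_eventually)
qed

text \<open>The walk is of smaller order than \<open>n\<close>. This is what the convergence of the
  means rests on.\<close>

lemma n_th_at_top: "(\<lambda>n. 1 / (real n * th n)) \<longlonglongrightarrow> 0"
proof -
  have c0: "1 / norm c_lim \<noteq> 0" using Re_c_lim_pos by auto
  have "(\<lambda>n. (kk (th n) / th n) / (real n * kk (th n))) \<longlonglongrightarrow> 0 / (1 / norm c_lim)"
    by (intro tendsto_divide th_kk filterlim_compose[OF kk_over_s th_at_right] c0)
  moreover have "\<forall>\<^sub>F n in sequentially. (kk (th n) / th n) / (real n * kk (th n)) = 1 / (real n * th n)"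
    using eventually_compose_filterlim[OF eventually_kk_pos th_at_right] by eventually_elim (simp add: field_simps)
  ultimately show ?thesis by (auto intro: Lim_transform_eventually)
qed

text \<open>The normalisation fixes the modulus of \<open>w (th n)\<close> rather than
  \<open>kk (th n)\<close>, hence the factor \<open>norm c_lim\<close>.\<close>

definition C :: complex where "C = c_lim / of_real (p_B * norm c_lim)"

lemma Re_C_pos: "Re C > 0"
proof -
  have "norm c_lim > 0" using Re_c_lim_pos by auto
  then show ?thesis using Re_c_lim_pos B_pos unfolding C_def Re_divide_of_real by simp
qed

text \<open>The characteristic exponent of the limiting \<alpha>-stable law; the conjugate for
  negative \<open>u\<close> reflects that the walk is real.\<close>

definition psi :: "real \<Rightarrow> complex" where
  "psi u = (if u \<ge> 0 then C else cnj C) * of_real (\<bar>u\<bar> powr \<alpha>)"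

lemma phiY_scaled_pos:
  assumes u: "u > 0"
  shows "(\<lambda>n. of_nat n * (1 - phiY (u * th n))) \<longlonglongrightarrow> psi u"
proof -
  have uth: "filterlim (\<lambda>n. u * th n) (at_right 0) sequentially"
    unfolding filterlim_at
  proof
    show "\<forall>\<^sub>F n in sequentially. u * th n \<in> {0<..} \<and> u * th n \<noteq> 0"
      using th_pos by eventually_elim (use u in simp)
    show "(\<lambda>n. u * th n) \<longlonglongrightarrow> 0"
      using th_at_right by (intro tendsto_mult_right_zero) (simp add: filterlim_at)
  qed
  have "(\<lambda>n. ((1 - phiY (u * th n)) / of_real (kk (u * th n))) * of_real ((kk (u * th n) / kk (th n)) * (real n * kk (th n))))
      \<longlonglongrightarrow> (c_lim / of_real p_B) * of_real (u powr \<alpha> * (1 / norm c_lim))"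
    by (intro tendsto_mult tendsto_of_real th_kk filterlim_compose[OF phiY_over_kk uth] filterlim_compose[OF kk_regular[OF u] th_at_right])
  moreover have "(c_lim / of_real p_B) * of_real (u powr \<alpha> * (1 / norm c_lim)) = psi u"
    using u by (simp add: psi_def C_def)
  moreover have "\<forall>\<^sub>F n in sequentially. ((1 - phiY (u * th n)) / of_real (kk (u * th n))) * of_real ((kk (u * th n) / kk (th n)) * (real n * kk (th n)))
      = of_nat n * (1 - phiY (u * th n))"
    using eventually_compose_filterlim[OF eventually_kk_pos th_at_right] eventually_compose_filterlim[OF eventually_kk_pos uth]
    by eventually_elim (simp add: field_simps)
  ultimately show ?thesis by (auto intro: Lim_transform_eventually)
qed

lemma phiY_scaled: "(\<lambda>n. of_nat n * (1 - phiY (u * th n))) \<longlonglongrightarrow> psi u"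
proof -
  consider "u > 0" | "u = 0" | "u < 0" by linarith
  then show ?thesis
  proof cases
    case 1 then show ?thesis by (rule phiY_scaled_pos)
  next
    case 2 then show ?thesis by (simp add: psi_def)
  next
    case 3
    have "(\<lambda>n. cnj (of_nat n * (1 - phiY ((- u) * th n)))) \<longlonglongrightarrow> cnj (psi (- u))"
      by (intro tendsto_cnj phiY_scaled_pos) (use 3 in simp)
    moreover have "cnj (psi (- u)) = psi u" using 3 by (simp add: psi_def)
    ultimately show ?thesis by (simp add: phiY_minus)
  qed
qed

text \<open>Valid exactly on the range \<open>\<bar>u\<bar> * th n \<le> P / 2\<close> over which
  the inversion integral runs, apart from \<open>\<bar>u\<bar> < 1\<close>, where the integrand is
  simply bounded.\<close>

lemma nD_lower_bound:
  "\<exists>c>0. \<forall>\<^sub>F n in sequentially. \<forall>u. 1 \<le> \<bar>u\<bar> \<longrightarrow> \<bar>u\<bar> * th n \<le> P / 2 \<longrightarrow> c * \<bar>u\<bar> \<le> real n * D (u * th n)"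
proof -
  obtain c where c: "c > 0" "\<forall>\<^sub>F t in at_right 0. \<forall>s. t \<le> s \<longrightarrow> s \<le> P / 2 \<longrightarrow> c * (s / t) * kk t \<le> D s"
    by (rule D_lower_bound) blast
  define c2 where "c2 = 1 / norm c_lim / 2"
  have c0: "norm c_lim > 0" using Re_c_lim_pos by auto
  then have x: "0 < 1 / norm c_lim" by simp
  have "y / 2 < y" if "0 < y" for y :: real using that by simp
  from half_gt_zero[OF x] this[OF x] have c2: "0 < c2" and c2': "c2 < 1 / norm c_lim" unfolding c2_def by auto
  from order_tendstoD(1)[OF th_kk c2'] have ev: "\<forall>\<^sub>F n in sequentially. c2 < real n * kk (th n)" .
  show ?thesis
  proof (intro exI[of _ "c * c2"] conjI)
    show "\<forall>\<^sub>F n in sequentially. \<forall>u. 1 \<le> \<bar>u\<bar> \<longrightarrow> \<bar>u\<bar> * th n \<le> P / 2 \<longrightarrow> c * c2 * \<bar>u\<bar> \<le> real n * D (u * th n)"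
      using ev eventually_compose_filterlim[OF c(2) th_at_right] th_pos
    proof eventually_elim
      case (elim n)
      show ?case
      proof (intro allI impI)
        fix u assume u: "1 \<le> \<bar>u\<bar>" "\<bar>u\<bar> * th n \<le> P / 2"
        have Du: "D (u * th n) = D (\<bar>u\<bar> * th n)"
          using D_minus[of "u * th n"] by (cases "u \<ge> 0") auto
        have "c * ((\<bar>u\<bar> * th n) / th n) * kk (th n) \<le> D (\<bar>u\<bar> * th n)"
        proof -
          have "th n \<le> \<bar>u\<bar> * th n" using u elim by (simp add: mult_le_cancel_right1)
          then show ?thesis using elim(2) u by blast
        qed
        then have "c * \<bar>u\<bar> * kk (th n) \<le> D (u * th n)" using elim Du by simp
        then have "real n * (c * \<bar>u\<bar> * kk (th n)) \<le> real n * D (u * th n)" by (rule mult_left_mono) simp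
        moreover have "c * \<bar>u\<bar> * c2 \<le> c * \<bar>u\<bar> * (real n * kk (th n))"
          using elim c by (intro mult_left_mono) auto
        ultimately show "c * c2 * \<bar>u\<bar> \<le> real n * D (u * th n)" by (simp add: mult_ac)
      qed
    qed
  qed (use c c2 in simp)
qed

end

section \<open>Joint characteristic function of walk and count\<close>

lemma norm_one_minus_iexp_square: "(norm (1 - iexp x))\<^sup>2 = 2 * Re (1 - iexp x)"
  unfolding cmod_power2 using sin_cos_squared_add[of x]
  by (simp add: Re_exp Im_exp power2_eq_square algebra_simps)

lemma norm_one_minus_iexp_le_2: "norm (1 - iexp x) \<le> 2"
  using norm_triangle_ineq4[of 1 "iexp x"] by simp

lemma norm_one_minus_iexp_add: "norm (1 - iexp (x + y)) \<le> norm (1 - iexp x) + norm (1 - iexp y)"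
proof -
  have "1 - iexp (x + y) = (1 - iexp x) + iexp x * (1 - iexp y)"
    by (simp add: exp_add distrib_left algebra_simps)
  then have "norm (1 - iexp (x + y)) \<le> norm (1 - iexp x) + norm (iexp x * (1 - iexp y))"
    by (simp only: norm_triangle_ineq)
  then show ?thesis by (simp add: norm_mult)
qed

lemma norm_one_minus_iexp_total: "norm (1 - iexp (total h b)) \<le> total (\<lambda>k. norm (1 - iexp (h k))) b"
proof (induction b)
  case (Cons k b)
  then show ?case using norm_one_minus_iexp_add[of "h k" "total h b"] by simp
qed simp

context stable_blocks
begin

text \<open>The distance of \<open>iexp\<close> to 1 is subadditive over letters and at most 2 for
  each, so Wald's identity for bounded functionals applies although the steps are unbounded. The 2
  in the bound is the mean of \<open>real k + 1\<close>.\<close>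

lemma expectation_one_minus_walk:
  "measure_pmf.expectation block (\<lambda>b. norm (1 - iexp (s * real_of_int (walk b)))) \<le> 2 * \<bar>s\<bar> / p_B"
proof -
  let ?g = "\<lambda>k. norm (1 - iexp (s * (real k - 1)))"
  have g2: "\<bar>?g k\<bar> \<le> 2" for k
    using norm_one_minus_iexp_le_2[of "s * (real k - 1)"] by simp
  have i1: "integrable \<mu> (\<lambda>k. \<bar>s\<bar> * (real k + 1))" using integrable_mean by simp
  have "measure_pmf.expectation block (\<lambda>b. norm (1 - iexp (s * real_of_int (walk b)))) \<le> measure_pmf.expectation block (total ?g)"
  proof (rule integral_mono)
    show "integrable block (\<lambda>b. norm (1 - iexp (s * real_of_int (walk b))))"
      by (rule integrable_norm, rule integrable_pmf_bounded, rule norm_one_minus_iexp_le_2)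
    show "norm (1 - iexp (s * real_of_int (walk b))) \<le> total ?g b" for b
      using norm_one_minus_iexp_total[of "\<lambda>k. s * (real k - 1)" b] by (simp only: total_walk)
  qed (rule integrable_block_total[OF g2])
  also have "\<dots> = measure_pmf.expectation \<mu> ?g / p_B" by (rule expectation_block_total[OF g2])
  also have "measure_pmf.expectation \<mu> ?g \<le> measure_pmf.expectation \<mu> (\<lambda>k. \<bar>s\<bar> * (real k + 1))"
  proof (rule integral_mono[OF _ i1])
    show "integrable \<mu> ?g" by (rule integrable_pmf_bounded[where C = 2]) (use g2 in simp)
    fix k
    have "norm (1 - iexp (s * (real k - 1))) \<le> \<bar>s * (real k - 1)\<bar>"
      using norm_iexp_minus_1[of "s * (real k - 1)"] by (simp only: norm_minus_commute)
    also have "\<dots> \<le> \<bar>s\<bar> * (real k + 1)" unfolding abs_mult by (intro mult_left_mono) auto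
    finally show "norm (1 - iexp (s * (real k - 1))) \<le> \<bar>s\<bar> * (real k + 1)" .
  qed
  also have "measure_pmf.expectation \<mu> (\<lambda>k. \<bar>s\<bar> * (real k + 1)) = 2 * \<bar>s\<bar>"
    using integrable_mean mean by simp
  finally show ?thesis using B_pos by (simp add: divide_right_mono)
qed

definition phiZ :: "(nat \<Rightarrow> real) \<Rightarrow> nat \<Rightarrow> real \<Rightarrow> complex" where
  "phiZ g n s = measure_pmf.expectation block
     (\<lambda>b. iexp (s * real_of_int (walk b) + (total g b - bmean g) / sqrt (real n)))"

context
  fixes g :: "nat \<Rightarrow> real" and c :: real
  assumes g: "\<And>k. \<bar>g k\<bar> \<le> c"
begin

abbreviation Z :: "nat list \<Rightarrow> real" where "Z b \<equiv> total g b - bmean g"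

lemma integrable_Z_power: "j \<le> 4 \<Longrightarrow> integrable block (\<lambda>b. (Z b) ^ j)"
  by (rule integrable_block_total_power[OF g])

text \<open>\<open>Z\<close> is centred, so the expectation can be taken of \<open>e2\<close>
  instead; \<open>n * e2 (Z b / sqrt n)\<close> tends to half the square of \<open>Z b\<close> and
  is dominated by that square.\<close>

lemma clt_block:
  "(\<lambda>n. of_nat n * (1 - measure_pmf.expectation block (\<lambda>b. iexp (Z b / sqrt (real n))))) \<longlonglongrightarrow> of_real (bvar g / 2)"
proof -
  have lim: "(\<lambda>n. measure_pmf.expectation block (\<lambda>b. of_nat n * e2 (Z b / sqrt (real n))))
      \<longlonglongrightarrow> measure_pmf.expectation block (\<lambda>b. complex_of_real ((Z b)\<^sup>2 / 2))"
  proof (rule integral_dominated_convergence[where w = "\<lambda>b. (Z b)\<^sup>2"])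
    show "AE b in block. (\<lambda>n. of_nat n * e2 (Z b / sqrt (real n))) \<longlonglongrightarrow> complex_of_real ((Z b)\<^sup>2 / 2)"
    proof (rule AE_I2)
      fix b
      have "(\<lambda>n. of_nat n * e2 (Z b / sqrt (real n)) - complex_of_real ((Z b)\<^sup>2 / 2)) \<longlonglongrightarrow> 0"
      proof (rule Lim_null_comparison)
        show "\<forall>\<^sub>F n in sequentially. norm (of_nat n * e2 (Z b / sqrt (real n)) - complex_of_real ((Z b)\<^sup>2 / 2))
            \<le> \<bar>Z b\<bar> ^ 3 / 6 * (1 / sqrt (real n))"
          using eventually_gt_at_top[of 0]
        proof eventually_elim
          case (elim n)
          let ?x = "Z b / sqrt (real n)"
          have "of_nat n * complex_of_real (?x\<^sup>2 / 2) = complex_of_real ((Z b)\<^sup>2 / 2)"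
          proof -
            have "of_nat n * complex_of_real (?x\<^sup>2 / 2) = complex_of_real (real n * (?x\<^sup>2 / 2))" by simp
            also have "real n * (?x\<^sup>2 / 2) = (Z b)\<^sup>2 / 2" using elim by (simp add: power_divide)
            finally show ?thesis .
          qed
          then have "of_nat n * e2 ?x - complex_of_real ((Z b)\<^sup>2 / 2) = of_nat n * (e2 ?x - of_real (?x\<^sup>2 / 2))"
            by (simp only: right_diff_distrib)
          then have "norm (of_nat n * e2 ?x - complex_of_real ((Z b)\<^sup>2 / 2)) = real n * norm (e2 ?x - of_real (?x\<^sup>2 / 2))"
            by (simp only: norm_mult norm_of_nat)
          also have "\<dots> \<le> real n * (\<bar>?x\<bar> ^ 3 / 6)" by (intro mult_left_mono norm_e2_minus) simp
          also have "\<bar>?x\<bar> ^ 3 = \<bar>Z b\<bar> ^ 3 / (sqrt (real n) * real n)"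
            using elim by (simp add: power_divide power3_eq_cube)
          finally show ?case using elim by (simp add: field_simps)
        qed
        have "(\<lambda>n. 1 / sqrt (real n)) \<longlonglongrightarrow> 0"
          by (intro tendsto_divide_0[OF tendsto_const] filterlim_at_top_imp_at_infinity
              filterlim_compose[OF sqrt_at_top filterlim_real_sequentially])
        then show "(\<lambda>n. \<bar>Z b\<bar> ^ 3 / 6 * (1 / sqrt (real n))) \<longlonglongrightarrow> 0" by (rule tendsto_mult_right_zero)
      qed
      then show "(\<lambda>n. of_nat n * e2 (Z b / sqrt (real n))) \<longlonglongrightarrow> complex_of_real ((Z b)\<^sup>2 / 2)"
        by (simp add: LIM_zero_cancel)
    qed
    show "AE b in block. norm (of_nat n * e2 (Z b / sqrt (real n))) \<le> (Z b)\<^sup>2" for n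
    proof (rule AE_I2)
      fix b
      show "norm (of_nat n * e2 (Z b / sqrt (real n))) \<le> (Z b)\<^sup>2"
      proof (cases "n = 0")
        case False
        have "norm (of_nat n * e2 (Z b / sqrt (real n))) \<le> real n * ((Z b / sqrt (real n))\<^sup>2 / 2)"
          unfolding norm_mult norm_of_nat by (intro mult_left_mono norm_e2_le_square) simp
        also have "\<dots> \<le> (Z b)\<^sup>2" using False by (simp add: power_divide)
        finally show ?thesis .
      qed simp
    qed
  qed (use integrable_Z_power[of 2] in auto)
  have eq: "of_nat n * (1 - measure_pmf.expectation block (\<lambda>b. iexp (Z b / sqrt (real n))))
      = measure_pmf.expectation block (\<lambda>b. of_nat n * e2 (Z b / sqrt (real n)))" for n
  proof -
    have i: "integrable block (\<lambda>b. iexp (Z b / sqrt (real n)))"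
      by (rule integrable_pmf_bounded[where C = 1]) simp
    have iz: "integrable block (\<lambda>b. \<i> * complex_of_real (Z b / sqrt (real n)))"
      using integrable_Z_power[of 1] by (intro integrable_mult_right integrable_of_real) simp
    have "measure_pmf.expectation block (\<lambda>b. e2 (Z b / sqrt (real n)))
        = measure_pmf.expectation block (\<lambda>b. (1 - iexp (Z b / sqrt (real n))) + \<i> * complex_of_real (Z b / sqrt (real n)))"
      unfolding e2_def by (intro Bochner_Integration.integral_cong refl) (simp only: diff_add_eq)
    also have "\<dots> = (1 - measure_pmf.expectation block (\<lambda>b. iexp (Z b / sqrt (real n))))
        + measure_pmf.expectation block (\<lambda>b. \<i> * complex_of_real (Z b / sqrt (real n)))"
      using i iz by (subst Bochner_Integration.integral_add) auto
    also have "measure_pmf.expectation block (\<lambda>b. \<i> * complex_of_real (Z b / sqrt (real n)))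
        = \<i> * complex_of_real (measure_pmf.expectation block (\<lambda>b. Z b / sqrt (real n)))"
      by (simp only: integral_mult_right_zero integral_complex_of_real)
    also have "measure_pmf.expectation block (\<lambda>b. Z b / sqrt (real n)) = 0"
      by (simp only: integral_divide_zero block_centered[OF g])
    finally show ?thesis by (simp only: integral_mult_right_zero) simp
  qed
  have "measure_pmf.expectation block (\<lambda>b. complex_of_real ((Z b)\<^sup>2 / 2)) = of_real (bvar g / 2)"
    by (simp only: integral_complex_of_real bvar_def) simp
  with lim show ?thesis unfolding eq by simp
qed

text \<open>Where \<open>\<bar>Z\<bar> \<le> K\<close>, the first factor has mean of order
  \<open>th n\<close>, and \<open>sqrt n * th n\<close> tends to 0. Where
  \<open>\<bar>Z\<bar> > K\<close>, an extra factor \<open>\<bar>Z\<bar> / K\<close> is affordable,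
  and the product splits into squares: \<open>n\<close> times the mean square of the first factor
  stays bounded by the stable limit, and the fourth moment of \<open>Z\<close> is finite. The second
  part is of order \<open>1 / K\<close>.\<close>

lemma cross_term:
  "(\<lambda>n. of_nat n * measure_pmf.expectation block
      (\<lambda>b. (1 - iexp (u * th n * real_of_int (walk b))) * (1 - iexp (Z b / sqrt (real n))))) \<longlonglongrightarrow> 0"
proof (rule tendstoI)
  fix \<epsilon> :: real assume \<epsilon>: "\<epsilon> > 0"
  define a where "a n b = norm (1 - iexp (u * th n * real_of_int (walk b)))" for n b
  define M4 where "M4 = measure_pmf.expectation block (\<lambda>b. (Z b) ^ 4)"
  define C2 where "C2 = 2 * Re (psi u) + 1"
  \<comment> \<open>Here \<open>K\<close> is the truncation level of \<open>Z\<close>, large enough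
    to bring the limit \<open>(2 * Re (psi u) + M4) / (2 * K)\<close> of the second part below
    \<open>\<epsilon>\<close>.\<close>
  define K where "K = (\<bar>C2\<bar> + \<bar>M4\<bar> + 1) / \<epsilon>"
  have K: "K > 0" using \<epsilon> by (simp add: K_def)
  have a2: "a n b \<le> 2" for n b
    unfolding a_def by (rule norm_one_minus_iexp_le_2)
  have a0: "0 \<le> a n b" for n b by (simp add: a_def)
  have ia: "integrable block (a n)" for n
    by (rule integrable_pmf_bounded[where C = 2]) (use a0 a2 in auto)
  have ia2: "integrable block (\<lambda>b. (a n b)\<^sup>2)" for n
  proof (rule integrable_pmf_bounded)
    fix b
    have "(a n b)\<^sup>2 \<le> 2\<^sup>2" by (rule power_mono[OF a2 a0])
    then show "norm ((a n b)\<^sup>2) \<le> 2\<^sup>2" by simp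
  qed
  have Ea: "measure_pmf.expectation block (a n) \<le> 2 * \<bar>u * th n\<bar> / p_B" for n
    unfolding a_def by (rule expectation_one_minus_walk)
  have Ea2: "measure_pmf.expectation block (\<lambda>b. (a n b)\<^sup>2) = 2 * Re (1 - phiY (u * th n))" for n
  proof -
    have i: "integrable block (\<lambda>b. iexp (u * th n * real_of_int (walk b)))"
      by (rule integrable_pmf_bounded[where C = 1]) simp
    have "measure_pmf.expectation block (\<lambda>b. (a n b)\<^sup>2)
        = measure_pmf.expectation block (\<lambda>b. 2 * Re (1 - iexp (u * th n * real_of_int (walk b))))"
      unfolding a_def norm_one_minus_iexp_square ..
    also have "\<dots> = 2 * Re (measure_pmf.expectation block (\<lambda>b. 1 - iexp (u * th n * real_of_int (walk b))))"
      using i by (subst integral_mult_right_zero, subst integral_Re) auto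
    also have "measure_pmf.expectation block (\<lambda>b. 1 - iexp (u * th n * real_of_int (walk b))) = 1 - phiY (u * th n)"
      using i by (simp add: phiY_eq)
    finally show ?thesis .
  qed
  have pw: "real n * (a n b * norm (1 - iexp (Z b / sqrt (real n))))
      \<le> K * (sqrt (real n) * a n b) + (1 / (2 * K)) * (real n * (a n b)\<^sup>2 + (Z b) ^ 4)" for n b
  proof (cases "n = 0")
    case False
    have "norm (1 - iexp (Z b / sqrt (real n))) \<le> \<bar>Z b\<bar> / sqrt (real n)"
      using norm_iexp_minus_1[of "Z b / sqrt (real n)"] False by (simp add: norm_minus_commute)
    then have "real n * (a n b * norm (1 - iexp (Z b / sqrt (real n)))) \<le> real n * (a n b * (\<bar>Z b\<bar> / sqrt (real n)))"
      using a0 by (intro mult_left_mono) auto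
    also have "\<dots> = (real n / sqrt (real n)) * a n b * \<bar>Z b\<bar>" by simp
    also have "\<dots> = (sqrt (real n) * a n b) * \<bar>Z b\<bar>" by (simp add: real_div_sqrt)
    also have "\<dots> \<le> K * (sqrt (real n) * a n b) + (1 / (2 * K)) * (real n * (a n b)\<^sup>2 + (Z b) ^ 4)"
    proof -
      define y where "y = sqrt (real n) * a n b"
      have y: "0 \<le> y" "y\<^sup>2 = real n * (a n b)\<^sup>2" using a0 by (auto simp: y_def power_mult_distrib)
      have Z4: "(Z b) ^ 4 = ((Z b)\<^sup>2)\<^sup>2" by (simp flip: power_mult)
      show ?thesis
      proof (cases "\<bar>Z b\<bar> \<le> K")
        case True
        then have "y * \<bar>Z b\<bar> \<le> y * K" using y(1) by (rule mult_left_mono)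
        then have "y * \<bar>Z b\<bar> \<le> K * y" by (simp only: mult.commute)
        moreover have "0 \<le> (1 / (2 * K)) * (y\<^sup>2 + (Z b) ^ 4)" using K by simp
        ultimately show ?thesis unfolding y(2)[symmetric] y_def[symmetric] by linarith
      next
        case False
        have "K * \<bar>Z b\<bar> \<le> \<bar>Z b\<bar> * \<bar>Z b\<bar>" using False by (intro mult_right_mono) auto
        then have "K * \<bar>Z b\<bar> \<le> (Z b)\<^sup>2" by (simp add: power2_eq_square)
        then have "y * (K * \<bar>Z b\<bar>) \<le> y * (Z b)\<^sup>2" using y by (intro mult_left_mono)
        moreover have "2 * (y * (Z b)\<^sup>2) \<le> y\<^sup>2 + (Z b) ^ 4"
          using zero_le_power2[of "y - (Z b)\<^sup>2"] unfolding Z4 by (simp add: power2_diff)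
        ultimately have "2 * K * (y * \<bar>Z b\<bar>) \<le> y\<^sup>2 + (Z b) ^ 4" by (simp add: mult_ac)
        then have "y * \<bar>Z b\<bar> \<le> (1 / (2 * K)) * (y\<^sup>2 + (Z b) ^ 4)" using K by (simp add: field_simps)
        moreover have "0 \<le> K * y" using K y by simp
        ultimately show ?thesis unfolding y(2)[symmetric] y_def[symmetric] by linarith
      qed
    qed
    finally show ?thesis .
  qed (use K in simp)
  have bound: "norm (of_nat n * measure_pmf.expectation block
      (\<lambda>b. (1 - iexp (u * th n * real_of_int (walk b))) * (1 - iexp (Z b / sqrt (real n)))))
     \<le> K * (sqrt (real n) * (2 * \<bar>u * th n\<bar> / p_B)) + (1 / (2 * K)) * (2 * Re (of_nat n * (1 - phiY (u * th n))) + M4)" for n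
  proof -
    have "norm (measure_pmf.expectation block (\<lambda>b. (1 - iexp (u * th n * real_of_int (walk b))) * (1 - iexp (Z b / sqrt (real n)))))
        \<le> measure_pmf.expectation block (\<lambda>b. a n b * norm (1 - iexp (Z b / sqrt (real n))))"
      using integral_norm_bound[of block "\<lambda>b. (1 - iexp (u * th n * real_of_int (walk b))) * (1 - iexp (Z b / sqrt (real n)))"]
      unfolding norm_mult a_def .
    then have "norm (of_nat n * measure_pmf.expectation block (\<lambda>b. (1 - iexp (u * th n * real_of_int (walk b))) * (1 - iexp (Z b / sqrt (real n)))))
        \<le> real n * measure_pmf.expectation block (\<lambda>b. a n b * norm (1 - iexp (Z b / sqrt (real n))))"
      unfolding norm_mult norm_of_nat by (intro mult_left_mono) auto
    also have "\<dots> = measure_pmf.expectation block (\<lambda>b. real n * (a n b * norm (1 - iexp (Z b / sqrt (real n)))))"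
      by simp
    also have "\<dots> \<le> measure_pmf.expectation block (\<lambda>b. K * (sqrt (real n) * a n b) + (1 / (2 * K)) * (real n * (a n b)\<^sup>2 + (Z b) ^ 4))"
    proof (rule integral_mono[OF _ _ pw])
      show "integrable block (\<lambda>b. real n * (a n b * norm (1 - iexp (Z b / sqrt (real n)))))"
      proof (intro integrable_mult_right integrable_pmf_bounded[where C = "2 * 2"])
        fix b
        have "norm (1 - iexp (Z b / sqrt (real n))) \<le> 2"
          by (rule norm_one_minus_iexp_le_2)
        then have "a n b * norm (1 - iexp (Z b / sqrt (real n))) \<le> 2 * 2"
          using a2 a0 by (intro mult_mono) auto
        then show "norm (a n b * norm (1 - iexp (Z b / sqrt (real n)))) \<le> 2 * 2" using a0 by simp
      qed
      show "integrable block (\<lambda>b. K * (sqrt (real n) * a n b) + (1 / (2 * K)) * (real n * (a n b)\<^sup>2 + (Z b) ^ 4))"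
        using ia[of n] ia2[of n] integrable_Z_power[of 4]
        by (intro Bochner_Integration.integrable_add integrable_mult_right) auto
    qed
    also have "\<dots> = K * (sqrt (real n) * measure_pmf.expectation block (a n))
        + (1 / (2 * K)) * (real n * measure_pmf.expectation block (\<lambda>b. (a n b)\<^sup>2) + M4)"
    proof -
      have i1: "integrable block (\<lambda>b. K * (sqrt (real n) * a n b))" using ia[of n] by (intro integrable_mult_right)
      have i2: "integrable block (\<lambda>b. real n * (a n b)\<^sup>2)" using ia2[of n] by (intro integrable_mult_right)
      have i3: "integrable block (\<lambda>b. (Z b) ^ 4)" by (rule integrable_Z_power) simp
      show ?thesis
        unfolding M4_def Bochner_Integration.integral_add[OF i1 integrable_mult_right[OF Bochner_Integration.integrable_add[OF i2 i3]]]
          integral_mult_right_zero Bochner_Integration.integral_add[OF i2 i3] ..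
    qed
    also have "\<dots> \<le> K * (sqrt (real n) * (2 * \<bar>u * th n\<bar> / p_B)) + (1 / (2 * K)) * (2 * Re (of_nat n * (1 - phiY (u * th n))) + M4)"
    proof (rule add_mono)
      show "K * (sqrt (real n) * measure_pmf.expectation block (a n)) \<le> K * (sqrt (real n) * (2 * \<bar>u * th n\<bar> / p_B))"
        using K by (intro mult_left_mono Ea) auto
    qed (simp add: Ea2 algebra_simps)
    finally show ?thesis .
  qed
  have s0: "(\<lambda>n. K * (sqrt (real n) * (2 * \<bar>u * th n\<bar> / p_B))) \<longlonglongrightarrow> 0"
  proof -
    have "(\<lambda>n. sqrt (real n * (th n)\<^sup>2)) \<longlonglongrightarrow> sqrt 0" by (intro tendsto_real_sqrt n_th_square)
    then have "(\<lambda>n. (K * 2 * \<bar>u\<bar> / p_B) * sqrt (real n * (th n)\<^sup>2)) \<longlonglongrightarrow> 0"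
      by (intro tendsto_mult_right_zero) simp
    then show ?thesis by (simp add: real_sqrt_mult abs_mult mult_ac)
  qed
  have "(\<lambda>n. K * (sqrt (real n) * (2 * \<bar>u * th n\<bar> / p_B)) + (1 / (2 * K)) * (2 * Re (of_nat n * (1 - phiY (u * th n))) + M4))
      \<longlonglongrightarrow> 0 + (1 / (2 * K)) * (2 * Re (psi u) + M4)"
    by (intro tendsto_intros s0 phiY_scaled)
  moreover have "0 + (1 / (2 * K)) * (2 * Re (psi u) + M4) < \<epsilon>"
  proof -
    have "2 * Re (psi u) + M4 = C2 - 1 + M4" by (simp add: C2_def)
    also have "\<dots> < 2 * (\<bar>C2\<bar> + \<bar>M4\<bar> + 1)"
    proof -
      have "x - 1 + y < 2 * (x' + y' + 1)" if "x \<le> x'" "y \<le> y'" "0 \<le> x'" "0 \<le> y'" for x y x' y' :: real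
        using that by argo
      from this[OF abs_ge_self abs_ge_self abs_ge_zero abs_ge_zero] show ?thesis .
    qed
    also have "\<dots> = 2 * K * \<epsilon>" using \<epsilon> by (simp add: K_def)
    finally show ?thesis using K by (simp add: pos_divide_less_eq mult.commute)
  qed
  ultimately have "\<forall>\<^sub>F n in sequentially. K * (sqrt (real n) * (2 * \<bar>u * th n\<bar> / p_B))
      + (1 / (2 * K)) * (2 * Re (of_nat n * (1 - phiY (u * th n))) + M4) < \<epsilon>"
    by (rule order_tendstoD)
  then show "\<forall>\<^sub>F n in sequentially. dist (of_nat n * measure_pmf.expectation block
      (\<lambda>b. (1 - iexp (u * th n * real_of_int (walk b))) * (1 - iexp (Z b / sqrt (real n))))) 0 < \<epsilon>"
    by eventually_elim (use bound in \<open>auto simp del: of_real_mult of_real_divide intro: le_less_trans\<close>)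
qed

text \<open>\<open>1 - x * y\<close> is \<open>(1 - x) + (1 - y) - (1 - x) * (1 - y)\<close> and the
  last product vanishes in the limit. The exponents add up: walk and count are asymptotically
  independent.\<close>

lemma phiZ_scaled: "(\<lambda>n. of_nat n * (1 - phiZ g n (u * th n))) \<longlonglongrightarrow> psi u + of_real (bvar g / 2)"
proof -
  have eq: "1 - phiZ g n s = (1 - phiY s) + (1 - measure_pmf.expectation block (\<lambda>b. iexp (Z b / sqrt (real n))))
      - measure_pmf.expectation block (\<lambda>b. (1 - iexp (s * real_of_int (walk b))) * (1 - iexp (Z b / sqrt (real n))))" for n s
  proof -
    let ?x = "\<lambda>b. iexp (s * real_of_int (walk b))" and ?y = "\<lambda>b. iexp (Z b / sqrt (real n))"
    have i: "integrable block ?x" "integrable block ?y" "integrable block (\<lambda>b. ?x b * ?y b)"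
      by (rule integrable_pmf_bounded[where C = 1], simp add: norm_mult)+
    have "measure_pmf.expectation block (\<lambda>b. (1 - ?x b) * (1 - ?y b))
        = measure_pmf.expectation block (\<lambda>b. (1 - ?x b) - (?y b - ?x b * ?y b))"
      by (intro Bochner_Integration.integral_cong refl) (simp add: algebra_simps)
    also have "\<dots> = measure_pmf.expectation block (\<lambda>b. 1 - ?x b) - measure_pmf.expectation block (\<lambda>b. ?y b - ?x b * ?y b)"
      by (rule Bochner_Integration.integral_diff) (use i in auto)
    also have "measure_pmf.expectation block (\<lambda>b. 1 - ?x b) = 1 - phiY s" using i by (simp add: phiY_eq)
    also have "measure_pmf.expectation block (\<lambda>b. ?y b - ?x b * ?y b)
        = measure_pmf.expectation block ?y - measure_pmf.expectation block (\<lambda>b. ?x b * ?y b)"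
      by (rule Bochner_Integration.integral_diff) (use i in auto)
    also have "measure_pmf.expectation block (\<lambda>b. ?x b * ?y b) = phiZ g n s"
      unfolding phiZ_def by (simp add: exp_add distrib_left)
    finally show ?thesis by simp
  qed
  have "(\<lambda>n. of_nat n * (1 - phiY (u * th n))
      + of_nat n * (1 - measure_pmf.expectation block (\<lambda>b. iexp (Z b / sqrt (real n))))
      - of_nat n * measure_pmf.expectation block (\<lambda>b. (1 - iexp (u * th n * real_of_int (walk b))) * (1 - iexp (Z b / sqrt (real n)))))
    \<longlonglongrightarrow> psi u + of_real (bvar g / 2) - 0"
    by (intro tendsto_diff tendsto_add phiY_scaled clt_block cross_term)
  then show ?thesis unfolding eq by (simp only: distrib_left right_diff_distrib diff_zero)
qed

lemma norm_phiZ_le_1: "norm (phiZ g n s) \<le> 1"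
  unfolding phiZ_def by (rule norm_expectation_iexp_le)

lemma phiZ_power_tendsto:
  "(\<lambda>n. phiZ g n (u * th n) ^ n) \<longlonglongrightarrow> exp (- (psi u + of_real (bvar g / 2)))"
  by (rule power_complex_tendsto_exp[OF phiZ_scaled norm_phiZ_le_1])

text \<open>\<open>spread_triangle\<close> carries the decay of the walk over to the joint
  characteristic function at the price of a variance \<open>bvar g / n\<close> per block, which
  after \<open>n\<close> blocks is a constant factor.\<close>

lemma norm_phiZ_power_le: "norm (phiZ g n s ^ n) \<le> exp (bvar g / 2) * exp (- (real n * D s) / 4)"
proof (cases "n = 0")
  case False
  have i2: "integrable block (\<lambda>b. (Z b / sqrt (real n))\<^sup>2)"
    using integrable_Z_power[of 2] by (simp add: power_divide)
  have "D s \<le> 2 * spread block (\<lambda>b. s * real_of_int (walk b) + Z b / sqrt (real n)) + 2 * spread block (\<lambda>b. Z b / sqrt (real n))"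
    unfolding D_spread by (rule spread_triangle)
  also have "spread block (\<lambda>b. Z b / sqrt (real n)) \<le> measure_pmf.expectation block (\<lambda>b. (Z b / sqrt (real n))\<^sup>2)"
    by (rule spread_le_square[OF i2])
  also have "\<dots> = bvar g / real n" by (simp add: power_divide bvar_def)
  also have "spread block (\<lambda>b. s * real_of_int (walk b) + Z b / sqrt (real n)) = 1 - (norm (phiZ g n s))\<^sup>2"
    by (simp add: spread_def phiZ_def)
  finally have "(norm (phiZ g n s))\<^sup>2 \<le> 1 + (bvar g / real n - D s / 2)" by simp
  also have "\<dots> \<le> exp (bvar g / real n - D s / 2)" by (rule exp_ge_add_one_self)
  finally have sq: "(norm (phiZ g n s))\<^sup>2 \<le> (exp ((bvar g / real n - D s / 2) / 2))\<^sup>2"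
    by (simp add: power2_eq_square flip: exp_add)
  have "norm (phiZ g n s) \<le> exp ((bvar g / real n - D s / 2) / 2)"
    by (rule power2_le_imp_le[OF sq]) simp
  then have "norm (phiZ g n s) ^ n \<le> exp ((bvar g / real n - D s / 2) / 2) ^ n" by (intro power_mono) auto
  also have "\<dots> = exp (bvar g / 2) * exp (- (real n * D s) / 4)"
  proof -
    have "real n * ((bvar g / real n - D s / 2) / 2) = bvar g / 2 + (- (real n * D s) / 4)"
      using False by (simp add: field_simps)
    then show ?thesis by (simp only: exp_of_nat_mult[symmetric] exp_add)
  qed
  finally show ?thesis by (simp add: norm_power)
qed (use bvar_nonneg[of g] in simp)

end

end

section \<open>Fourier inversion on the lattice of the walk\<close>

lemma integral_iexp_Icc:
  assumes a: "0 \<le> a"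
  shows "(\<integral>u. indicator {- a..a} u *\<^sub>R iexp (u * y) \<partial>lborel)
    = (if y = 0 then of_real (2 * a) else of_real (2 * sin (a * y) / y))"
proof (cases "y = 0")
  case True
  have "(\<integral>u. indicator {- a..a} u *\<^sub>R (1 :: complex) \<partial>lborel) = of_real (2 * a)"
    using a by (simp add: scaleR_conv_of_real)
  then show ?thesis using True by simp
next
  case False
  let ?f = "\<lambda>z. exp (\<i> * (z * of_real y)) / (\<i> * of_real y)"
  have "(\<integral>u. indicator {- a..a} u *\<^sub>R iexp (u * y) \<partial>lborel) = ?f (of_real a) - ?f (of_real (- a))"
  proof (rule integral_FTC_Icc)
    fix x
    have "(?f has_field_derivative exp (\<i> * (of_real x * of_real y))) (at (of_real x))"
    proof -
      have "((\<lambda>z. exp (\<i> * (z * of_real y))) has_field_derivative (\<i> * of_real y) * exp (\<i> * (of_real x * of_real y))) (at (of_real x))"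
        by (auto intro!: derivative_eq_intros simp: mult_ac)
      from DERIV_cdivide[OF this, of "\<i> * of_real y"] show ?thesis using False by simp
    qed
    from has_vector_derivative_real_field[OF this]
    show "((\<lambda>x. ?f (of_real x)) has_vector_derivative iexp (x * y)) (at x within {- a..a})" by simp
  qed (use a in \<open>auto intro!: continuous_intros\<close>)
  also have "\<dots> = of_real (2 * sin (a * y) / y)"
  proof -
    have "iexp (a * y) - iexp (- (a * y)) = 2 * \<i> * of_real (sin (a * y))"
      by (simp add: complex_eq_iff Re_exp Im_exp)
    then have "?f (of_real a) - ?f (of_real (- a)) = (2 * \<i> * of_real (sin (a * y))) / (\<i> * of_real y)"
      by (simp add: diff_divide_distrib[symmetric])
    then show ?thesis using False by simp
  qed
  finally show ?thesis using False by simp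
qed

lemma exp_minus_le_square: "0 < x \<Longrightarrow> exp (- x) \<le> 2 / x\<^sup>2" for x :: real
proof -
  assume x: "0 < x"
  have "x\<^sup>2 / 2 \<le> exp x" using exp_lower_Taylor_quadratic[of x] x by simp
  then have "1 / exp x \<le> 1 / (x\<^sup>2 / 2)" using x by (intro divide_left_mono) auto
  then show ?thesis by (simp add: exp_minus inverse_eq_divide)
qed

context stable_blocks
begin

text \<open>\<open>D P = 0\<close> makes \<open>iexp (P * walk)\<close> constant over the support of
  a block: all values reached after \<open>n\<close> blocks lie in one residue class of the
  span.\<close>

lemma walk_period: "v \<in> set_pmf (blocks n) \<Longrightarrow> iexp (P * real_of_int (walk v)) = phiY P ^ n"
proof (induction n arbitrary: v)
  case (Suc n)
  then obtain b v' where bv: "b \<in> set_pmf block" "v' \<in> set_pmf (blocks n)" "v = b @ v'" by auto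
  have "iexp (P * real_of_int (walk b)) = phiY P"
    using spread_zero_imp_const[of block "\<lambda>b. P * real_of_int (walk b)" b] D_P bv by (simp add: D_spread phiY_eq)
  then show ?case using Suc.IH[OF bv(2)] bv by (simp add: distrib_left exp_add)
qed simp

text \<open>Integration over one period annihilates every lattice point except -1, where the kernel
  is constant. That -1 belongs to the lattice follows from its positive probability. The variable is
  rescaled by \<open>t\<close> in view of the limit.\<close>

lemma inversion_bounded:
  fixes H :: "nat list \<Rightarrow> complex"
  assumes pos: "measure_pmf.prob (blocks n) {w. walk w = - 1} > 0" and t: "t > 0"
    and H: "\<And>w. norm (H w) \<le> 1"
  shows "measure_pmf.expectation (blocks n) (\<lambda>w. H w * indicator {w. walk w = - 1} w)
    = of_real (t / P) * (\<integral>u. indicator {- (P / (2 * t))..P / (2 * t)} u *\<^sub>R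
        measure_pmf.expectation (blocks n) (\<lambda>w. H w * iexp (u * (t * (real_of_int (walk w) + 1)))) \<partial>lborel)"
proof -
  let ?a = "P / (2 * t)"
  have a: "0 \<le> ?a" using t P_pos by simp
  let ?F = "\<lambda>w u. indicator {- ?a..?a} u *\<^sub>R (H w * iexp (u * (t * (real_of_int (walk w) + 1))))"
  interpret pair_sigma_finite "measure_pmf (blocks n)" lborel ..
  have ii: "integrable lborel (\<lambda>u. indicator {- ?a..?a} u :: real)" by (rule integrable_real_indicator) (use emeasure_compact_finite[OF compact_Icc] in auto)
  have nF: "norm (?F w u) \<le> indicator {- ?a..?a} u" for w u
    using H[of w] by (auto simp: norm_mult split: split_indicator)
  have int1: "integrable lborel (?F w)" for w
    by (rule Bochner_Integration.integrable_bound[OF ii]) (use nF in auto)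
  have meas: "(\<lambda>(w, u). ?F w u) \<in> borel_measurable (measure_pmf (blocks n) \<Otimes>\<^sub>M lborel)"
  proof -
    have "(\<lambda>(w, u). ?F w u) \<in> borel_measurable (count_space UNIV \<Otimes>\<^sub>M lborel)"
      by (rule measurable_pair_measure_countable1) auto
    moreover have "sets (measure_pmf (blocks n) \<Otimes>\<^sub>M lborel) = sets (count_space UNIV \<Otimes>\<^sub>M lborel)"
      by (rule sets_pair_measure_cong) auto
    ultimately show ?thesis by (simp cong: measurable_cong_sets)
  qed
  have int: "integrable (measure_pmf (blocks n) \<Otimes>\<^sub>M lborel) (\<lambda>(w, u). ?F w u)"
  proof (rule Fubini_integrable[OF meas])
    have le: "(\<integral>u. norm (?F w u) \<partial>lborel) \<le> (\<integral>u. indicator {- ?a..?a} u \<partial>lborel)" for w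
      by (rule integral_mono[OF integrable_norm[OF int1] ii nF])
    show "integrable (measure_pmf (blocks n)) (\<lambda>w. \<integral>u. norm (case (w, u) of (w, u) \<Rightarrow> ?F w u) \<partial>lborel)"
      by (rule integrable_pmf_bounded[where C = "\<integral>u. indicator {- ?a..?a} u \<partial>lborel"])
         (use le in \<open>simp only: prod.case real_norm_def abs_of_nonneg integral_nonneg_AE AE_I2 norm_ge_zero\<close>)
  qed (use int1 in auto)
  have fub: "(\<integral>u. (\<integral>w. ?F w u \<partial>blocks n) \<partial>lborel) = (\<integral>w. (\<integral>u. ?F w u \<partial>lborel) \<partial>blocks n)"
    using Fubini_integral[OF int] by simp
  obtain w0 where w0: "w0 \<in> set_pmf (blocks n)" "walk w0 = - 1"
  proof -
    have "set_pmf (blocks n) \<inter> {w. walk w = - 1} \<noteq> {}"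
      using pos measure_Int_set_pmf[of "blocks n" "{w. walk w = - 1}"] by (auto simp: inf_commute[of "{w. walk w = - 1}"])
    then show thesis using that by blast
  qed
  have inner: "of_real (t / P) * (\<integral>u. ?F w u \<partial>lborel) = H w * indicator {w. walk w = - 1} w"
    if w: "w \<in> set_pmf (blocks n)" for w
  proof -
    define x where "x = real_of_int (walk w) + 1"
    \<comment> \<open>Comparing with a word \<open>w0\<close> of walk -1 shows that
      \<open>P * x\<close> is a multiple of \<open>2 * pi\<close>, which is where the sine kernel
      vanishes.\<close>
    have "iexp (P * real_of_int (walk w)) = iexp (P * real_of_int (walk w0))"
      using walk_period[OF w] walk_period[OF w0(1)] by simp
    then have "iexp (P * real_of_int (walk w)) * iexp P = 1" using w0(2) by (simp flip: exp_add)
    then have "iexp (P * x) = 1" by (simp add: x_def distrib_left exp_add)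
    then obtain j :: int where j: "P * x = of_int (2 * j) * pi" by (auto simp: exp_eq_1)
    have "P * x / 2 = of_int j * pi" using j by simp
    then have s: "sin (P * x / 2) = 0" unfolding sin_zero_iff_int2 by blast
    have "(\<integral>u. ?F w u \<partial>lborel) = (\<integral>u. H w * (indicator {- ?a..?a} u *\<^sub>R iexp (u * (t * x))) \<partial>lborel)"
      by (intro Bochner_Integration.integral_cong refl) (simp add: x_def)
    also have "\<dots> = H w * (\<integral>u. indicator {- ?a..?a} u *\<^sub>R iexp (u * (t * x)) \<partial>lborel)"
      by (rule integral_mult_right_zero)
    also have "\<dots> = H w * (if x = 0 then of_real (P / t) else 0)"
    proof -
      have "?a * (t * x) = P * x / 2" using t by simp
      then have "sin (?a * (t * x)) = 0" using s by simp
      then show ?thesis unfolding integral_iexp_Icc[OF a] using t by auto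
    qed
    finally have "(\<integral>u. ?F w u \<partial>lborel) = H w * (if x = 0 then of_real (P / t) else 0)" .
    moreover have "x = 0 \<longleftrightarrow> walk w = - 1" unfolding x_def by linarith
    ultimately show ?thesis using t P_pos by (auto simp: indicator_def)
  qed
  have "of_real (t / P) * (\<integral>u. (\<integral>w. ?F w u \<partial>blocks n) \<partial>lborel)
      = (\<integral>w. of_real (t / P) * (\<integral>u. ?F w u \<partial>lborel) \<partial>blocks n)"
    unfolding fub by (rule integral_mult_right_zero[symmetric])
  also have "\<dots> = (\<integral>w. H w * indicator {w. walk w = - 1} w \<partial>blocks n)"
    by (rule integral_cong_AE) (use inner in \<open>auto simp: AE_measure_pmf_iff\<close>)
  finally show ?thesis by simp
qed

text \<open>The inversion integral without its prefactor \<open>th n / P\<close>, which does not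
  depend on \<open>g\<close>.\<close>

definition J :: "(nat \<Rightarrow> real) \<Rightarrow> nat \<Rightarrow> complex" where
  "J g n = (\<integral>u. indicator {- (P / (2 * th n))..P / (2 * th n)} u *\<^sub>R
      (iexp (u * th n) * phiZ g n (u * th n) ^ n) \<partial>lborel)"

text \<open>Up to the factor \<open>2 * pi\<close> the value at 0 of the density of the stable law
  with exponent \<open>psi\<close>.\<close>

definition I0 :: complex where "I0 = (\<integral>u. exp (- psi u) \<partial>lborel)"

lemma expectation_blocks_phiZ:
  assumes n: "n > 0"
  shows "measure_pmf.expectation (blocks n)
      (\<lambda>w. iexp ((total g w - real n * bmean g) / sqrt (real n)) * iexp (s * (real_of_int (walk w) + 1)))
    = iexp s * phiZ g n s ^ n"
proof -
  define h where "h k = 1 / sqrt (real n) * g k + s * (real k - 1)" for k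
  define c where "c = - (bmean g / sqrt (real n))"
  have h: "total h w = total g w / sqrt (real n) + s * real_of_int (walk w)" for w
    unfolding h_def total_lincomb real_walk by simp
  have ie: "iexp x * iexp y = iexp (x + y)" for x y :: real
    by (simp add: distrib_left exp_add)
  have ip: "iexp c ^ n = iexp (real n * c)"
    by (simp add: mult_ac flip: exp_of_nat_mult)
  have 1: "iexp ((total g v - real n * bmean g) / sqrt (real n)) * iexp (s * (real_of_int (walk v) + 1))
      = iexp s * iexp c ^ n * iexp (total h v)" for v
    unfolding ip ie
    by (rule arg_cong[where f = "\<lambda>x. iexp x"]) (simp add: h c_def diff_divide_distrib distrib_left)
  have 2: "phiZ g n s = iexp c * phi h"
  proof -
    have "phiZ g n s = measure_pmf.expectation block (\<lambda>b. iexp c * iexp (total h b))"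
      unfolding phiZ_def ie
      by (intro Bochner_Integration.integral_cong refl arg_cong[where f = "\<lambda>x. iexp x"])
         (simp add: h c_def diff_divide_distrib)
    then show ?thesis unfolding phi_def by simp
  qed
  show ?thesis
    unfolding 1 2 power_mult_distrib integral_mult_right_zero expectation_blocks_iexp by (simp add: mult.assoc)
qed

lemma inversion:
  assumes pos: "measure_pmf.prob (blocks n) {w. walk w = - 1} > 0" and n: "n > 0" and t: "th n > 0"
  shows "measure_pmf.expectation (blocks n)
      (\<lambda>w. iexp ((total g w - real n * bmean g) / sqrt (real n)) * indicator {w. walk w = - 1} w)
    = of_real (th n / P) * J g n"
  by (subst inversion_bounded[OF pos t])
     (simp_all only: J_def mult.assoc[symmetric] expectation_blocks_phiZ[OF n] norm_exp_i_times order_refl)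

text \<open>By asymptotic independence the limiting integrand factors, so \<open>g\<close>
  contributes only a constant. The phase \<open>iexp (u * th n)\<close>, which stems from the end
  value -1, tends to 1.\<close>

lemma J_tendsto:
  assumes g: "\<And>k. \<bar>g k\<bar> \<le> c"
  shows "J g \<longlonglongrightarrow> exp (- of_real (bvar g / 2)) * I0"
proof -
  obtain d where d: "d > 0" "\<forall>\<^sub>F n in sequentially. \<forall>u. 1 \<le> \<bar>u\<bar> \<longrightarrow> \<bar>u\<bar> * th n \<le> P / 2 \<longrightarrow> d * \<bar>u\<bar> \<le> real n * D (u * th n)"
    using nD_lower_bound by blast
  obtain N where N: "\<And>n. n \<ge> N \<Longrightarrow> 0 < th n"
    "\<And>n u. n \<ge> N \<Longrightarrow> 1 \<le> \<bar>u\<bar> \<Longrightarrow> \<bar>u\<bar> * th n \<le> P / 2 \<Longrightarrow> d * \<bar>u\<bar> \<le> real n * D (u * th n)"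
    using eventually_conj[OF th_pos d(2)] unfolding eventually_sequentially by blast
  \<comment> \<open>For \<open>\<bar>u\<bar> > 1\<close> the linear lower bound turns the decay into
    \<open>exp (- (d * \<bar>u\<bar> / 4))\<close>, which is at most 2 divided by the square of the
    exponent, hence \<open>32 / d\<^sup>2\<close>.\<close>
  define W where "W u = exp (bvar g / 2) * (indicator {- 1..1} u
    + 32 / d\<^sup>2 * (indicator {1..} u * u powr (- 2) + indicator {1..} (- u) * (- u) powr (- 2)))" for u :: real
  have iW: "integrable lborel W"
  proof -
    have 1: "integrable lborel (\<lambda>u::real. indicator {1..} u * u powr (- 2))"
      by (rule integrable_powr_atLeast) auto
    have 2: "integrable lborel (\<lambda>u::real. indicator {1..} (- u) * (- u) powr (- 2))"
      using lborel_integrable_real_affine[OF 1, of "- 1" 0] by simp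
    have 3: "integrable lborel (\<lambda>u. indicator {- 1..1::real} u :: real)" by (rule integrable_real_indicator) (use emeasure_compact_finite[OF compact_Icc] in auto)
    show ?thesis unfolding W_def
      by (intro integrable_mult_right Bochner_Integration.integrable_add 1 2 3)
  qed
  let ?s = "\<lambda>n u. indicator {- (P / (2 * th n))..P / (2 * th n)} u *\<^sub>R (iexp (u * th n) * phiZ g n (u * th n) ^ n)"
  have bound: "norm (?s n u) \<le> W u" if n: "n \<ge> N" for n u
  proof (cases "u \<in> {- (P / (2 * th n))..P / (2 * th n)}")
    case True
    have t: "th n > 0" using N n by blast
    have "\<bar>u\<bar> \<le> P / (2 * th n)" using True by auto
    then have ut: "\<bar>u\<bar> * th n \<le> P / 2" using t by (simp add: field_simps)
    have ns: "norm (?s n u) = norm (phiZ g n (u * th n) ^ n)" using True by (simp add: norm_mult)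
    have le: "norm (phiZ g n (u * th n) ^ n) \<le> exp (bvar g / 2) * exp (- (real n * D (u * th n)) / 4)"
      by (rule norm_phiZ_power_le[OF g])
    have nn: "0 \<le> 32 / d\<^sup>2 * (indicator {1..} u * u powr (- 2) + indicator {1..} (- u) * (- u) powr (- 2))"
      by simp
    show ?thesis
    proof (cases "\<bar>u\<bar> \<le> 1")
      case True
      have "exp (- (real n * D (u * th n)) / 4) \<le> 1" using D_nonneg by simp
      also have "1 \<le> indicator {- 1..1} u + 32 / d\<^sup>2 * (indicator {1..} u * u powr (- 2) + indicator {1..} (- u) * (- u) powr (- 2))"
      proof -
        have "u \<in> {- 1..1}" using True by (simp add: abs_le_iff)
    then have "indicator {- 1..1} u = (1 :: real)" by simp
        with nn show ?thesis by linarith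
      qed
      finally show ?thesis unfolding ns W_def by (intro order_trans[OF le] mult_left_mono) auto
    next
      case False
      have "exp (- (real n * D (u * th n)) / 4) \<le> exp (- (d * \<bar>u\<bar> / 4))"
        using N(2)[OF n _ ut] False by simp
      also have "\<dots> \<le> 2 / (d * \<bar>u\<bar> / 4)\<^sup>2"
        by (rule exp_minus_le_square) (use d False in auto)
      also have "\<dots> = 32 / d\<^sup>2 * \<bar>u\<bar> powr (- 2)"
        using False by (simp add: powr_minus power_mult_distrib power_divide field_simps)
      also have "\<bar>u\<bar> powr (- 2) = indicator {1..} u * u powr (- 2) + indicator {1..} (- u) * (- u) powr (- 2)"
        using False by (cases "u \<ge> 0") auto
      also have "32 / d\<^sup>2 * \<dots> \<le> indicator {- 1..1} u + 32 / d\<^sup>2 * \<dots>" by simp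
      finally show ?thesis unfolding ns W_def by (intro order_trans[OF le] mult_left_mono) auto
    qed
  next
    case False
    have "0 \<le> W u" unfolding W_def by (intro mult_nonneg_nonneg add_nonneg_nonneg) auto
    then show ?thesis using False by simp
  qed
  have th0: "th \<longlonglongrightarrow> 0" using th_at_right by (simp add: filterlim_at)
  have pt: "(\<lambda>n. ?s n u) \<longlonglongrightarrow> exp (- (psi u + of_real (bvar g / 2)))" for u
  proof (rule Lim_transform_eventually)
    have "(\<lambda>n. iexp (u * th n)) \<longlonglongrightarrow> iexp (u * 0)" by (intro tendsto_intros th0)
    then have "(\<lambda>n. iexp (u * th n) * phiZ g n (u * th n) ^ n) \<longlonglongrightarrow> iexp (u * 0) * exp (- (psi u + of_real (bvar g / 2)))"
      by (intro tendsto_mult phiZ_power_tendsto[OF g])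
    then show "(\<lambda>n. iexp (u * th n) * phiZ g n (u * th n) ^ n) \<longlonglongrightarrow> exp (- (psi u + of_real (bvar g / 2)))" by simp
    have "(\<lambda>n. \<bar>u\<bar> * th n) \<longlonglongrightarrow> \<bar>u\<bar> * 0" by (intro tendsto_intros th0)
    then have "\<forall>\<^sub>F n in sequentially. \<bar>u\<bar> * th n < P / 2" by (rule order_tendstoD) (use P_pos in simp)
    then show "\<forall>\<^sub>F n in sequentially. iexp (u * th n) * phiZ g n (u * th n) ^ n = ?s n u"
      using th_pos
    proof eventually_elim
      case (elim n)
      then have "\<bar>u\<bar> \<le> P / (2 * th n)" by (simp add: field_simps)
      then have "u \<in> {- (P / (2 * th n))..P / (2 * th n)}" by auto
      then show ?case by simp
    qed
  qed
  have meas: "?s n \<in> borel_measurable lborel" for n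
  proof -
    have "isCont (phiZ g n) x" for x
      using isCont_expectation_iexp[where p = block and f = "\<lambda>b. real_of_int (walk b)"
          and g = "\<lambda>b. (total g b - bmean g) / sqrt (real n)" and s = x]
      unfolding phiZ_def[abs_def] .
    then have [measurable]: "phiZ g n \<in> borel_measurable borel"
      by (intro borel_measurable_continuous_onI continuous_at_imp_continuous_on) auto
    show ?thesis by measurable
  qed
  have "(\<lambda>n. J g (n + N)) \<longlonglongrightarrow> (\<integral>u. exp (- (psi u + of_real (bvar g / 2))) \<partial>lborel)"
    unfolding J_def
  proof (rule integral_dominated_convergence[OF _ _ iW])
    show "(\<lambda>u. exp (- (psi u + of_real (bvar g / 2)))) \<in> borel_measurable lborel"
      unfolding psi_def[abs_def] by measurable
    show "AE u in lborel. (\<lambda>n. ?s (n + N) u) \<longlonglongrightarrow> exp (- (psi u + of_real (bvar g / 2)))"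
      by (intro AE_I2 LIMSEQ_ignore_initial_segment pt)
    show "AE u in lborel. norm (?s (n + N) u) \<le> W u" for n
      by (intro AE_I2 bound) simp
  qed (rule meas)
  then have "J g \<longlonglongrightarrow> (\<integral>u. exp (- (psi u + of_real (bvar g / 2))) \<partial>lborel)"
    by (rule LIMSEQ_offset)
  moreover have "(\<integral>u. exp (- (psi u + of_real (bvar g / 2))) \<partial>lborel) = exp (- of_real (bvar g / 2)) * I0"
  proof -
    have "exp (- (psi u + of_real (bvar g / 2))) = exp (- of_real (bvar g / 2)) * exp (- psi u)" for u
      unfolding minus_add_distrib exp_add by (rule mult.commute)
    then show ?thesis unfolding I0_def by (simp only: integral_mult_right_zero)
  qed
  ultimately show ?thesis by simp
qed

end

section \<open>Positivity of the stable density at 0\<close>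

lemma integrable_inverse_square_tails:
  "integrable lborel (\<lambda>u::real. indicator {1..} u * u powr (- 2) + indicator {1..} (- u) * (- u) powr (- 2))"
proof -
  have 1: "integrable lborel (\<lambda>u::real. indicator {1..} u * u powr (- 2))"
    by (rule integrable_powr_atLeast) auto
  have 2: "integrable lborel (\<lambda>u::real. indicator {1..} (- u) * (- u) powr (- 2))"
    using lborel_integrable_real_affine[OF 1, of "- 1" 0] by simp
  show ?thesis by (intro Bochner_Integration.integrable_add 1 2)
qed

text \<open>Substituting \<open>y * v\<close> in the Gamma integral gives the Laplace representation
  of \<open>y powr (- \<beta>)\<close>.\<close>

lemma Gamma_integral_scaled:
  fixes \<beta> y :: real
  assumes b: "\<beta> > 0" and y: "y > 0"
  shows "integrable lborel (\<lambda>v. indicator {0<..} v * (v powr (\<beta> - 1) * exp (- (v * y))))"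
    and "(\<integral>v. indicator {0<..} v * (v powr (\<beta> - 1) * exp (- (v * y))) \<partial>lborel) = Gamma \<beta> * y powr (- \<beta>)"
proof -
  let ?f = "\<lambda>v. indicator {0<..} v * (v powr (\<beta> - 1) * exp (- (v * y)))"
  have "ennreal (Gamma \<beta>) = (\<integral>\<^sup>+t. ennreal (indicator {0..} t * t powr (\<beta> - 1) / exp t) \<partial>lborel)"
    by (rule Gamma_conv_nn_integral_real[OF b])
  also have "\<dots> = ennreal \<bar>y\<bar> * (\<integral>\<^sup>+v. ennreal (indicator {0..} (0 + y * v) * (0 + y * v) powr (\<beta> - 1) / exp (0 + y * v)) \<partial>lborel)"
    by (rule nn_integral_real_affine) (use y in auto)
  also have "(\<integral>\<^sup>+v. ennreal (indicator {0..} (0 + y * v) * (0 + y * v) powr (\<beta> - 1) / exp (0 + y * v)) \<partial>lborel)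
      = (\<integral>\<^sup>+v. ennreal (y powr (\<beta> - 1)) * ennreal (?f v) \<partial>lborel)"
  proof (intro nn_integral_cong_AE AE_I2)
    fix v :: real
    show "ennreal (indicator {0..} (0 + y * v) * (0 + y * v) powr (\<beta> - 1) / exp (0 + y * v)) = ennreal (y powr (\<beta> - 1)) * ennreal (?f v)"
      using y by (cases "v > 0"; cases "v = 0")
        (auto simp: powr_mult exp_minus inverse_eq_divide mult.commute ennreal_mult[symmetric] zero_le_mult_iff split: split_indicator)
  qed
  also have "\<dots> = ennreal (y powr (\<beta> - 1)) * (\<integral>\<^sup>+v. ennreal (?f v) \<partial>lborel)"
    by (rule nn_integral_cmult) simp
  finally have eq: "ennreal (Gamma \<beta>) = ennreal (y powr \<beta>) * (\<integral>\<^sup>+v. ennreal (?f v) \<partial>lborel)"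
    using y by (simp add: powr_diff ennreal_mult[symmetric] flip: mult.assoc)
  have "ennreal (y powr (- \<beta>)) * ennreal (Gamma \<beta>) = (ennreal (y powr (- \<beta>)) * ennreal (y powr \<beta>)) * (\<integral>\<^sup>+v. ennreal (?f v) \<partial>lborel)"
    unfolding eq by (simp only: mult.assoc)
  also have "ennreal (y powr (- \<beta>)) * ennreal (y powr \<beta>) = 1"
    using y by (simp add: ennreal_mult[symmetric] powr_add[symmetric])
  finally have nn: "(\<integral>\<^sup>+v. ennreal (?f v) \<partial>lborel) = ennreal (Gamma \<beta> * y powr (- \<beta>))"
    using Gamma_real_pos[OF b] by (simp add: ennreal_mult[symmetric] mult.commute)
  show int: "integrable lborel ?f"
    by (rule integrableI_nonneg) (auto simp: nn)
  have "ennreal (integral\<^sup>L lborel ?f) = ennreal (Gamma \<beta> * y powr (- \<beta>))"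
    using nn_integral_eq_integral[OF int] nn by simp
  then show "integral\<^sup>L lborel ?f = Gamma \<beta> * y powr (- \<beta>)"
    using Gamma_real_pos[OF b] by (subst (asm) ennreal_inj) (auto intro!: integral_nonneg_AE)
qed

lemma integrable_exp_powr:
  fixes a \<alpha> :: real
  assumes a: "a > 0" and al: "\<alpha> \<ge> 1"
  shows "integrable lborel (\<lambda>u. exp (- (a * \<bar>u\<bar> powr \<alpha>)))"
proof (rule Bochner_Integration.integrable_bound)
  have "integrable lborel (\<lambda>u. indicator {- 1..1::real} u :: real)"
    by (rule integrable_real_indicator) (use emeasure_compact_finite[OF compact_Icc] in auto)
  then show "integrable lborel (\<lambda>u. indicator {- 1..1} u
      + 2 / a\<^sup>2 * (indicator {1..} u * u powr (- 2) + indicator {1..} (- u) * (- u) powr (- 2)))"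
    by (intro Bochner_Integration.integrable_add integrable_mult_right integrable_inverse_square_tails)
  have "exp (- (a * \<bar>u\<bar> powr \<alpha>)) \<le> indicator {- 1..1} u
      + 2 / a\<^sup>2 * (indicator {1..} u * u powr (- 2) + indicator {1..} (- u) * (- u) powr (- 2))" for u :: real
  proof (cases "\<bar>u\<bar> \<le> 1")
    case True
    have "exp (- (a * \<bar>u\<bar> powr \<alpha>)) \<le> 1" using a by simp
    moreover have "0 \<le> 2 / a\<^sup>2 * (indicator {1..} u * u powr (- 2) + indicator {1..} (- u) * (- u) powr (- 2))"
      by simp
    moreover have "indicator {- 1..1} u = (1 :: real)" using True by (simp add: abs_le_iff indicator_def)
    ultimately show ?thesis by linarith
  next
    case False
    have "\<bar>u\<bar> powr 1 \<le> \<bar>u\<bar> powr \<alpha>" using False al by (intro powr_mono) auto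
    then have "a * \<bar>u\<bar> \<le> a * \<bar>u\<bar> powr \<alpha>" using a False by simp
    then have "exp (- (a * \<bar>u\<bar> powr \<alpha>)) \<le> exp (- (a * \<bar>u\<bar>))" by simp
    also have "\<dots> \<le> 2 / (a * \<bar>u\<bar>)\<^sup>2" by (rule exp_minus_le_square) (use a False in auto)
    also have "\<dots> = 2 / a\<^sup>2 * \<bar>u\<bar> powr (- 2)"
      using False by (simp add: powr_minus power_mult_distrib field_simps)
    also have "\<bar>u\<bar> powr (- 2) = indicator {1..} u * u powr (- 2) + indicator {1..} (- u) * (- u) powr (- 2)"
      using False by (cases "u \<ge> 0") auto
    finally have "exp (- (a * \<bar>u\<bar> powr \<alpha>)) \<le> 2 / a\<^sup>2 * (indicator {1..} u * u powr (- 2) + indicator {1..} (- u) * (- u) powr (- 2))" .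
    moreover have "0 \<le> (indicator {- 1..1} u :: real)" by simp
    ultimately show ?thesis by linarith
  qed
  then show "AE u in lborel. norm (exp (- (a * \<bar>u\<bar> powr \<alpha>))) \<le> norm (indicator {- 1..1} u
      + 2 / a\<^sup>2 * (indicator {1..} u * u powr (- 2) + indicator {1..} (- u) * (- u) powr (- 2)))"
    by (intro AE_I2) (auto intro: order_trans[OF _ abs_ge_self])
qed simp

lemma integral_powr_exp_powr:
  fixes c :: complex and \<alpha> :: real
  assumes c: "Re c > 0" and al1: "\<alpha> \<ge> 1"
    and int: "integrable lborel (\<lambda>u. indicator {0<..} u *\<^sub>R (of_real (u powr (\<alpha> - 1)) * exp (- (c * of_real (u powr \<alpha>)))))"
  shows "(\<integral>u. indicator {0<..} u *\<^sub>R (of_real (u powr (\<alpha> - 1)) * exp (- (c * of_real (u powr \<alpha>)))) \<partial>lborel) = 1 / (of_real \<alpha> * c)"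
proof -
  let ?F = "\<lambda>u. - exp (- (c * of_real (u powr \<alpha>))) / (of_real \<alpha> * c)"
  have al: "\<alpha> > 0" using al1 by simp
  have pt: "filterlim (\<lambda>u::real. u powr \<alpha>) at_top at_top"
  proof (rule filterlim_at_top_mono[OF filterlim_ident])
    show "\<forall>\<^sub>F u in at_top. u \<le> u powr \<alpha>"
      using eventually_ge_at_top[of "1::real"]
      by eventually_elim (use powr_mono[OF al1] in force)
  qed
  have c0: "c \<noteq> 0" using c by auto
  have ei: "einterval 0 \<infinity> = {0<..}" by (auto simp: einterval_def zero_ereal_def)
  have "(LBINT u=0..\<infinity>. of_real (u powr (\<alpha> - 1)) * exp (- (c * of_real (u powr \<alpha>)))) = 0 - (- 1 / (of_real \<alpha> * c))"
  proof (rule interval_integral_FTC_integrable)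
    fix u assume "0 < ereal u"
    then have u: "u > 0" by (simp add: zero_ereal_def)
    have d: "((\<lambda>u. u powr \<alpha>) has_real_derivative \<alpha> * u powr (\<alpha> - 1)) (at u)"
      using u by (auto intro!: derivative_eq_intros)
    have "((\<lambda>u. complex_of_real (u powr \<alpha>)) has_vector_derivative of_real (\<alpha> * u powr (\<alpha> - 1))) (at u)"
      using d by (intro has_vector_derivative_of_real)
    moreover have "((\<lambda>z. - exp (- (c * z)) / (of_real \<alpha> * c)) has_field_derivative exp (- (c * z)) / of_real \<alpha>) (at z)" for z
      using c0 al by (auto intro!: derivative_eq_intros)
    ultimately have "(((\<lambda>z. - exp (- (c * z)) / (of_real \<alpha> * c)) \<circ> (\<lambda>u. complex_of_real (u powr \<alpha>))) has_vector_derivative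
        (of_real (\<alpha> * u powr (\<alpha> - 1)) * (exp (- (c * of_real (u powr \<alpha>))) / of_real \<alpha>))) (at u)"
      by (rule field_vector_diff_chain_at)
    then show "(?F has_vector_derivative of_real (u powr (\<alpha> - 1)) * exp (- (c * of_real (u powr \<alpha>)))) (at u)"
      using al by (simp add: o_def)
    show "isCont (\<lambda>u. of_real (u powr (\<alpha> - 1)) * exp (- (c * of_real (u powr \<alpha>)))) u"
      using u by (intro continuous_intros) auto
  next
    show "set_integrable lborel (einterval 0 \<infinity>) (\<lambda>u. of_real (u powr (\<alpha> - 1)) * exp (- (c * of_real (u powr \<alpha>))))"
      unfolding set_integrable_def ei by (rule int)
    have p0: "((\<lambda>u. u powr \<alpha>) \<longlongrightarrow> 0 powr \<alpha>) (at_right (0::real))"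
      by (rule tendsto_powr2) (use al in \<open>auto simp: eventually_at_filter intro: tendsto_ident_at\<close>)
    have "(?F \<longlongrightarrow> - exp (- (c * of_real (0 powr \<alpha>))) / (of_real \<alpha> * c)) (at_right 0)"
      by (intro tendsto_intros p0) (use c0 al in auto)
    then have "(?F \<longlongrightarrow> - 1 / (of_real \<alpha> * c)) (at_right 0)" by simp
    then show "((?F \<circ> real_of_ereal) \<longlongrightarrow> - 1 / (of_real \<alpha> * c)) (at_right 0)"
      by (simp add: ereal_tendsto_simps zero_ereal_def del: ereal_eq_0)
    have e0: "((\<lambda>u. exp (- (Re c * u powr \<alpha>))) \<longlongrightarrow> 0) at_top"
    proof -
      have "filterlim (\<lambda>u. Re c * u powr \<alpha>) at_top at_top"
        by (rule filterlim_tendsto_pos_mult_at_top[OF tendsto_const c pt])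
      then show ?thesis
        by (intro filterlim_compose[OF exp_at_bot]) (simp add: filterlim_uminus_at_bot)
    qed
    have "(?F \<longlongrightarrow> 0) at_top"
    proof (rule Lim_null_comparison)
      show "\<forall>\<^sub>F u in at_top. norm (?F u) \<le> exp (- (Re c * u powr \<alpha>)) / norm (of_real \<alpha> * c)"
        by (intro always_eventually allI) (simp add: norm_divide)
      show "((\<lambda>u. exp (- (Re c * u powr \<alpha>)) / norm (of_real \<alpha> * c)) \<longlongrightarrow> 0) at_top"
        by (rule tendsto_divide_zero[OF e0])
    qed
    then show "((?F \<circ> real_of_ereal) \<longlongrightarrow> 0) (at_left \<infinity>)"
      by (simp add: ereal_tendsto_simps)
  qed simp
  then show ?thesis by (simp add: interval_lebesgue_integral_def set_lebesgue_integral_def ei)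
qed

text \<open>The value at \<open>0\<close> of the stable density is positive: inserting
  \<open>1 = u powr (\<alpha> - 1) * (u powr \<alpha>) powr (- \<beta>)\<close> with \<open>\<beta> = 1 - 1 / \<alpha>\<close>, and the Laplace representation of
  the second factor, turns the integral into that of \<open>v powr (\<beta> - 1) / (\<alpha> * (c + v))\<close>.\<close>

lemma Re_integral_exp_powr_pos:
  fixes c :: complex and \<alpha> :: real
  assumes c: "Re c > 0" and al: "\<alpha> > 1"
  shows "0 < Re (\<integral>u. indicator {0<..} u *\<^sub>R exp (- (c * of_real (u powr \<alpha>))) \<partial>lborel)"
proof -
  define \<beta> where "\<beta> = 1 - 1 / \<alpha>"
  have b: "\<beta> > 0" using al by (simp add: \<beta>_def)
  have ab: "\<alpha> * \<beta> = \<alpha> - 1" using al by (simp add: \<beta>_def field_simps)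
  \<comment> \<open>Integrating out \<open>v\<close> returns the original integrand times
    \<open>Gamma \<beta>\<close>; integrating out \<open>u\<close> gives the elementary function
    \<open>m\<close>, whose real part is visibly nonnegative.\<close>
  define F where "F = (\<lambda>(u, v). indicator {0<..} u *\<^sub>R (of_real (u powr (\<alpha> - 1)) * exp (- (c * of_real (u powr \<alpha>)))
      * of_real (indicator {0<..} v * (v powr (\<beta> - 1) * exp (- (v * u powr \<alpha>))))))"
  have meas: "F \<in> borel_measurable (lborel \<Otimes>\<^sub>M lborel)"
    unfolding F_def case_prod_beta by measurable
  have uu: "u powr (\<alpha> - 1) * (u powr \<alpha>) powr (- \<beta>) = 1" if "u > 0" for u :: real
    using that by (simp add: powr_powr ab powr_minus_divide)
  have intv: "integrable lborel (\<lambda>v. F (u, v))" for u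
    unfolding F_def prod.case
  proof (rule integrable_scaleR_right)
    assume "indicator {0<..} u \<noteq> (0 :: real)"
    then have "u powr \<alpha> > 0" by (auto split: split_indicator_asm)
    from Gamma_integral_scaled(1)[OF b this]
    show "integrable lborel (\<lambda>v. of_real (u powr (\<alpha> - 1)) * exp (- (c * of_real (u powr \<alpha>)))
        * complex_of_real (indicator {0<..} v * (v powr (\<beta> - 1) * exp (- (v * u powr \<alpha>)))))"
      by (intro integrable_mult_right integrable_of_real)
  qed
  have valv: "(\<integral>v. F (u, v) \<partial>lborel) = of_real (Gamma \<beta>) * (indicator {0<..} u *\<^sub>R exp (- (c * of_real (u powr \<alpha>))))" for u
  proof (cases "u > 0")
    case True
    have "(\<integral>v. F (u, v) \<partial>lborel) = of_real (u powr (\<alpha> - 1)) * exp (- (c * of_real (u powr \<alpha>))) * of_real (Gamma \<beta> * (u powr \<alpha>) powr (- \<beta>))"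
    proof -
      have up: "u powr \<alpha> > 0" using True by simp
      have "F (u, v) = of_real (u powr (\<alpha> - 1)) * exp (- (c * of_real (u powr \<alpha>)))
          * of_real (indicator {0<..} v * (v powr (\<beta> - 1) * exp (- (v * u powr \<alpha>))))" for v
        using True by (simp add: F_def)
      then show ?thesis
        by (simp only: integral_mult_right_zero integral_complex_of_real Gamma_integral_scaled(2)[OF b up])
    qed
    also have "\<dots> = of_real (Gamma \<beta>) * exp (- (c * of_real (u powr \<alpha>))) * of_real (u powr (\<alpha> - 1) * (u powr \<alpha>) powr (- \<beta>))"
      by (simp add: mult_ac)
    finally show ?thesis using True uu[OF True] by simp
  qed (simp add: F_def)
  have nF: "norm (F (u, v)) = indicator {0<..} u * (u powr (\<alpha> - 1) * exp (- (Re c * u powr \<alpha>))) *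
      (indicator {0<..} v * (v powr (\<beta> - 1) * exp (- (v * u powr \<alpha>))))" for u v
    by (simp add: F_def norm_mult split: split_indicator)
  have nv: "(\<integral>v. norm (F (u, v)) \<partial>lborel) = Gamma \<beta> * (indicator {0<..} u * exp (- (Re c * \<bar>u\<bar> powr \<alpha>)))" for u
  proof (cases "u > 0")
    case True
    have "(\<integral>v. norm (F (u, v)) \<partial>lborel) = (u powr (\<alpha> - 1) * exp (- (Re c * u powr \<alpha>))) * (Gamma \<beta> * (u powr \<alpha>) powr (- \<beta>))"
      unfolding nF using True by (simp only: integral_mult_right_zero) (simp add: Gamma_integral_scaled(2)[OF b])
    also have "\<dots> = Gamma \<beta> * exp (- (Re c * u powr \<alpha>)) * (u powr (\<alpha> - 1) * (u powr \<alpha>) powr (- \<beta>))"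
      by (simp only: mult_ac)
    finally show ?thesis using True uu[OF True] by simp
  qed (simp add: F_def)
  have intE: "integrable lborel (\<lambda>u. indicator {0<..} u * exp (- (Re c * \<bar>u\<bar> powr \<alpha>)))"
    by (rule Bochner_Integration.integrable_bound[OF integrable_exp_powr[of "Re c" \<alpha>]]) (use c al in \<open>auto split: split_indicator\<close>)
  have int: "integrable (lborel \<Otimes>\<^sub>M lborel) F"
    by (rule lborel_pair.Fubini_integrable[OF meas]) (use nv intE intv in \<open>auto intro: integrable_mult_right\<close>)
  have intsw: "integrable (lborel \<Otimes>\<^sub>M lborel) (\<lambda>(u, v). F (u, v))" using int by simp
  define m where "m v = of_real (indicator {0<..} v * v powr (\<beta> - 1)) / (of_real \<alpha> * (c + of_real v))" for v :: real
  have swap: "(\<integral>v. (\<integral>u. F (u, v) \<partial>lborel) \<partial>lborel) = (\<integral>u. (\<integral>v. F (u, v) \<partial>lborel) \<partial>lborel)"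
    by (rule lborel_pair.Fubini_integral[OF intsw])
  \<comment> \<open>Fubini supplies the integrability in \<open>u\<close> that
    \<open>integral_powr_exp_powr\<close> asks for, but only for almost every
    \<open>v\<close>.\<close>
  have AEm: "AE v in lborel. (\<integral>u. F (u, v) \<partial>lborel) = m v"
    using lborel_pair.AE_integrable_snd[OF intsw]
  proof eventually_elim
    case (elim v)
    show ?case
    proof (cases "v > 0")
      case True
      have Fv: "F (u, v) = of_real (v powr (\<beta> - 1)) * (indicator {0<..} u *\<^sub>R (of_real (u powr (\<alpha> - 1)) * exp (- ((c + of_real v) * of_real (u powr \<alpha>)))))" for u
      proof -
        have e1: "complex_of_real (exp (- (v * u powr \<alpha>))) = exp (- (of_real v * of_real (u powr \<alpha>)))"
          by (simp flip: exp_of_real)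
        have "- ((c + of_real v) * of_real (u powr \<alpha>)) = - (c * of_real (u powr \<alpha>)) + - (of_real v * of_real (u powr \<alpha>))"
          by (simp add: algebra_simps)
        then have e2: "exp (- ((c + of_real v) * of_real (u powr \<alpha>)))
            = exp (- (c * of_real (u powr \<alpha>))) * exp (- (of_real v * of_real (u powr \<alpha>)))"
          by (simp only: exp_add)
        show ?thesis unfolding e2 using True by (simp add: F_def e1[symmetric])
      qed
      have vp: "complex_of_real (v powr (\<beta> - 1)) \<noteq> 0" using True by simp
      have "integrable lborel (\<lambda>u. indicator {0<..} u *\<^sub>R (of_real (u powr (\<alpha> - 1)) * exp (- ((c + of_real v) * of_real (u powr \<alpha>)))))"
      proof -
        have cancel: "inverse (complex_of_real (v powr (\<beta> - 1))) * (of_real (v powr (\<beta> - 1)) * x) = x" for x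
          using vp by simp
        from integrable_mult_right[OF elim, of "inverse (complex_of_real (v powr (\<beta> - 1)))"] show ?thesis
          unfolding Fv cancel .
      qed
      from integral_powr_exp_powr[OF _ _ this]
      have "(\<integral>u. indicator {0<..} u *\<^sub>R (of_real (u powr (\<alpha> - 1)) * exp (- ((c + of_real v) * of_real (u powr \<alpha>)))) \<partial>lborel)
          = 1 / (of_real \<alpha> * (c + of_real v))" using c True al by simp
      then show ?thesis unfolding Fv integral_mult_right_zero using True by (simp add: m_def)
    qed (simp add: F_def m_def)
  qed
  have meas_m: "m \<in> borel_measurable borel" unfolding m_def[abs_def] by measurable
  have im: "integrable lborel m"
    by (rule integrable_cong_AE_imp[OF lborel_pair.integrable_snd[OF intsw]]) (use AEm meas_m in auto)
  have eq: "(\<integral>v. m v \<partial>lborel) = of_real (Gamma \<beta>) * (\<integral>u. indicator {0<..} u *\<^sub>R exp (- (c * of_real (u powr \<alpha>))) \<partial>lborel)"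
  proof -
    have "(\<integral>v. m v \<partial>lborel) = (\<integral>v. (\<integral>u. F (u, v) \<partial>lborel) \<partial>lborel)"
      by (rule integral_cong_AE) (use AEm meas_m borel_measurable_integrable[OF lborel_pair.integrable_snd[OF intsw]] in auto)
    then show ?thesis unfolding swap valv by (simp only: integral_mult_right_zero)
  qed
  \<comment> \<open>A lower bound for the real part of \<open>m\<close> on \<open>[1, 2]\<close>:
    there \<open>Re c + v \<ge> 1\<close>, the modulus of \<open>c + v\<close> is at most
    \<open>norm c + 2\<close>, and the decreasing power is smallest at 2.\<close>
  define \<kappa> where "\<kappa> = 2 powr (\<beta> - 1) * (1 / (\<alpha> * (norm c + 2)\<^sup>2))"
  have nc: "0 < norm c + 2" by (rule add_nonneg_pos) auto
  have k: "\<kappa> > 0" unfolding \<kappa>_def using al nc by (intro mult_pos_pos divide_pos_pos zero_less_power) auto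
  have "\<kappa> * (\<integral>v. indicator {1..2::real} v \<partial>lborel) = (\<integral>v. \<kappa> * indicator {1..2::real} v \<partial>lborel)" by simp
  also have "\<dots> \<le> (\<integral>v. Re (m v) \<partial>lborel)"
  proof (rule integral_mono)
    show "integrable lborel (\<lambda>v. \<kappa> * indicator {1..2::real} v)"
      by (intro integrable_mult_right, rule integrable_real_indicator) (use emeasure_compact_finite[OF compact_Icc] in auto)
    show "integrable lborel (\<lambda>v. Re (m v))" using im by (rule integrable_Re)
    fix v :: real
    have Rem: "Re (m v) = indicator {0<..} v * v powr (\<beta> - 1) * ((Re c + v) / (\<alpha> * (norm (c + of_real v))\<^sup>2))" if "v > 0"
    proof -
      have "Re (1 / (of_real \<alpha> * (c + of_real v))) = (Re c + v) / (\<alpha> * (norm (c + of_real v))\<^sup>2)"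
      proof -
        have "1 / (of_real \<alpha> * (c + of_real v)) = (1 / (c + of_real v)) / of_real \<alpha>" by simp
        then have "Re (1 / (of_real \<alpha> * (c + of_real v))) = Re (1 / (c + of_real v)) / \<alpha>" by (simp only: Re_divide_of_real)
        also have "Re (1 / (c + of_real v)) = (Re c + v) / (norm (c + of_real v))\<^sup>2"
          by (simp add: Re_divide cmod_power2)
        finally show ?thesis by simp
      qed
      moreover have "m v = of_real (indicator {0<..} v * v powr (\<beta> - 1)) * (1 / (of_real \<alpha> * (c + of_real v)))"
        by (simp add: m_def)
      ultimately show ?thesis
        by (simp only: Re_complex_of_real Im_complex_of_real times_complex.simps mult_zero_left diff_zero)
    qed
    show "\<kappa> * indicator {1..2} v \<le> Re (m v)"
    proof (cases "v \<in> {1..2}")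
      case True
      then have v: "1 \<le> v" "v \<le> 2" by auto
      have "2 powr (\<beta> - 1) \<le> v powr (\<beta> - 1)" using v al by (intro powr_mono2') (auto simp: \<beta>_def)
      moreover have "1 / (\<alpha> * (norm c + 2)\<^sup>2) \<le> (Re c + v) / (\<alpha> * (norm (c + of_real v))\<^sup>2)"
      proof (rule frac_le)
        have n: "norm (c + of_real v) \<le> norm c + 2" using norm_triangle_ineq[of c "of_real v"] v by simp
        then show "\<alpha> * (norm (c + of_real v))\<^sup>2 \<le> \<alpha> * (norm c + 2)\<^sup>2" using al by (intro mult_left_mono power_mono) auto
        have "c + of_real v \<noteq> 0" using c v by (auto simp: complex_eq_iff)
        then show "0 < \<alpha> * (norm (c + of_real v))\<^sup>2" using al by simp
      qed (use c v in auto)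
      ultimately have "\<kappa> \<le> v powr (\<beta> - 1) * ((Re c + v) / (\<alpha> * (norm (c + of_real v))\<^sup>2))"
        unfolding \<kappa>_def using al by (intro mult_mono) auto
      then show ?thesis using True v Rem by simp
    next
      case False
      show ?thesis
      proof (cases "v > 0")
        case True
        then show ?thesis using False Rem c al by (simp add: divide_nonneg_nonneg)
      qed (use False in \<open>simp add: m_def\<close>)
    qed
  qed
  also have "\<dots> = Re (\<integral>v. m v \<partial>lborel)" by (rule integral_Re[OF im])
  also have "\<dots> = Gamma \<beta> * Re (\<integral>u. indicator {0<..} u *\<^sub>R exp (- (c * of_real (u powr \<alpha>))) \<partial>lborel)"
    unfolding eq by (simp only: Re_complex_of_real Im_complex_of_real times_complex.simps mult_zero_left diff_zero)
  finally have "0 < Gamma \<beta> * Re (\<integral>u. indicator {0<..} u *\<^sub>R exp (- (c * of_real (u powr \<alpha>))) \<partial>lborel)"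
    using k by simp
  then show ?thesis using Gamma_real_pos[OF b] by (simp add: zero_less_mult_iff)
qed

context stable_blocks
begin

text \<open>The integral over the negative half-line is the conjugate of the one over the positive
  half-line, so the real part is twice that of the half-line integral.\<close>

lemma Re_I0_pos: "Re I0 > 0"
proof -
  let ?E = "\<lambda>u. indicator {0<..} u *\<^sub>R exp (- (C * of_real (u powr \<alpha>)))"
  have iE: "integrable lborel ?E"
    by (rule Bochner_Integration.integrable_bound[OF integrable_exp_powr[of "Re C" \<alpha>]])
       (use Re_C_pos alpha in \<open>auto split: split_indicator\<close>)
  have iE': "integrable lborel (\<lambda>u. ?E (- u))"
    using lborel_integrable_real_affine[OF iE, of "- 1" 0] by simp
  have vE': "(\<integral>u. ?E (- u) \<partial>lborel) = integral\<^sup>L lborel ?E"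
    using lborel_integral_real_affine[of "- 1" ?E 0] by simp
  have ic: "integrable lborel (\<lambda>u. cnj (?E (- u)))" using iE' by (rule integrable_cnj)
  have "Re I0 = Re (\<integral>u. ?E u + cnj (?E (- u)) \<partial>lborel)"
    unfolding I0_def
  proof (rule arg_cong[where f = Re], rule integral_cong_AE)
    show "AE u in lborel. exp (- psi u) = ?E u + cnj (?E (- u))"
      using AE_lborel_singleton[of 0]
      by eventually_elim (auto simp: psi_def exp_cnj split: split_indicator)
    show "(\<lambda>u. ?E u + cnj (?E (- u))) \<in> borel_measurable lborel"
      by (rule borel_measurable_integrable[OF Bochner_Integration.integrable_add[OF iE ic]])
  qed (auto simp: psi_def[abs_def])
  also have "\<dots> = Re (integral\<^sup>L lborel ?E) + Re (cnj (integral\<^sup>L lborel (\<lambda>u. ?E (- u))))"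
  proof -
    have "(\<integral>u. ?E u + cnj (?E (- u)) \<partial>lborel) = integral\<^sup>L lborel ?E + (\<integral>u. cnj (?E (- u)) \<partial>lborel)"
      by (rule Bochner_Integration.integral_add[OF iE ic])
    then show ?thesis by (simp only: Bochner_Integration.integral_cnj plus_complex.simps)
  qed
  also have "\<dots> = 2 * Re (integral\<^sup>L lborel ?E)" unfolding vE' by simp
  finally show ?thesis using Re_integral_exp_powr_pos[OF Re_C_pos alpha(1)] by simp
qed

end

section \<open>Conditioned trees\<close>

lemma cond_pmf_expectation:
  fixes f :: "'a \<Rightarrow> 'b::{banach, second_countable_topology}"
  assumes pos: "measure_pmf.prob p S > 0" and int: "integrable (measure_pmf p) f"
  shows "integrable (measure_pmf (cond_pmf p S)) f"
    and "measure_pmf.expectation (cond_pmf p S) f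
      = measure_pmf.expectation p (\<lambda>x. indicator S x *\<^sub>R f x) /\<^sub>R measure_pmf.prob p S"
proof -
  have ne: "set_pmf p \<inter> S \<noteq> {}"
    using pos measure_Int_set_pmf[of p S] by (auto simp: inf_commute[of S])
  let ?d = "\<lambda>x. indicator S x / measure_pmf.prob p S"
  have eq: "measure_pmf (cond_pmf p S) = density (measure_pmf p) (\<lambda>x. ennreal (?d x))"
    unfolding cond_pmf.rep_eq[OF ne] uniform_measure_def
    by (intro density_cong AE_I2)
       (use pos in \<open>auto simp: measure_pmf.emeasure_eq_measure divide_ennreal ennreal_1[symmetric] simp del: ennreal_1 split: split_indicator\<close>)
  have iS: "integrable (measure_pmf p) (\<lambda>x. indicator S x *\<^sub>R f x)"
    by (rule Bochner_Integration.integrable_bound[OF int]) (auto split: split_indicator)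
  have d: "?d x *\<^sub>R f x = (indicator S x *\<^sub>R f x) /\<^sub>R measure_pmf.prob p S" for x
    by (simp add: field_simps)
  show "integrable (measure_pmf (cond_pmf p S)) f"
    unfolding eq using pos iS by (subst integrable_density) (auto simp only: d integrable_scaleR_right borel_measurable_integrable, auto)
  show "measure_pmf.expectation (cond_pmf p S) f = measure_pmf.expectation p (\<lambda>x. indicator S x *\<^sub>R f x) /\<^sub>R measure_pmf.prob p S"
    unfolding eq using pos by (subst integral_density) (auto simp only: d integral_scaleR_right, auto)
qed

lemma NC_total: "real (NC S t) = total (indicator S) (code t)"
proof -
  have "real (length (filter (\<lambda>k. k \<in> S) v)) = total (indicator S) v" for v
    by (induction v) (auto split: split_indicator)
  then show ?thesis by (simp add: NC_code)
qed

context stable_blocks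
begin

text \<open>Additive functionals depend on the multiset of letters only, which is what
  \<open>gw_cond_blocks\<close> transports between trees and blocks.\<close>

lemma prob_walk: "measure_pmf.prob (blocks n) {v. walk v = - 1} > 0"
  and expectation_gw_cond: "\<And>F :: real \<Rightarrow> 'b::{banach, second_countable_topology}.
    measure_pmf.expectation (gw_cond \<mu> B n) (\<lambda>t. F (total g (code t)))
      = measure_pmf.expectation (cond_pmf (blocks n) {v. walk v = - 1}) (\<lambda>v. F (total g v))"
  if n: "n \<in> admissible \<mu> B"
proof -
  show "measure_pmf.prob (blocks n) {v. walk v = - 1} > 0"
    by (rule gw_cond_blocks(1)[OF n crit inf_var])
  fix F :: "real \<Rightarrow> 'b"
  define G where "G M = F (\<Sum>k\<in>#M. g k)" for M
  have G: "F (total g v) = G (mset v)" for v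
    by (simp add: G_def total_def sum_mset_sum_list flip: mset_map)
  have "measure_pmf.expectation (map_pmf (\<lambda>t. mset (code t)) (gw_cond \<mu> B n)) G
      = measure_pmf.expectation (map_pmf mset (cond_pmf (blocks n) {v. walk v = - 1})) G"
    unfolding gw_cond_blocks(2)[OF n crit inf_var] ..
  then show "measure_pmf.expectation (gw_cond \<mu> B n) (\<lambda>t. F (total g (code t)))
      = measure_pmf.expectation (cond_pmf (blocks n) {v. walk v = - 1}) (\<lambda>v. F (total g v))"
    by (simp add: G)
qed

lemma eventually_admissible:
  "\<forall>\<^sub>F n in along_admissible \<mu> B. n \<in> admissible \<mu> B \<and> n > 0 \<and> th n > 0"
  unfolding along_admissible_def eventually_inf_principal
  using th_pos eventually_gt_at_top[of 0] by eventually_elim auto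

lemma tendsto_along_admissible: "X \<longlonglongrightarrow> l \<Longrightarrow> (X \<longlongrightarrow> l) (along_admissible \<mu> B)"
  unfolding along_admissible_def by (rule tendsto_mono[OF inf_le1])

lemma bmean_0 [simp]: "bmean (\<lambda>_. 0) = 0" and bvar_0 [simp]: "bvar (\<lambda>_. 0) = 0"
  by (simp_all add: bmean_def bvar_def total_const)

text \<open>For \<open>g = 0\<close> the character of the count is 1, and the inversion formula
  computes the probability of the conditioning event.\<close>

lemma prob_walk_eq:
  assumes "n \<in> admissible \<mu> B" "n > 0" "th n > 0"
  shows "complex_of_real (measure_pmf.prob (blocks n) {v. walk v = - 1}) = of_real (th n / P) * J (\<lambda>_. 0) n"
proof -
  have "measure_pmf.expectation (blocks n) (\<lambda>v. iexp ((total (\<lambda>_. 0) v - real n * bmean (\<lambda>_. 0)) / sqrt (real n)) * indicator {v. walk v = - 1} v)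
      = of_real (th n / P) * J (\<lambda>_. 0) n"
    by (rule inversion) (use prob_walk assms in auto)
  moreover have "measure_pmf.expectation (blocks n) (\<lambda>v. iexp ((total (\<lambda>_. 0) v - real n * bmean (\<lambda>_. 0)) / sqrt (real n)) * indicator {v. walk v = - 1} v)
      = measure_pmf.expectation (blocks n) (\<lambda>v. complex_of_real (indicator {v. walk v = - 1} v))"
    by (intro Bochner_Integration.integral_cong refl) (simp add: total_const split: split_indicator)
  ultimately show ?thesis by simp
qed

text \<open>The conditional characteristic function is the quotient of two inversion formulas. The
  prefactor \<open>th n / P\<close> cancels, and so does \<open>I0\<close> in the limit.\<close>

theorem clt_along_admissible:
  assumes g: "\<And>k. \<bar>g k\<bar> \<le> c"
  shows "((\<lambda>n. measure_pmf.expectation (gw_cond \<mu> B n)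
      (\<lambda>t. iexp ((total g (code t) - real n * bmean g) / sqrt (real n)))) \<longlongrightarrow> of_real (exp (- bvar g / 2))) (along_admissible \<mu> B)"
proof -
  have I: "I0 \<noteq> 0" using Re_I0_pos by auto
  have J0: "J (\<lambda>_. 0) \<longlonglongrightarrow> I0" using J_tendsto[of "\<lambda>_. 0" 0] by simp
  have "(\<lambda>n. J g n / J (\<lambda>_. 0) n) \<longlonglongrightarrow> exp (- of_real (bvar g / 2)) * I0 / I0"
    by (intro tendsto_divide J_tendsto[OF g] J0 I)
  moreover have "exp (- of_real (bvar g / 2)) * I0 / I0 = of_real (exp (- bvar g / 2))"
    using I by (simp flip: exp_of_real)
  ultimately have "((\<lambda>n. J g n / J (\<lambda>_. 0) n) \<longlongrightarrow> of_real (exp (- bvar g / 2))) (along_admissible \<mu> B)"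
    by (intro tendsto_along_admissible) simp
  then show ?thesis
  proof (rule Lim_transform_eventually)
    show "\<forall>\<^sub>F n in along_admissible \<mu> B. J g n / J (\<lambda>_. 0) n = measure_pmf.expectation (gw_cond \<mu> B n)
      (\<lambda>t. iexp ((total g (code t) - real n * bmean g) / sqrt (real n)))"
      using eventually_admissible
    proof eventually_elim
      case (elim n)
      let ?p = "measure_pmf.prob (blocks n) {v. walk v = - 1}"
      let ?f = "\<lambda>v. iexp ((total g v - real n * bmean g) / sqrt (real n))"
      have p: "?p > 0" using prob_walk elim by blast
      have i: "integrable (measure_pmf (blocks n)) ?f" by (rule integrable_pmf_bounded[where C = 1]) simp
      have "measure_pmf.expectation (gw_cond \<mu> B n) (\<lambda>t. iexp ((total g (code t) - real n * bmean g) / sqrt (real n)))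
          = measure_pmf.expectation (cond_pmf (blocks n) {v. walk v = - 1}) ?f"
        using elim by (intro expectation_gw_cond) auto
      also have "\<dots> = measure_pmf.expectation (blocks n) (\<lambda>v. indicator {v. walk v = - 1} v *\<^sub>R ?f v) /\<^sub>R ?p"
        by (rule cond_pmf_expectation(2)[OF p i])
      also have "measure_pmf.expectation (blocks n) (\<lambda>v. indicator {v. walk v = - 1} v *\<^sub>R ?f v)
          = measure_pmf.expectation (blocks n) (\<lambda>v. ?f v * indicator {v. walk v = - 1} v)"
        by (intro Bochner_Integration.integral_cong refl) (simp split: split_indicator)
      also have "\<dots> = of_real (th n / P) * J g n"
        by (rule inversion[OF p]) (use elim in auto)
      also have "(of_real (th n / P) * J g n) /\<^sub>R ?p = (of_real (th n / P) * J g n) / complex_of_real ?p"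
        by (simp add: scaleR_conv_of_real divide_inverse mult.commute)
      also have "\<dots> = (of_real (th n / P) * J g n) / (of_real (th n / P) * J (\<lambda>_. 0) n)"
        using prob_walk_eq[of n] elim by simp
      also have "\<dots> = J g n / J (\<lambda>_. 0) n"
      proof -
        have "complex_of_real (th n / P) \<noteq> 0" using elim P_pos by simp
        then show ?thesis by (rule mult_divide_mult_cancel_left)
      qed
      finally show ?case ..
    qed
  qed
qed

text \<open>The conditional second moment of the centred average is at most the unconditional one,
  \<open>bvar g / n\<close>, divided by the probability of the conditioning. That probability is of
  order \<open>th n\<close>, so the bound is of order \<open>1 / (n * th n)\<close> and
  vanishes.\<close>

theorem lln_along_admissible:
  assumes g: "\<And>k. \<bar>g k\<bar> \<le> c"
  shows "((\<lambda>n. measure_pmf.expectation (gw_cond \<mu> B n) (\<lambda>t. total g (code t)) / real n) \<longlongrightarrow> bmean g) (along_admissible \<mu> B)"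
proof -
  have I: "I0 \<noteq> 0" using Re_I0_pos by auto
  have J0: "J (\<lambda>_. 0) \<longlonglongrightarrow> I0" using J_tendsto[of "\<lambda>_. 0" 0] by simp
  have "(\<lambda>n. (1 / (real n * th n)) * (bvar g * P / norm (J (\<lambda>_. 0) n))) \<longlonglongrightarrow> 0 * (bvar g * P / norm I0)"
    by (intro tendsto_mult n_th_at_top tendsto_divide tendsto_norm J0 tendsto_const) (use I in simp)
  then have "(\<lambda>n. sqrt ((1 / (real n * th n)) * (bvar g * P / norm (J (\<lambda>_. 0) n)))) \<longlonglongrightarrow> sqrt 0"
    by (intro tendsto_real_sqrt) simp
  then have lim: "((\<lambda>n. sqrt ((1 / (real n * th n)) * (bvar g * P / norm (J (\<lambda>_. 0) n)))) \<longlongrightarrow> 0) (along_admissible \<mu> B)"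
    by (intro tendsto_along_admissible) simp
  have "((\<lambda>n. measure_pmf.expectation (gw_cond \<mu> B n) (\<lambda>t. total g (code t)) / real n - bmean g) \<longlongrightarrow> 0) (along_admissible \<mu> B)"
  proof (rule Lim_null_comparison[OF _ lim])
    show "\<forall>\<^sub>F n in along_admissible \<mu> B. norm (measure_pmf.expectation (gw_cond \<mu> B n) (\<lambda>t. total g (code t)) / real n - bmean g)
        \<le> sqrt ((1 / (real n * th n)) * (bvar g * P / norm (J (\<lambda>_. 0) n)))"
      using eventually_admissible
    proof eventually_elim
      case (elim n)
      let ?S = "{v. walk v = - 1}"
      let ?p = "measure_pmf.prob (blocks n) ?S" and ?c = "cond_pmf (blocks n) ?S"
      define x where "x v = (total g v - real n * bmean g) / real n" for v
      have p: "?p > 0" using prob_walk elim by blast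
      have i2: "integrable (blocks n) (\<lambda>v. (x v)\<^sup>2)"
        using blocks_moments[OF g, of n] unfolding x_def by (simp add: power_divide)
      have v2: "measure_pmf.expectation (blocks n) (\<lambda>v. (x v)\<^sup>2) = bvar g / real n"
        using blocks_moments[OF g, of n] elim unfolding x_def by (simp add: power_divide power2_eq_square)
      have i1: "integrable (blocks n) x" by (rule integrable_of_square_pmf[OF i2])
      note c2 = cond_pmf_expectation[OF p i2] and c1 = cond_pmf_expectation(1)[OF p i1]
      have "measure_pmf.expectation (gw_cond \<mu> B n) (\<lambda>t. total g (code t)) / real n - bmean g
          = measure_pmf.expectation ?c (\<lambda>v. total g v) / real n - bmean g"
        using expectation_gw_cond[of n "\<lambda>y. y" g] elim by simp
      also have "\<dots> = measure_pmf.expectation ?c x"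
      proof -
        have "total g v = real n * x v + real n * bmean g" for v using elim by (simp add: x_def)
        then have "measure_pmf.expectation ?c (\<lambda>v. total g v) = measure_pmf.expectation ?c (\<lambda>v. real n * x v + real n * bmean g)" by simp
        also have "\<dots> = real n * measure_pmf.expectation ?c x + real n * bmean g" using c1 by simp
        finally show ?thesis using elim by (simp add: add_divide_distrib)
      qed
      finally have e: "measure_pmf.expectation (gw_cond \<mu> B n) (\<lambda>t. total g (code t)) / real n - bmean g = measure_pmf.expectation ?c x" .
      have "(measure_pmf.expectation ?c x)\<^sup>2 \<le> measure_pmf.expectation ?c (\<lambda>v. (x v)\<^sup>2)"
        using measure_pmf.variance_eq[OF c1 c2(1)] measure_pmf.variance_positive[of ?c x] by simp
      also have "\<dots> \<le> (bvar g / real n) / ?p"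
      proof -
        have "measure_pmf.expectation (blocks n) (\<lambda>v. indicator ?S v *\<^sub>R (x v)\<^sup>2) \<le> measure_pmf.expectation (blocks n) (\<lambda>v. (x v)\<^sup>2)"
          by (rule integral_mono[OF _ i2])
             (auto intro!: Bochner_Integration.integrable_bound[OF i2] split: split_indicator)
        then show ?thesis unfolding c2(2) v2 using p by (simp add: divide_inverse mult.commute)
      qed
      also have "?p = th n / P * norm (J (\<lambda>_. 0) n)"
      proof -
        have "norm (complex_of_real ?p) = norm (of_real (th n / P) * J (\<lambda>_. 0) n)"
          using prob_walk_eq[of n] elim by simp
        then show ?thesis using elim P_pos by (simp add: norm_mult norm_divide)
      qed
      also have "(bvar g / real n) / (th n / P * norm (J (\<lambda>_. 0) n)) = (1 / (real n * th n)) * (bvar g * P / norm (J (\<lambda>_. 0) n))"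
        by simp
      finally show ?case unfolding e real_norm_def by (intro real_le_rsqrt) simp
    qed
  qed
  then show ?thesis by (simp add: LIM_zero_iff)
qed

section \<open>Degenerate limits\<close>

lemma set_block_singleton: "b \<in> B \<Longrightarrow> b \<in> set_pmf \<mu> \<Longrightarrow> [b] \<in> set_pmf block"
  by (subst block_unfold) (auto intro!: bexI[of _ b])

lemma set_block_Cons: "a \<notin> B \<Longrightarrow> a \<in> set_pmf \<mu> \<Longrightarrow> v \<in> set_pmf block \<Longrightarrow> a # v \<in> set_pmf block"
  by (subst block_unfold) (auto intro!: bexI[of _ a])

lemma set_blockD:
  assumes "v \<in> set_pmf block"
  shows "set v \<subseteq> set_pmf \<mu>" "total (indicator B) v = 1"
proof -
  have "blocks 1 = block" by (simp add: map_pmf_def[symmetric] bind_return_pmf')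
  then have "pmf (blocks 1) v \<noteq> 0" using assms by (simp add: set_pmf_iff)
  then have c: "length (filter (\<lambda>k. k \<in> B) v) = 1" "prod_list (map (pmf \<mu>) v) \<noteq> 0"
    unfolding pmf_blocks by (auto split: if_splits)
  show "set v \<subseteq> set_pmf \<mu>" using c(2) by (induction v) (auto simp: set_pmf_iff)
  have "real (length (filter (\<lambda>k. k \<in> B) u)) = total (indicator B) u" for u
    by (induction u) (auto split: split_indicator)
  then show "total (indicator B) v = 1" using c(1) by (metis of_nat_1)
qed

text \<open>Zero variance means that the count is the same for all blocks in the support, and blocks
  of one or two letters already decide this. Conversely a block never meets a null set and has
  exactly one letter in \<open>B\<close>.\<close>

lemma bvar_zero_iff:
  "bvar (indicator A) = 0 \<longleftrightarrow> measure_pmf.prob \<mu> A = 0 \<or>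
     (measure_pmf.prob \<mu> (A - B) = 0 \<and> measure_pmf.prob \<mu> (B - A) = 0)"
proof
  have gA: "\<bar>indicator A k :: real\<bar> \<le> 1" for k by (auto split: split_indicator)
  have i2: "integrable block (\<lambda>b. (total (indicator A) b - bmean (indicator A))\<^sup>2)"
    by (rule integrable_block_total_power[OF gA]) simp
  assume "bvar (indicator A) = 0"
  then have "AE b in block. (total (indicator A) b - bmean (indicator A))\<^sup>2 = 0"
    unfolding bvar_def by (subst (asm) integral_nonneg_eq_0_iff_AE[OF i2]) auto
  then have const: "total (indicator A) u = total (indicator A) v" if "u \<in> set_pmf block" "v \<in> set_pmf block" for u v
    using that by (auto simp: AE_measure_pmf_iff)
  obtain b where b: "b \<in> B" "b \<in> set_pmf \<mu>"
    using B_pos measure_Int_set_pmf[of \<mu> B] by (metis Int_emptyI inf_commute less_irrefl measure_empty)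
  have AB: "A \<inter> set_pmf \<mu> \<subseteq> B"
  proof (rule ccontr)
    assume "\<not> A \<inter> set_pmf \<mu> \<subseteq> B"
    then obtain a where "a \<in> A" "a \<in> set_pmf \<mu>" "a \<notin> B" by auto
    \<comment> \<open>A letter of \<open>A\<close> outside \<open>B\<close> can be put in front of a
      block, so \<open>[a, b]\<close> counts one more than \<open>[b]\<close>.\<close>
    then show False using const[OF set_block_Cons set_block_singleton, of a "[b]" b] set_block_singleton[OF b] b by simp
  qed
  have "A \<inter> set_pmf \<mu> = {} \<or> B \<inter> set_pmf \<mu> \<subseteq> A"
  proof (rule ccontr)
    assume "\<not> ?thesis"
    then obtain a b' where "a \<in> A" "a \<in> set_pmf \<mu>" "a \<in> B" "b' \<in> B" "b' \<in> set_pmf \<mu>" "b' \<notin> A" using AB by auto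
    \<comment> \<open>The one-letter blocks \<open>[a]\<close> and \<open>[b']\<close> have counts 1
      and 0.\<close>
    then show False using const[OF set_block_singleton set_block_singleton, of a b'] by simp
  qed
  then show "measure_pmf.prob \<mu> A = 0 \<or> (measure_pmf.prob \<mu> (A - B) = 0 \<and> measure_pmf.prob \<mu> (B - A) = 0)"
    unfolding measure_pmf_zero_iff using AB by auto
next
  have gA: "\<bar>indicator A k :: real\<bar> \<le> 1" for k by (auto split: split_indicator)
  assume h: "measure_pmf.prob \<mu> A = 0 \<or> (measure_pmf.prob \<mu> (A - B) = 0 \<and> measure_pmf.prob \<mu> (B - A) = 0)"
  have "\<exists>d. \<forall>v\<in>set_pmf block. total (indicator A) v = d"
  proof (cases "measure_pmf.prob \<mu> A = 0")
    case True
    have "total (indicator A) v = 0" if "set v \<subseteq> set_pmf \<mu>" for v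
      using that True unfolding measure_pmf_zero_iff by (induction v) (auto split: split_indicator)
    then show ?thesis using set_blockD(1) by blast
  next
    case False
    then have "k \<in> A \<longleftrightarrow> k \<in> B" if "k \<in> set_pmf \<mu>" for k using h that unfolding measure_pmf_zero_iff by auto
    then have "total (indicator A) v = total (indicator B) v" if "set v \<subseteq> set_pmf \<mu>" for v
      using that by (induction v) (auto split: split_indicator)
    then show ?thesis using set_blockD by metis
  qed
  then obtain d where d: "\<And>v. v \<in> set_pmf block \<Longrightarrow> total (indicator A) v = d" by blast
  have "measure_pmf.expectation block (total (indicator A)) = measure_pmf.expectation block (\<lambda>_. d)"
    by (rule integral_cong_AE) (use d in \<open>auto simp: AE_measure_pmf_iff\<close>)
  then have m: "bmean (indicator A) = d"
    using expectation_block_total[OF gA] by (simp add: bmean_def)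
  have "bvar (indicator A) = measure_pmf.expectation block (\<lambda>_. 0)"
    unfolding bvar_def by (rule integral_cong_AE) (use d m in \<open>auto simp: AE_measure_pmf_iff\<close>)
  then show "bvar (indicator A) = 0" by simp
qed

lemma bmean_indicator: "bmean (indicator A) = measure_pmf.prob \<mu> A / p_B"
  by (simp add: bmean_def)

end

section \<open>Convergence of the counts\<close>

context stable_blocks
begin

lemma prob_along_admissible_mean:
  "((\<lambda>n. measure_pmf.expectation (gw_cond \<mu> B n) (\<lambda>t. real (NC A t)) / real n)
    \<longlongrightarrow> measure_pmf.prob \<mu> A / p_B) (along_admissible \<mu> B)"
  using lln_along_admissible[of "indicator A" 1] by (simp add: NC_total bmean_indicator indicator_def)

text \<open>The frequency \<open>u\<close> is absorbed into the functional \<open>g\<close>, so the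
  limit theorem for characteristic functions is only invoked in the form with frequency 1.\<close>

lemma conv_distr_count:
  "conv_distr (along_admissible \<mu> B)
    (\<lambda>n. measure_pmf (map_pmf
       (\<lambda>t. (real (NC A t) - real n * measure_pmf.prob \<mu> A / p_B) / sqrt (real n)) (gw_cond \<mu> B n)))
    (gaussian 0 (sqrt (bvar (indicator A))))"
  unfolding along_admissible_def
proof (rule conv_distr_along)
  let ?s = "sqrt (bvar (indicator A))"
  have s: "0 \<le> ?s" using bvar_nonneg by simp
  have rd: "real_distribution (gaussian 0 ?s)" by (rule real_distribution_gaussian[OF s])
  then show "prob_space (gaussian 0 ?s)" "sets (gaussian 0 ?s) = sets borel"
    by (auto simp: real_distribution_def real_distribution_axioms_def)
  fix u :: real
  define g where "g = (\<lambda>k. u * indicator A k :: real)"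
  have gb: "\<bar>g k\<bar> \<le> \<bar>u\<bar>" for k by (auto simp: g_def abs_mult split: split_indicator)
  have tg: "total g v = u * total (indicator A) v" for v by (induction v) (simp_all add: g_def algebra_simps)
  have mg: "bmean g = u * bmean (indicator A)" by (simp add: bmean_def g_def)
  have vg: "bvar g = u\<^sup>2 * bvar (indicator A)"
    by (simp add: bvar_def tg mg power_mult_distrib flip: right_diff_distrib)
  have "charf (gaussian 0 ?s) u = of_real (exp (- bvar g / 2))"
    using char_gaussian[OF s, of u] bvar_nonneg[of "indicator A"]
    by (simp add: charf_def char_def vg power_mult_distrib mult.commute)
  moreover have "u \<bullet> ((real (NC A t) - real n * measure_pmf.prob \<mu> A / p_B) / sqrt (real n))
      = (total g (code t) - real n * bmean g) / sqrt (real n)" for t n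
    by (simp add: tg mg NC_total bmean_indicator right_diff_distrib)
  ultimately show "((\<lambda>n. measure_pmf.expectation (map_pmf
       (\<lambda>t. (real (NC A t) - real n * measure_pmf.prob \<mu> A / p_B) / sqrt (real n)) (gw_cond \<mu> B n))
      (\<lambda>x. iexp (u \<bullet> x))) \<longlongrightarrow> charf (gaussian 0 ?s) u) (inf at_top (principal (admissible \<mu> B)))"
    using clt_along_admissible[OF gb] by (simp only: integral_map_pmf along_admissible_def)
qed

text \<open>Cramer-Wold: a linear combination of the counts is again the total of a bounded function
  of the letters. The limit has the covariance of the counts in one block, possibly degenerate,
  which is why the Gaussian law is built from a semidefinite form.\<close>

lemma conv_distr_counts:
  fixes As :: "'j::finite \<Rightarrow> nat set"
  shows "\<exists>M. gaussian_vector M \<and> conv_distr (along_admissible \<mu> B)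
    (\<lambda>n. measure_pmf (map_pmf
       (\<lambda>t. \<chi> i. (real (NC (As i) t) - real n * measure_pmf.prob \<mu> (As i) / p_B) / sqrt (real n)) (gw_cond \<mu> B n))) M"
proof -
  define g where "g u k = (\<Sum>i\<in>UNIV. u $ i * indicator (As i) k)" for u :: "real ^ 'j" and k
  define c where "c u = (\<Sum>i\<in>UNIV. \<bar>u $ i\<bar>)" for u :: "real ^ 'j"
  have gb: "\<bar>g u k\<bar> \<le> c u" for u k
  proof -
    have "\<bar>\<Sum>i\<in>UNIV. u $ i * indicator (As i) k\<bar> \<le> (\<Sum>i\<in>UNIV. \<bar>u $ i * indicator (As i) k\<bar>)"
      by (rule sum_abs)
    also have "\<dots> \<le> (\<Sum>i\<in>UNIV. \<bar>u $ i\<bar>)"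
      by (rule sum_mono) (simp add: abs_mult split: split_indicator)
    finally show ?thesis
      unfolding g_def c_def .
  qed
  have tg: "total (g u) v = (\<Sum>i\<in>UNIV. u $ i * total (indicator (As i)) v)" for u v
    by (induction v) (simp_all add: g_def distrib_left sum.distrib)
  have mg: "bmean (g u) = (\<Sum>i\<in>UNIV. u $ i * bmean (indicator (As i)))" for u
  proof -
    have "integrable \<mu> (\<lambda>k. u $ i * indicator (As i) k)" for i
      by (rule integrable_pmf_bounded[where C = "\<bar>u $ i\<bar>"]) (simp split: split_indicator)
    then have "measure_pmf.expectation \<mu> (g u) = (\<Sum>i\<in>UNIV. u $ i * measure_pmf.prob \<mu> (As i))"
      unfolding g_def by (subst Bochner_Integration.integral_sum) auto
    then show ?thesis by (simp add: bmean_def sum_divide_distrib)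
  qed
  define Z where "Z u b = total (g u) b - bmean (g u)" for u b
  have linZ: "Z (x + y) b = Z x b + Z y b" "Z (r *\<^sub>R x) b = r * Z x b" for x y r b
    by (simp_all add: Z_def tg mg distrib_right sum.distrib sum_distrib_left right_diff_distrib mult.assoc)
  have iZ: "integrable block (\<lambda>b. (Z u b)\<^sup>2)" for u
    unfolding Z_def using gb by (rule integrable_block_total_power) simp
  have iZZ: "integrable block (\<lambda>b. Z x b * Z y b)" for x y
  proof -
    \<comment> \<open>Polarisation reduces the integrability of products to that of squares.\<close>
    have "Z x b * Z y b = ((Z (x + y) b)\<^sup>2 - (Z x b)\<^sup>2 - (Z y b)\<^sup>2) / 2" for b
      by (simp add: linZ power2_eq_square algebra_simps)
    then have eq: "(\<lambda>b. Z x b * Z y b) = (\<lambda>b. ((Z (x + y) b)\<^sup>2 - (Z x b)\<^sup>2 - (Z y b)\<^sup>2) / 2)"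
      by (rule ext)
    show ?thesis unfolding eq by (intro Bochner_Integration.integrable_diff integrable_divide iZ)
  qed
  define Q where "Q x y = measure_pmf.expectation block (\<lambda>b. Z x b * Z y b)" for x y
  have Q: "linear (Q x)" "Q x y = Q y x" "0 \<le> Q x x" for x y
  proof -
    show "linear (Q x)"
      by (rule linearI) (simp_all add: Q_def linZ distrib_left iZZ mult.left_commute[of _ r for r])
    show "Q x y = Q y x" by (simp add: Q_def mult.commute)
    show "0 \<le> Q x x" unfolding Q_def by (rule integral_nonneg_AE) simp
  qed
  have QV: "Q u u = bvar (g u)" for u by (simp add: Q_def bvar_def Z_def power2_eq_square)
  obtain M where M: "prob_space M" "sets M = sets borel" "\<And>u. charf M u = of_real (exp (- Q u u / 2))"
    using gaussian_measure_exists[of Q] Q by blast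
  have "conv_distr (inf at_top (principal (admissible \<mu> B)))
    (\<lambda>n. measure_pmf (map_pmf
       (\<lambda>t. \<chi> i. (real (NC (As i) t) - real n * measure_pmf.prob \<mu> (As i) / p_B) / sqrt (real n)) (gw_cond \<mu> B n))) M"
  proof (rule conv_distr_along[OF M(1,2)])
    fix u :: "real ^ 'j"
    have "u \<bullet> (\<chi> i. (real (NC (As i) t) - real n * measure_pmf.prob \<mu> (As i) / p_B) / sqrt (real n))
        = (total (g u) (code t) - real n * bmean (g u)) / sqrt (real n)" for t n
      by (simp add: inner_vec_def tg mg NC_total bmean_indicator sum_distrib_left sum_divide_distrib
          right_diff_distrib diff_divide_distrib sum_subtractf mult.left_commute)
    then show "((\<lambda>n. measure_pmf.expectation (map_pmf
         (\<lambda>t. \<chi> i. (real (NC (As i) t) - real n * measure_pmf.prob \<mu> (As i) / p_B) / sqrt (real n)) (gw_cond \<mu> B n))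
        (\<lambda>x. iexp (u \<bullet> x))) \<longlongrightarrow> charf M u) (inf at_top (principal (admissible \<mu> B)))"
      using clt_along_admissible[OF gb, of u] by (simp only: integral_map_pmf M(3) QV along_admissible_def)
  qed
  then show ?thesis
    using gaussian_vectorI[OF M Q] unfolding along_admissible_def by blast
qed

end

theorem theorem6p2:
  fixes \<mu> :: "nat pmf" and \<alpha> :: real and A B :: "nat set"
  assumes "critical \<mu>" and "infinite_variance \<mu>"
    and "1 < \<alpha>" and "\<alpha> \<le> 2" and "stable_domain \<mu> \<alpha>"
    and "measure_pmf.prob \<mu> B > 0"
  shows
    "((\<lambda>n. measure_pmf.expectation (gw_cond \<mu> B n) (\<lambda>t. real (NC A t)) / real n)
        \<longlongrightarrow> measure_pmf.prob \<mu> A / measure_pmf.prob \<mu> B) (along_admissible \<mu> B)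
   \<and> (\<exists>\<delta>\<ge>0. conv_distr (along_admissible \<mu> B)
        (\<lambda>n. measure_pmf (map_pmf
           (\<lambda>t. (real (NC A t) - real n * measure_pmf.prob \<mu> A / measure_pmf.prob \<mu> B) / sqrt (real n))
           (gw_cond \<mu> B n)))
        (gaussian 0 \<delta>)
      \<and> (\<delta> = 0 \<longleftrightarrow> measure_pmf.prob \<mu> A = 0 \<or>
            (measure_pmf.prob \<mu> (A - B) = 0 \<and> measure_pmf.prob \<mu> (B - A) = 0)))
   \<and> (\<forall>As :: 'j::finite \<Rightarrow> nat set. \<exists>M. gaussian_vector M \<and>
       conv_distr (along_admissible \<mu> B)
        (\<lambda>n. measure_pmf (map_pmf
           (\<lambda>t. \<chi> i. (real (NC (As i) t) - real n * measure_pmf.prob \<mu> (As i) / measure_pmf.prob \<mu> B)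
                      / sqrt (real n))
           (gw_cond \<mu> B n)))
        M)"
proof -
  interpret stable_blocks \<mu> \<alpha> B
    by unfold_locales (use assms in auto)
  show ?thesis
  proof (intro conjI allI)
    show "\<exists>\<delta>\<ge>0. conv_distr (along_admissible \<mu> B)
        (\<lambda>n. measure_pmf (map_pmf
           (\<lambda>t. (real (NC A t) - real n * measure_pmf.prob \<mu> A / measure_pmf.prob \<mu> B) / sqrt (real n))
           (gw_cond \<mu> B n)))
        (gaussian 0 \<delta>)
      \<and> (\<delta> = 0 \<longleftrightarrow> measure_pmf.prob \<mu> A = 0 \<or>
            (measure_pmf.prob \<mu> (A - B) = 0 \<and> measure_pmf.prob \<mu> (B - A) = 0))"
      using conv_distr_count[of A] bvar_zero_iff[of A] bvar_nonneg[of "indicator A"]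
      by (intro exI[of _ "sqrt (bvar (indicator A))"]) simp
  qed (rule prob_along_admissible_mean conv_distr_counts)+
qed

end
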